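(* Let $H\in(0,1)$ and let $h$ be a positive function slowly varying at $+\infty$ such that $\mathbf{Var}(S_n)=h^2(n)n^{2H}$ for all $n\ge1$, and suppose that $\mathbf{E}|\xi_1|^\alpha<\infty$ for some $\alpha$ with $\alpha\ge2$ and $\alpha H>1$. Then, as $n\to\infty$, the processes $S_{[nt]}/\sqrt{\mathbf{Var}(S_n)}$, $t\in[0,1]$, $C$-converge in $D[0,1]$ to $B_H(t)$.
   Context: Setting. $\{\xi_k;\,k\in\mathbb{Z}\}$ are i.i.d. real random variables with mean zero and variance one; $\{a_k;\,k\in\mathbb{Z}\}$ is a nonrandom square summable sequence of real numbers; $X_j=\sum_{k=-\infty}^{\infty}a_{j-k}\xi_k$ for $j\in\mathbb{Z}$; $S_0=0$ and $S_n=\sum_{i=1}^nX_i$ for $n\ge1$. $[x]$ is the largest integer not exceeding $x$. A function $g$ is slowly varying at $+\infty$ if $g(cx)/g(x)\to1$ as $x\to+\infty$ for every $c>0$. $B_H$ is fractional Brownian motion: the centered Gaussian process with continuous paths and covariance $\frac12(t^{2H}+s^{2H}-|t-s|^{2H})$. $C$-convergence in $D[0,1]$ of processes $Y_n$ to a process $Y$ with continuous paths means: for every functional $F:D[0,1]\to\mathbb{R}$ that is measurable with respect to the Borel $\sigma$-algebra of Skorokhod's topology and continuous in the uniform topology at every point of $C[0,1]$, $F(Y_n)$ converges in distribution to $F(Y)$. *)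

theory Defs
  imports "HOL-Probability.Probability"
begin

subsection \<open>Slow variation, linear processes\<close>

definition slowly_varying :: "(real \<Rightarrow> real) \<Rightarrow> bool" where
  "slowly_varying g \<longleftrightarrow> (\<forall>c>0. ((\<lambda>x. g (c * x) / g x) \<longlongrightarrow> 1) at_top)"

definition iid :: "'a measure \<Rightarrow> (int \<Rightarrow> 'a \<Rightarrow> real) \<Rightarrow> bool" where
  "iid M \<xi> \<longleftrightarrow> prob_space.indep_vars M (\<lambda>_. borel) \<xi> UNIV \<and>
     (\<forall>j k. distr M borel (\<xi> j) = distr M borel (\<xi> k))"

text \<open>
  The two-sided series is split at \<open>k = 0\<close> because it converges only conditionally:
  for centred i.i.d. square integrable \<open>\<xi>\<close> and square summable \<open>a\<close> both one-sided
  series converge almost surely and in mean square, but in general not absolutely.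
  On the null set where one of them diverges the value is immaterial.
\<close>

definition linear_process :: "(int \<Rightarrow> real) \<Rightarrow> (int \<Rightarrow> 'a \<Rightarrow> real) \<Rightarrow> int \<Rightarrow> 'a \<Rightarrow> real" where
  "linear_process a \<xi> j \<omega> =
     (\<Sum>k. a (j - int k) * \<xi> (int k) \<omega>) +
     (\<Sum>k. a (j - (- int (Suc k))) * \<xi> (- int (Suc k)) \<omega>)"

definition linear_process_sum :: "(int \<Rightarrow> real) \<Rightarrow> (int \<Rightarrow> 'a \<Rightarrow> real) \<Rightarrow> nat \<Rightarrow> 'a \<Rightarrow> real" where
  "linear_process_sum a \<xi> n \<omega> = (\<Sum>i=1..n. linear_process a \<xi> (int i) \<omega>)"

subsection \<open>Fractional Brownian motion\<close>

text \<open>Almost surely constant random variables count as (degenerate) Gaussian.\<close>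

definition gaussian_rv :: "'a measure \<Rightarrow> ('a \<Rightarrow> real) \<Rightarrow> bool" where
  "gaussian_rv M X \<longleftrightarrow> X \<in> borel_measurable M \<and>
     ((\<exists>m. AE \<omega> in M. X \<omega> = m) \<or>
      (\<exists>m \<sigma>. \<sigma> > 0 \<and> distributed M lborel X (\<lambda>x. ennreal (normal_density m \<sigma> x))))"

definition gaussian_process_on ::
    "real set \<Rightarrow> 'a measure \<Rightarrow> (real \<Rightarrow> 'a \<Rightarrow> real) \<Rightarrow> bool" where
  "gaussian_process_on I M B \<longleftrightarrow>
     (\<forall>T c. finite T \<and> T \<subseteq> I \<longrightarrow> gaussian_rv M (\<lambda>\<omega>. \<Sum>t\<in>T. c t * B t \<omega>))"

text \<open>Since the process is centred, the covariance is the expectation of the product.\<close>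

definition fractional_BM_on ::
    "real set \<Rightarrow> real \<Rightarrow> 'a measure \<Rightarrow> (real \<Rightarrow> 'a \<Rightarrow> real) \<Rightarrow> bool" where
  "fractional_BM_on I H M B \<longleftrightarrow>
     prob_space M \<and>
     gaussian_process_on I M B \<and>
     (\<forall>t\<in>I. prob_space.expectation M (B t) = 0) \<and>
     (\<forall>s\<in>I. \<forall>t\<in>I. prob_space.expectation M (\<lambda>\<omega>. B s \<omega> * B t \<omega>) =
        (t powr (2 * H) + s powr (2 * H) - \<bar>t - s\<bar> powr (2 * H)) / 2) \<and>
     (\<forall>\<omega>\<in>space M. continuous_on I (\<lambda>t. B t \<omega>))"

subsection \<open>The space \<open>D[0,1]\<close>\<close>

text \<open>
  Functions on \<open>[0,1]\<close> are represented by functions on the reals that are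
  \<^const>\<open>undefined\<close> outside \<open>[0,1]\<close>, so that equality is equality on \<open>[0,1]\<close>.
\<close>

definition D01 :: "(real \<Rightarrow> real) set" where
  "D01 = {f \<in> extensional {0..1}.
     (\<forall>t\<in>{0..<1}. (f \<longlongrightarrow> f t) (at_right t)) \<and>
     (\<forall>t\<in>{0<..1}. \<exists>l. (f \<longlongrightarrow> l) (at_left t))}"

definition C01 :: "(real \<Rightarrow> real) set" where
  "C01 = {f \<in> extensional {0..1}. continuous_on {0..1} f}"

definition time_changes :: "(real \<Rightarrow> real) set" where
  "time_changes =
     {l. continuous_on {0..1} l \<and> strict_mono_on {0..1} l \<and> l ` {0..1} = {0..1}}"

text \<open>The value outside \<open>D[0,1]\<close> is irrelevant; it is chosen so that
  \<^locale>\<open>Metric_space\<close> applies, which asks for symmetry and nonnegativity everywhere.\<close>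

definition skorokhod_dist :: "(real \<Rightarrow> real) \<Rightarrow> (real \<Rightarrow> real) \<Rightarrow> real" where
  "skorokhod_dist f g =
     (if f \<in> D01 \<and> g \<in> D01 then
        INF l\<in>time_changes. max (SUP t\<in>{0..1}. \<bar>l t - t\<bar>) (SUP t\<in>{0..1}. \<bar>f t - g (l t)\<bar>)
      else 0)"

definition skorokhod_topology :: "(real \<Rightarrow> real) topology" where
  "skorokhod_topology = Metric_space.mtopology D01 skorokhod_dist"

definition skorokhod_borel :: "(real \<Rightarrow> real) measure" where
  "skorokhod_borel = sigma D01 {U. openin skorokhod_topology U}"

text \<open>\<^term>\<open>funspace S m\<close> carries the supremum metric.\<close>

definition uniform_topology :: "(real \<Rightarrow> real) topology" where
  "uniform_topology = subtopology (mtopology_of (funspace {0..1} euclidean_metric)) D01"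

subsection \<open>C-convergence\<close>

text \<open>The measurability conditions say that \<open>Y n\<close> and \<open>Z\<close> are random elements of
  \<open>D[0,1]\<close>; they make the image measures below probability distributions.\<close>

definition C_converges ::
    "'a measure \<Rightarrow> (nat \<Rightarrow> 'a \<Rightarrow> real \<Rightarrow> real) \<Rightarrow> 'b measure \<Rightarrow> ('b \<Rightarrow> real \<Rightarrow> real) \<Rightarrow> bool" where
  "C_converges M Y N Z \<longleftrightarrow>
     (\<forall>n. Y n \<in> measurable M skorokhod_borel) \<and>
     Z \<in> measurable N skorokhod_borel \<and>
     (\<forall>\<omega>\<in>space N. Z \<omega> \<in> C01) \<and>
     (\<forall>F \<in> borel_measurable skorokhod_borel.
        (\<forall>f\<in>C01. topcontinuous_at uniform_topology euclideanreal F f) \<longrightarrow>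
        weak_conv_m (\<lambda>n. distr M borel (\<lambda>\<omega>. F (Y n \<omega>))) (distr N borel (\<lambda>\<omega>. F (Z \<omega>))))"

subsection \<open>Well-definedness of the topologies\<close>

lemma C01_subset_D01: "C01 \<subseteq> D01"
proof
  fix f assume f: "f \<in> C01"
  have lim: "(f \<longlongrightarrow> f t) (at t within {0..1})" if "t \<in> {0..1}" for t
    using f that by (auto simp: C01_def continuous_on_def)
  have "(f \<longlongrightarrow> f t) (at_right t)" if t: "t \<in> {0..<1}" for t
  proof -
    have "(f \<longlongrightarrow> f t) (at t within {t..1})"
      by (rule tendsto_within_subset[OF lim]) (use t in auto)
    then show ?thesis using t by (simp add: at_within_Icc_at_right)
  qed
  moreover have "(f \<longlongrightarrow> f t) (at_left t)" if t: "t \<in> {0<..1}" for t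
  proof -
    have "(f \<longlongrightarrow> f t) (at t within {0..t})"
      by (rule tendsto_within_subset[OF lim]) (use t in auto)
    then show ?thesis using t by (simp add: at_within_Icc_at_left)
  qed
  ultimately show "f \<in> D01"
    using f unfolding D01_def C01_def by blast
qed

lemma D01_right:
  assumes "f \<in> D01" "0 \<le> t" "t < 1" "e > 0"
  obtains d where "d > 0" "\<And>s. t \<le> s \<Longrightarrow> s < t + d \<Longrightarrow> \<bar>f s - f t\<bar> < e"
proof -
  have "(f \<longlongrightarrow> f t) (at_right t)"
    using assms by (auto simp: D01_def)
  then have "\<forall>\<^sub>F s in at_right t. dist (f s) (f t) < e"
    using assms(4) by (rule tendstoD)
  then obtain b where b: "b > t" "\<And>s. t < s \<Longrightarrow> s < b \<Longrightarrow> dist (f s) (f t) < e"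
    unfolding eventually_at_right_field by blast
  show thesis
  proof (rule that[of "b - t"])
    show "\<bar>f s - f t\<bar> < e" if "t \<le> s" "s < t + (b - t)" for s
      using b(2)[of s] that assms(4) by (cases "s = t") (auto simp: dist_real_def)
  qed (use b in auto)
qed

lemma D01_left:
  assumes "f \<in> D01" "0 < t" "t \<le> 1" "e > 0"
  obtains d l where "d > 0" "\<And>s. t - d < s \<Longrightarrow> s < t \<Longrightarrow> \<bar>f s - l\<bar> < e"
proof -
  obtain l where "(f \<longlongrightarrow> l) (at_left t)"
    using assms by (force simp: D01_def)
  then have "\<forall>\<^sub>F s in at_left t. dist (f s) l < e"
    using assms(4) by (rule tendstoD)
  then obtain b where b: "b < t" "\<And>s. b < s \<Longrightarrow> s < t \<Longrightarrow> dist (f s) l < e"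
    unfolding eventually_at_left_field by blast
  show thesis
    by (rule that[of "t - b" l]) (use b in \<open>auto simp: dist_real_def\<close>)
qed

lemma D01_bounded:
  assumes f: "f \<in> D01"
  shows "bounded (f ` {0..1})"
proof -
  define P where "P a b \<longleftrightarrow> bounded (f ` ({a..b} \<inter> {0..1}))" for a b
  have "P 0 1"
  proof (rule Bolzano)
    show "(0::real) \<le> 1" by simp
  next
    fix a b c :: real assume "P a b" "P b c" "a \<le> b" "b \<le> c"
    then have "bounded (f ` ({a..b} \<inter> {0..1}) \<union> f ` ({b..c} \<inter> {0..1}))"
      by (simp add: P_def)
    moreover have "f ` ({a..c} \<inter> {0..1}) \<subseteq> f ` ({a..b} \<inter> {0..1}) \<union> f ` ({b..c} \<inter> {0..1})"
      by force
    ultimately show "P a c" unfolding P_def by (rule bounded_subset)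
  next
    fix x :: real assume x: "0 \<le> x" "x \<le> 1"
    have "\<exists>d>0. \<exists>C. \<forall>s\<in>{0..1}. x < s \<and> s < x + d \<longrightarrow> \<bar>f s\<bar> \<le> C"
    proof (cases "x = 1")
      case True then show ?thesis by (intro exI[of _ 1]) auto
    next
      case False
      then obtain d where "d > 0" and d: "\<And>s. x \<le> s \<Longrightarrow> s < x + d \<Longrightarrow> \<bar>f s - f x\<bar> < 1"
        using D01_right[OF f, of x 1] x by auto
      show ?thesis
      proof (intro exI conjI ballI impI)
        show "\<bar>f s\<bar> \<le> \<bar>f x\<bar> + 1" if "x < s \<and> s < x + d" for s
          using d[of s] that by auto
      qed fact
    qed
    then obtain d1 C1 where 1: "d1 > 0" "\<And>s. s \<in> {0..1} \<Longrightarrow> x < s \<Longrightarrow> s < x + d1 \<Longrightarrow> \<bar>f s\<bar> \<le> C1"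
      by blast
    have "\<exists>d>0. \<exists>C. \<forall>s\<in>{0..1}. x - d < s \<and> s < x \<longrightarrow> \<bar>f s\<bar> \<le> C"
    proof (cases "x = 0")
      case True then show ?thesis by (intro exI[of _ 1]) auto
    next
      case False
      then obtain d l where "d > 0" and d: "\<And>s. x - d < s \<Longrightarrow> s < x \<Longrightarrow> \<bar>f s - l\<bar> < 1"
        using D01_left[OF f, of x 1] x by auto
      show ?thesis
      proof (intro exI conjI ballI impI)
        show "\<bar>f s\<bar> \<le> \<bar>l\<bar> + 1" if "x - d < s \<and> s < x" for s
          using d[of s] that by auto
      qed fact
    qed
    then obtain d2 C2 where 2: "d2 > 0" "\<And>s. s \<in> {0..1} \<Longrightarrow> x - d2 < s \<Longrightarrow> s < x \<Longrightarrow> \<bar>f s\<bar> \<le> C2"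
      by blast
    show "\<exists>d>0. \<forall>a b. a \<le> x \<and> x \<le> b \<and> b - a < d \<longrightarrow> P a b"
    proof (intro exI[of _ "min d1 d2"] conjI allI impI)
      show "min d1 d2 > 0" using 1 2 by simp
      fix a b assume ab: "a \<le> x \<and> x \<le> b \<and> b - a < min d1 d2"
      show "P a b"
        unfolding P_def bounded_iff
      proof (intro exI ballI)
        fix y assume "y \<in> f ` ({a..b} \<inter> {0..1})"
        then obtain s where s: "s \<in> {a..b}" "s \<in> {0..1}" "y = f s" by auto
        consider "s = x" | "x < s" "s < x + d1" | "s < x" "x - d2 < s"
          using s ab by fastforce
        then show "norm y \<le> max \<bar>f x\<bar> (max C1 C2)"
          by cases (use s 1(2)[of s] 2(2)[of s] in auto)
      qed
    qed
  qed
  then show ?thesis by (simp add: P_def)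
qed

lemma D01_subset_funspace: "D01 \<subseteq> mspace (funspace {0..1} euclidean_metric)"
proof
  fix f assume f: "f \<in> D01"
  have "Met_TC.mbounded (f ` {0..1})"
    using D01_bounded[OF f] by simp
  then show "f \<in> mspace (funspace {0..1} euclidean_metric)"
    using f by (auto simp: D01_def Met_TC.fspace_def)
qed

lemma topspace_uniform_topology: "topspace uniform_topology = D01"
proof -
  have "topspace (mtopology_of (funspace {0..1} euclidean_metric)) =
      mspace (funspace {0..1} euclidean_metric :: (real \<Rightarrow> real) metric)"
    by (rule topspace_mtopology_of)
  then show ?thesis
    unfolding uniform_topology_def topspace_subtopology using D01_subset_funspace by blast
qed

lemma time_changes_id: "(\<lambda>t. t) \<in> time_changes"
  by (auto simp: time_changes_def strict_mono_on_def)

lemma time_changes_mem: "l \<in> time_changes \<Longrightarrow> t \<in> {0..1} \<Longrightarrow> l t \<in> {0..1}"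
  by (auto simp: time_changes_def)

lemma time_changes_one:
  assumes l: "l \<in> time_changes" shows "l 1 = 1"
proof -
  have "1 \<in> l ` {0..1}" using l by (simp add: time_changes_def)
  then obtain s where s: "s \<in> {0..1}" "l s = 1" by (metis imageE)
  have "l s \<le> l 1"
  proof (cases "s = 1")
    case False
    then have "s < 1" using s by simp
    then show ?thesis
      using l s strict_mono_onD[of "{0..1}" l s 1] unfolding time_changes_def by simp
  qed simp
  then show ?thesis using s time_changes_mem[OF l, of 1] by auto
qed

lemma time_changes_comp:
  assumes l: "l \<in> time_changes" and m: "m \<in> time_changes"
  shows "(\<lambda>t. m (l t)) \<in> time_changes"
proof -
  have "continuous_on {0..1} (\<lambda>t. m (l t))"
    by (rule continuous_on_compose2[of "{0..1}" m]) (use l m in \<open>auto simp: time_changes_def\<close>)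
  moreover have "strict_mono_on {0..1} (\<lambda>t. m (l t))"
  proof (rule strict_mono_onI)
    fix r s :: real assume rs: "r \<in> {0..1}" "s \<in> {0..1}" "r < s"
    then have "l r < l s" using l strict_mono_onD unfolding time_changes_def by blast
    then show "m (l r) < m (l s)"
      using m strict_mono_onD[of "{0..1}" m] time_changes_mem[OF l rs(1)] time_changes_mem[OF l rs(2)]
      unfolding time_changes_def by blast
  qed
  moreover have "(\<lambda>t. m (l t)) ` {0..1} = {0..1}"
  proof -
    have "(\<lambda>t. m (l t)) ` {0..1} = m ` l ` {0..1}" by (simp only: image_image)
    also have "\<dots> = {0..1}" using l m unfolding time_changes_def by simp
    finally show ?thesis .
  qed
  ultimately show ?thesis by (simp add: time_changes_def)
qed

lemma time_changes_inv:
  assumes l: "l \<in> time_changes"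
  obtains m where "m \<in> time_changes"
    "\<And>t. t \<in> {0..1} \<Longrightarrow> m (l t) = t" "\<And>t. t \<in> {0..1} \<Longrightarrow> l (m t) = t"
proof -
  have cont: "continuous_on {0..1} l" and mono: "strict_mono_on {0..1} l"
    and img: "l ` {0..1} = {0..1}"
    using l by (auto simp: time_changes_def)
  have inj: "inj_on l {0..1}"
    using mono by (rule strict_mono_on_imp_inj_on)
  define m where "m = inv_into {0..1} l"
  have ml: "m (l t) = t" if "t \<in> {0..1}" for t
    using that inj by (simp add: m_def)
  have lm: "l (m t) = t" and m_in: "m t \<in> {0..1}" if "t \<in> {0..1}" for t
    using that img f_inv_into_f[of t l "{0..1}"] inv_into_into[of t l "{0..1}"]
    unfolding m_def by blast+
  have "continuous_on (l ` {0..1}) m"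
    by (rule continuous_on_inv) (use cont ml in auto)
  moreover have "strict_mono_on {0..1} m"
  proof (rule strict_mono_onI)
    fix r s :: real assume rs: "r \<in> {0..1}" "s \<in> {0..1}" "r < s"
    show "m r < m s"
    proof (rule ccontr)
      assume "\<not> m r < m s"
      then have "l (m s) \<le> l (m r)"
        using strict_mono_onD[OF mono m_in[OF rs(2)] m_in[OF rs(1)]]
        by (cases "m s = m r") auto
      then show False using rs lm by simp
    qed
  qed
  moreover have "m ` {0..1} = {0..1}"
    unfolding m_def using inv_into_image_cancel[OF inj, of "{0..1}"] img by simp
  ultimately show thesis
    using that[of m] ml lm img by (simp add: time_changes_def)
qed

lemma skorokhod_dist_less_iff:
  assumes f: "f \<in> D01" and g: "g \<in> D01"
  shows "skorokhod_dist f g < e \<longleftrightarrow>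
    (\<exists>l\<in>time_changes. \<exists>e'<e. \<forall>t\<in>{0..1}. \<bar>l t - t\<bar> \<le> e' \<and> \<bar>f t - g (l t)\<bar> \<le> e')"
proof -
  define E where "E l = max (SUP t\<in>{0..1}. \<bar>l t - t\<bar>) (SUP t\<in>{0..1}. \<bar>f t - g (l t)\<bar>)" for l
  obtain A where A: "\<And>t. t \<in> {0..1} \<Longrightarrow> \<bar>f t\<bar> \<le> A"
    using D01_bounded[OF f] unfolding bounded_iff real_norm_def by blast
  obtain B where B: "\<And>t. t \<in> {0..1} \<Longrightarrow> \<bar>g t\<bar> \<le> B"
    using D01_bounded[OF g] unfolding bounded_iff real_norm_def by blast
  have E_le_iff: "E l \<le> e' \<longleftrightarrow> (\<forall>t\<in>{0..1}. \<bar>l t - t\<bar> \<le> e' \<and> \<bar>f t - g (l t)\<bar> \<le> e')"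
    if l: "l \<in> time_changes" for l e'
  proof -
    have "bdd_above ((\<lambda>t. \<bar>l t - t\<bar>) ` {0..1})"
    proof (rule bdd_aboveI2)
      show "\<bar>l t - t\<bar> \<le> 1" if "t \<in> {0..1}" for t
        using time_changes_mem[OF l that] that by auto
    qed
    moreover have "bdd_above ((\<lambda>t. \<bar>f t - g (l t)\<bar>) ` {0..1})"
    proof (rule bdd_aboveI2)
      show "\<bar>f t - g (l t)\<bar> \<le> A + B" if "t \<in> {0..1}" for t
        using A[OF that] B[OF time_changes_mem[OF l that]] by auto
    qed
    moreover have "{0..1::real} \<noteq> {}" by simp
    ultimately show ?thesis
      unfolding E_def max.bounded_iff by (simp add: cSUP_le_iff ball_conj_distrib)
  qed
  have "0 \<le> E l" if "l \<in> time_changes" for l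
  proof -
    have "\<forall>t\<in>{0..1}. \<bar>l t - t\<bar> \<le> E l \<and> \<bar>f t - g (l t)\<bar> \<le> E l"
      using E_le_iff[OF that, of "E l"] by blast
    then have "\<bar>l 0 - 0\<bar> \<le> E l" by (meson atLeastAtMost_iff order_refl zero_le_one)
    then show ?thesis by linarith
  qed
  then have "bdd_below (E ` time_changes)" by (intro bdd_belowI2[where m = 0])
  moreover have "time_changes \<noteq> {}" using time_changes_id by blast
  ultimately have "(INF l\<in>time_changes. E l) < e \<longleftrightarrow> (\<exists>l\<in>time_changes. E l < e)"
    by (intro cINF_less_iff)
  moreover have "skorokhod_dist f g = (INF l\<in>time_changes. E l)"
    using f g unfolding skorokhod_dist_def E_def by simp
  ultimately have "skorokhod_dist f g < e \<longleftrightarrow> (\<exists>l\<in>time_changes. E l < e)"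
    by simp
  also have "\<dots> \<longleftrightarrow> (\<exists>l\<in>time_changes. \<exists>e'<e. E l \<le> e')"
    by (meson le_less_trans order_refl)
  also have "\<dots> \<longleftrightarrow> (\<exists>l\<in>time_changes. \<exists>e'<e. \<forall>t\<in>{0..1}. \<bar>l t - t\<bar> \<le> e' \<and> \<bar>f t - g (l t)\<bar> \<le> e')"
    using E_le_iff by (intro bex_cong ex_cong conj_cong refl) blast
  finally show ?thesis .
qed

lemma skorokhod_dist_nonneg: "0 \<le> skorokhod_dist f g"
proof (cases "f \<in> D01 \<and> g \<in> D01")
  case True
  show ?thesis
  proof (rule ccontr)
    assume "\<not> 0 \<le> skorokhod_dist f g"
    then obtain l e' where "e' < 0" and le: "\<forall>t\<in>{0..1}. \<bar>l t - t\<bar> \<le> e' \<and> \<bar>f t - g (l t)\<bar> \<le> e'"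
      using skorokhod_dist_less_iff[of f g 0] True by (meson not_le)
    then have "\<bar>l 0 - 0\<bar> \<le> e'" by (meson atLeastAtMost_iff order_refl zero_le_one)
    then show False using \<open>e' < 0\<close> by linarith
  qed
next
  case False
  then have "skorokhod_dist f g = 0" unfolding skorokhod_dist_def by (rule if_not_P)
  then show ?thesis by simp
qed

lemma skorokhod_dist_commute_le:
  assumes f: "f \<in> D01" and g: "g \<in> D01"
  shows "skorokhod_dist g f \<le> skorokhod_dist f g"
proof (rule dense_ge)
  fix e assume "skorokhod_dist f g < e"
  then obtain l e' where l: "l \<in> time_changes" and e': "e' < e"
    and le: "\<And>t. t \<in> {0..1} \<Longrightarrow> \<bar>l t - t\<bar> \<le> e' \<and> \<bar>f t - g (l t)\<bar> \<le> e'"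
    unfolding skorokhod_dist_less_iff[OF f g] by blast
  obtain m where m: "m \<in> time_changes" and lm: "\<And>t. t \<in> {0..1} \<Longrightarrow> l (m t) = t"
    using time_changes_inv[OF l] by metis
  have "\<bar>m t - t\<bar> \<le> e' \<and> \<bar>g t - f (m t)\<bar> \<le> e'" if t: "t \<in> {0..1}" for t
    using le[OF time_changes_mem[OF m t]] lm[OF t] by (simp add: abs_minus_commute)
  then have "skorokhod_dist g f < e"
    unfolding skorokhod_dist_less_iff[OF g f] using m e' by blast
  then show "skorokhod_dist g f \<le> e" by simp
qed

lemma skorokhod_dist_eq_0_imp:
  assumes f: "f \<in> D01" and g: "g \<in> D01" and 0: "skorokhod_dist f g = 0"
  shows "f = g"
proof (rule extensionalityI[of _ "{0..1}"])
  have close: "\<exists>l\<in>time_changes. \<forall>t\<in>{0..1}. \<bar>l t - t\<bar> < e \<and> \<bar>f t - g (l t)\<bar> < e" if "e > 0" for e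
  proof -
    have "skorokhod_dist f g < e" using that 0 by simp
    then obtain l e' where "l \<in> time_changes" "e' < e"
      "\<forall>t\<in>{0..1}. \<bar>l t - t\<bar> \<le> e' \<and> \<bar>f t - g (l t)\<bar> \<le> e'"
      unfolding skorokhod_dist_less_iff[OF f g] by blast
    then show ?thesis by (meson le_less_trans)
  qed
  fix t :: real assume t: "t \<in> {0..1}"
  have "\<bar>f t - g t\<bar> \<le> 0 + e" if e: "e > 0" for e
  proof (cases "t = 1")
    case True
    show ?thesis
    proof -
      obtain l where l: "l \<in> time_changes" and "\<forall>s\<in>{0..1}. \<bar>l s - s\<bar> < e \<and> \<bar>f s - g (l s)\<bar> < e"
        using close[OF e] by blast
      then have "\<bar>f t - g (l t)\<bar> < e" using t by blast
      then show ?thesis using time_changes_one[OF l] True by simp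
    qed
  next
    case False
    then have t': "0 \<le> t" "t < 1" using t by auto
    obtain d1 where d1: "d1 > 0" "\<And>s. t \<le> s \<Longrightarrow> s < t + d1 \<Longrightarrow> \<bar>f s - f t\<bar> < e / 3"
      using D01_right[OF f t', of "e / 3"] e by auto
    obtain d2 where d2: "d2 > 0" "\<And>s. t \<le> s \<Longrightarrow> s < t + d2 \<Longrightarrow> \<bar>g s - g t\<bar> < e / 3"
      using D01_right[OF g t', of "e / 3"] e by auto
    define d where "d = min (min d1 d2) (1 - t) / 2"
    have d: "d > 0" "2 * d \<le> d1" "2 * d \<le> d2" "2 * d \<le> 1 - t"
      using d1 d2 t' by (auto simp: d_def min_def)
    obtain l where l: "l \<in> time_changes"
      and le: "\<And>s. s \<in> {0..1} \<Longrightarrow> \<bar>l s - s\<bar> < min d (e / 3) \<and> \<bar>f s - g (l s)\<bar> < min d (e / 3)"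
      using close[of "min d (e / 3)"] d e by auto
    have s: "t + d \<in> {0..1}" using t' d by auto
    have ls: "t < l (t + d)" "l (t + d) < t + 2 * d" and fg: "\<bar>f (t + d) - g (l (t + d))\<bar> < e / 3"
      using le[OF s] by (auto simp: abs_if split: if_splits)
    have "\<bar>f (t + d) - f t\<bar> < e / 3" using d1(2)[of "t + d"] d by auto
    moreover have "\<bar>g (l (t + d)) - g t\<bar> < e / 3" using d2(2)[of "l (t + d)"] ls d by auto
    ultimately show ?thesis using fg by linarith
  qed
  then have "\<bar>f t - g t\<bar> \<le> 0" by (rule field_le_epsilon)
  then show "f t = g t" by simp
next
  show "f \<in> extensional {0..1}" "g \<in> extensional {0..1}"
    using f g unfolding D01_def by blast+
qed

lemma Metric_space_skorokhod: "Metric_space D01 skorokhod_dist"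
proof
  fix f g
  show "0 \<le> skorokhod_dist f g" by (rule skorokhod_dist_nonneg)
  show "skorokhod_dist f g = skorokhod_dist g f"
  proof (cases "f \<in> D01 \<and> g \<in> D01")
    case True
    then show ?thesis by (simp add: skorokhod_dist_commute_le order_antisym)
  next
    case False
    then show ?thesis unfolding skorokhod_dist_def by metis
  qed
next
  fix f g assume fg: "f \<in> D01" "g \<in> D01"
  have "skorokhod_dist f f = 0"
  proof (rule antisym)
    show "skorokhod_dist f f \<le> 0"
    proof (rule dense_ge)
      fix e :: real assume "0 < e"
      then have "skorokhod_dist f f < e"
        unfolding skorokhod_dist_less_iff[OF fg(1) fg(1)]
        by (intro bexI[OF _ time_changes_id] exI[of _ 0]) auto
      then show "skorokhod_dist f f \<le> e" by simp
    qed
    show "0 \<le> skorokhod_dist f f" by (rule skorokhod_dist_nonneg)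
  qed
  then show "skorokhod_dist f g = 0 \<longleftrightarrow> f = g"
    using skorokhod_dist_eq_0_imp[OF fg] by blast
next
  fix f g h assume f: "f \<in> D01" and g: "g \<in> D01" and h: "h \<in> D01"
  show "skorokhod_dist f h \<le> skorokhod_dist f g + skorokhod_dist g h"
  proof (rule field_le_epsilon)
    fix e :: real assume e: "e > 0"
    obtain l e1 where l: "l \<in> time_changes" and e1: "e1 < skorokhod_dist f g + e / 2"
      and le: "\<And>t. t \<in> {0..1} \<Longrightarrow> \<bar>l t - t\<bar> \<le> e1 \<and> \<bar>f t - g (l t)\<bar> \<le> e1"
      using skorokhod_dist_less_iff[OF f g, of "skorokhod_dist f g + e / 2"] e
      by (metis half_gt_zero less_add_same_cancel1)
    obtain m e2 where m: "m \<in> time_changes" and e2: "e2 < skorokhod_dist g h + e / 2"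
      and me: "\<And>t. t \<in> {0..1} \<Longrightarrow> \<bar>m t - t\<bar> \<le> e2 \<and> \<bar>g t - h (m t)\<bar> \<le> e2"
      using skorokhod_dist_less_iff[OF g h, of "skorokhod_dist g h + e / 2"] e
      by (metis half_gt_zero less_add_same_cancel1)
    have "\<bar>m (l t) - t\<bar> \<le> e1 + e2 \<and> \<bar>f t - h (m (l t))\<bar> \<le> e1 + e2" if t: "t \<in> {0..1}" for t
      using le[OF t] me[OF time_changes_mem[OF l t]] by linarith
    moreover have "e1 + e2 < skorokhod_dist f g + skorokhod_dist g h + e"
      using e1 e2 by linarith
    ultimately have "skorokhod_dist f h < skorokhod_dist f g + skorokhod_dist g h + e"
      unfolding skorokhod_dist_less_iff[OF f h]
      by (intro bexI[OF _ time_changes_comp[OF l m]] exI[of _ "e1 + e2"] conjI) blast+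
    then show "skorokhod_dist f h \<le> skorokhod_dist f g + skorokhod_dist g h + e" by simp
  qed
qed

interpretation Skorokhod: Metric_space D01 skorokhod_dist
  by (rule Metric_space_skorokhod)

lemma topspace_skorokhod_topology: "topspace skorokhod_topology = D01"
  by (simp add: skorokhod_topology_def)

lemma space_skorokhod_borel: "space skorokhod_borel = D01"
proof -
  have "{U. openin skorokhod_topology U} \<subseteq> Pow D01"
    using openin_subset[of skorokhod_topology] unfolding topspace_skorokhod_topology by blast
  then show ?thesis unfolding skorokhod_borel_def by (rule space_measure_of)
qed

end

theory Submission
  imports Defs
begin

text \<open>
  Let \<open>s n\<close> be the standard deviation of the \<open>n\<close>-th partial sum. Stationarity makes \<open>s\<close>
  subadditive, and together with \<open>s (q n) / s n \<longrightarrow> q\<^sup>H\<close> for integers \<open>q\<close> this gives Potter bounds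
  and \<open>s [nt] / s n \<longrightarrow> t\<^sup>H\<close> without any measurability of \<open>h\<close>. The partial sums are series
  \<open>\<Sum>k. c k * \<xi> k\<close> whose normalized coefficients tend to zero uniformly, which yields the Gaussian
  limit of the finite dimensional distributions. Moments of order \<open>\<alpha>\<close> of such series are bounded by
  powers of their variances, so the increments over \<open>j\<close> steps have \<open>\<alpha>\<close>-th moment of order
  \<open>(j / n)\<^sup>\<gamma>\<close> with \<open>\<gamma> > 1\<close>, and a dyadic maximal inequality controls the distance between the path
  and its step interpolation on a grid of mesh \<open>1 / m\<close>. A bounded functional that is continuous at
  continuous paths is bounded below by uniformly Lipschitz functionals increasing to it there, and
  these are evaluated at the step interpolations only; this avoids tightness on \<open>D[0,1]\<close>, where the
  uniform topology is not separable.
\<close>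

section \<open>Regularly growing seminorm sequences\<close>

text \<open>The hypothesis \<open>\<alpha> * H > 1\<close> leaves room for an exponent
  \<open>\<beta>\<close> with \<open>1 / \<alpha> < \<beta> < H\<close>. Potter's bound is available
  for every exponent below \<open>H\<close>, though in general not for \<open>H\<close> itself, and
  \<open>\<gamma> = \<beta> * \<alpha>\<close> still exceeds 1. Each of about \<open>m\<close> grid
  blocks has an oscillation whose moment of order \<alpha> is of order
  \<open>m powr (- \<gamma>)\<close>, so even the sum of these moments tends to 0 with the mesh. Two
  facts let \<open>s\<close> carry all covariances: the coefficients of an increment are a translate
  of those of a partial sum, and inner products follow from norms of differences by polarization.
  Hence the limit of \<open>s [nt] / s n\<close> already fixes the covariance of the limit process.
  In the limit theorem the Lipschitz constant is fixed before the mesh, and the mesh before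
  \<open>n\<close>, so that a small oscillation can be chosen against a known constant. Only lower
  bounds for expectations need proof, because a functional with values in [0,1] can be replaced by
  its complement.\<close>

lemma eventually_increasing_almost_increasing:
  fixes u :: "nat \<Rightarrow> real"
  assumes pos: "\<And>n. u n > 0" and inc: "\<forall>\<^sub>F n in sequentially. u n \<le> u (Suc n)"
  obtains C where "C > 0" "\<And>i j. i \<le> j \<Longrightarrow> u i \<le> C * u j"
proof -
  obtain J where J: "\<And>n. n \<ge> J \<Longrightarrow> u n \<le> u (Suc n)"
    using inc by (auto simp: eventually_sequentially)
  have mono: "u i \<le> u j" if "J \<le> i" "i \<le> j" for i j
    using that(2,1) by (induction rule: dec_induct) (auto intro: order_trans J)
  define a where "a = Min (u ` {..J})"
  define b where "b = Max (u ` {..J})"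
  have a: "a > 0" "\<And>i. i \<le> J \<Longrightarrow> a \<le> u i" and b: "\<And>i. i \<le> J \<Longrightarrow> u i \<le> b"
    using pos by (auto simp: a_def b_def)
  have ab: "a \<le> b" using a(2)[of J] b[of J] by simp
  show thesis
  \<comment> \<open>Up to \<open>J\<close> all values lie between \<open>a\<close> and
    \<open>b\<close>, and past \<open>J\<close> the sequence is monotone, so the ratio of the
    extremes pays for the unordered initial segment.\<close>
  proof (rule that[of "b / a"])
    show "b / a > 0" using a ab by simp
    fix i j :: nat assume ij: "i \<le> j"
    show "u i \<le> b / a * u j"
    proof (cases "i \<le> J")
      case True
      have "a \<le> u j"
      proof (cases "j \<le> J")
        case False
        then show ?thesis using mono[of J j] a(2)[of J] by simp
      qed (use a in simp)
      then have "b * a \<le> b * u j" using a ab by (intro mult_left_mono) auto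
      then have "b \<le> b / a * u j" using a by (simp add: field_simps)
      then show ?thesis using b[OF True] by simp
    next
      case False
      have "1 * u j \<le> b / a * u j" using a ab pos[of j] by (intro mult_right_mono) (auto simp: field_simps)
      then show ?thesis using mono[of i j] False ij by simp
    qed
  qed
qed

text \<open>In the application \<open>s n\<close> is the L2 norm of the \<open>n\<close>-th partial
  sum: \<open>s_diff\<close> is the reverse triangle inequality combined with stationarity, and
  \<open>s_ratio\<close> is regular variation of index \<open>H\<close> tested on integer dilations
  only.\<close>

locale regular_norm =
  fixes s :: "nat \<Rightarrow> real" and H :: real
  assumes H_pos: "0 < H"
    and s_0: "s 0 = 0"
    and s_pos: "\<And>n. n \<ge> 1 \<Longrightarrow> s n > 0"
    and s_diff: "\<And>m n. \<bar>s (m + n) - s n\<bar> \<le> s m"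
    and s_ratio: "\<And>q. q \<ge> 1 \<Longrightarrow> (\<lambda>n. s (q * n) / s n) \<longlonglongrightarrow> real q powr H"
begin

lemma s_nonneg: "s n \<ge> 0"
  using s_pos[of n] s_0 by (cases "n = 0") auto

lemma s_add: "s (m + n) \<le> s m + s n"
  using s_diff[of m n] by linarith

lemma s_diff': "m \<le> n \<Longrightarrow> \<bar>s n - s m\<bar> \<le> s (n - m)"
  using s_diff[of "n - m" m] by simp

section \<open>Potter bounds\<close>

lemma s_mult: "s (q * n) \<le> real q * s n"
proof (induction q)
  case (Suc q)
  then show ?case using s_add[of n "q * n"] by (simp add: algebra_simps)
qed (simp add: s_0)

text \<open>Binary expansion of \<open>m\<close>: every digit contributes at most one power of two,
  and subadditivity adds up their norms.\<close>

lemma s_sum_dyadic: "m < 2 ^ Suc j \<Longrightarrow> s m \<le> (\<Sum>i\<le>j. s (2 ^ i))"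
proof (induction j arbitrary: m)
  case 0
  then have "m = 0 \<or> m = 1" by auto
  then show ?case using s_0 s_nonneg by auto
next
  case (Suc j)
  show ?case
  proof (cases "m < 2 ^ Suc j")
    case True
    then show ?thesis using Suc.IH[OF True] s_nonneg[of "2 ^ Suc j"] by simp
  next
    case False
    then have m: "m = (m - 2 ^ Suc j) + 2 ^ Suc j" "m - 2 ^ Suc j < 2 ^ Suc j"
      using Suc.prems by auto
    have "s m \<le> s (m - 2 ^ Suc j) + s (2 ^ Suc j)"
      using s_add[of "m - 2 ^ Suc j" "2 ^ Suc j"] m by simp
    then show ?thesis using Suc.IH[OF m(2)] by simp
  qed
qed

text \<open>The ratio of \<open>s\<close> at consecutive powers of two tends to
  \<open>2 powr H\<close>, which is larger than \<open>2 powr \<beta>\<close>. So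
  \<open>s (2 ^ j)\<close> divided by \<open>(2 powr \<beta>) ^ j\<close> eventually increases, and
  an eventually increasing positive sequence is increasing up to a constant.\<close>

lemma dyadic_growth:
  assumes \<beta>: "0 < \<beta>" "\<beta> < H"
  obtains C where "C > 0"
    "\<And>i j. i \<le> j \<Longrightarrow> s (2 ^ i) * (2 powr \<beta>) ^ (j - i) \<le> C * s (2 ^ j)"
proof -
  define b where "b = (2::real) powr \<beta>"
  have b: "b > 0" by (simp add: b_def)
  have "(\<lambda>j. s (2 * 2 ^ j) / s (2 ^ j)) \<longlonglongrightarrow> 2 powr H"
    using filterlim_compose[OF s_ratio[of 2], of "\<lambda>j. 2 ^ j" sequentially]
      filterlim_subseq[of "\<lambda>j. 2 ^ j :: nat"] by (simp add: strict_mono_def)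
  moreover have "b < 2 powr H" using \<beta> by (simp add: b_def)
  ultimately have "\<forall>\<^sub>F j in sequentially. b < s (2 * 2 ^ j) / s (2 ^ j)"
    by (rule order_tendstoD)
  then have "\<forall>\<^sub>F j in sequentially. s (2 ^ j) / b ^ j \<le> s (2 ^ Suc j) / b ^ Suc j"
  proof eventually_elim
    case (elim j)
    then have "b * s (2 ^ j) \<le> s (2 * 2 ^ j)" using s_pos[of "2 ^ j"] by (simp add: field_simps)
    then show ?case using b by (simp add: field_simps)
  qed
  moreover have "s (2 ^ j) / b ^ j > 0" for j using b s_pos[of "2 ^ j"] by simp
  ultimately obtain C where C: "C > 0"
    "\<And>i j. i \<le> j \<Longrightarrow> s (2 ^ i) / b ^ i \<le> C * (s (2 ^ j) / b ^ j)"
    using eventually_increasing_almost_increasing[of "\<lambda>j. s (2 ^ j) / b ^ j"] by blast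
  show thesis
  proof (rule that[OF C(1)])
    fix i j :: nat assume ij: "i \<le> j"
    have "s (2 ^ i) * b ^ (j - i) = s (2 ^ i) / b ^ i * b ^ j"
      using ij b by (simp add: power_diff)
    also have "\<dots> \<le> C * (s (2 ^ j) / b ^ j) * b ^ j"
      by (intro mult_right_mono C ij) (use b in auto)
    finally show "s (2 ^ i) * (2 powr \<beta>) ^ (j - i) \<le> C * s (2 ^ j)"
      using b by (simp add: b_def)
  qed
qed

text \<open>Dyadic growth settles powers of two. Since \<open>s\<close> need not be monotone, other
  arguments cannot simply be rounded: \<open>up\<close> rounds \<open>m\<close> down through its
  binary expansion, and \<open>low\<close> rounds \<open>n\<close> down through a division with
  remainder.\<close>

theorem potter_bound:
  assumes \<beta>: "0 < \<beta>" "\<beta> < H"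
  obtains C where "C > 0"
    "\<And>m n. 1 \<le> m \<Longrightarrow> m \<le> n \<Longrightarrow> s m \<le> C * (real m / real n) powr \<beta> * s n"
proof -
  define b where "b = (2::real) powr \<beta>"
  have b: "b > 1" using \<beta> by (simp add: b_def)
  obtain C where C: "C > 0"
    "\<And>i j. i \<le> j \<Longrightarrow> s (2 ^ i) * b ^ (j - i) \<le> C * s (2 ^ j)"
    using dyadic_growth[OF \<beta>] unfolding b_def by blast
  have C': "s (2 ^ i) \<le> C * (1 / b) ^ (j - i) * s (2 ^ j)" if "i \<le> j" for i j
    using C(2)[OF that] b by (simp add: field_simps)
  \<comment> \<open>Sum of a geometric series: going down from \<open>2 ^ j\<close>, the norms at
    smaller powers of two decay at least like powers of \<open>1 / b\<close>, up to the factor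
    \<open>C\<close>.\<close>
  define D where "D = C * (1 / (1 - 1 / b))"
  have D: "D > 0" using b C by (simp add: D_def)
  have up: "s m \<le> D * s (2 ^ j)" if "m < 2 ^ Suc j" for m j
  proof -
    have "(\<Sum>i\<le>j. (1 / b) ^ (j - i)) = (\<Sum>i\<le>j. (1 / b) ^ i)"
      by (intro sum.reindex_bij_witness[of _ "\<lambda>i. j - i" "\<lambda>i. j - i"]) auto
    also have "\<dots> \<le> (\<Sum>i. (1 / b) ^ i)"
      by (intro sum_le_suminf summable_geometric) (use b in auto)
    also have "\<dots> = 1 / (1 - 1 / b)" by (intro suminf_geometric) (use b in auto)
    finally have geo: "(\<Sum>i\<le>j. (1 / b) ^ (j - i)) \<le> 1 / (1 - 1 / b)" .
    have "s m \<le> (\<Sum>i\<le>j. s (2 ^ i))" by (rule s_sum_dyadic[OF that])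
    also have "\<dots> \<le> (\<Sum>i\<le>j. C * (1 / b) ^ (j - i) * s (2 ^ j))"
      by (intro sum_mono C') auto
    also have "\<dots> = C * (\<Sum>i\<le>j. (1 / b) ^ (j - i)) * s (2 ^ j)"
      by (simp add: sum_distrib_left sum_distrib_right)
    also have "\<dots> \<le> C * (1 / (1 - 1 / b)) * s (2 ^ j)"
      using geo C s_nonneg by (intro mult_right_mono mult_left_mono) auto
    finally show ?thesis by (simp add: D_def)
  qed
  \<comment> \<open>\<open>p\<close> is taken so large that a remainder below
    \<open>2 ^ Suc j\<close> carries at most half of the norm at \<open>2 ^ (j + Suc p)\<close>; the
    other half must then come from the multiple of \<open>n\<close>.\<close>
  have "(\<lambda>p. D * C * (1 / b) ^ Suc p) \<longlonglongrightarrow> D * C * 0"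
    by (intro tendsto_mult tendsto_const LIMSEQ_Suc LIMSEQ_realpow_zero) (use b in auto)
  then have "\<forall>\<^sub>F p in sequentially. D * C * (1 / b) ^ Suc p < 1 / 2"
    by (rule order_tendstoD) auto
  then obtain p where p: "D * C * (1 / b) ^ Suc p < 1 / 2"
    by (auto simp: eventually_sequentially)
  define E where "E = C * 2 * 2 ^ Suc p"
  have E: "E > 0" using C by (simp add: E_def)
  \<comment> \<open>Writing a larger power of two as \<open>q * n + r\<close> with \<open>r < n\<close> and \<open>q\<close> bounded turns
    subadditivity into a lower bound for \<open>s n\<close>.\<close>
  have low: "s (2 ^ j) \<le> E * s n" if "2 ^ j \<le> n" "n < 2 ^ Suc j" for j n
  proof -
    define K where "K = (2::nat) ^ (j + Suc p)"
    define q where "q = K div n"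
    define r where "r = K mod n"
    have n: "n > 0" using that by (metis less_le_trans zero_less_numeral zero_less_power)
    have K: "K = q * n + r" by (simp add: q_def r_def)
    have "r < n" using n by (simp add: r_def)
    have "s r \<le> D * s (2 ^ j)" by (rule up) (use \<open>r < n\<close> that in auto)
    also have "\<dots> \<le> D * (C * (1 / b) ^ (j + Suc p - j) * s K)"
      unfolding K_def using D by (intro mult_left_mono C') auto
    also have "\<dots> = (D * C * (1 / b) ^ Suc p) * s K" by simp
    also have "\<dots> \<le> 1 / 2 * s K" using p s_nonneg[of K] by (intro mult_right_mono) auto
    finally have r: "s r \<le> s K / 2" by simp
    have "q * 2 ^ j \<le> q * n" using that by simp
    also have "\<dots> \<le> 2 ^ Suc p * 2 ^ j" using K by (simp add: K_def power_add mult.commute)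
    finally have q: "q \<le> 2 ^ Suc p" by simp
    have "s K \<le> s (q * n) + s r" unfolding K by (rule s_add)
    then have "s K / 2 \<le> s (q * n)" using r by simp
    also have "\<dots> \<le> real q * s n" by (rule s_mult)
    also have "\<dots> \<le> 2 ^ Suc p * s n"
    proof -
      have "real q \<le> real (2 ^ Suc p)" using q by (simp only: of_nat_le_iff)
      then show ?thesis using s_nonneg[of n] by (intro mult_right_mono) auto
    qed
    finally have sK: "s K \<le> 2 * 2 ^ Suc p * s n" by simp
    have "s (2 ^ j) \<le> C * (1 / b) ^ (j + Suc p - j) * s K"
      unfolding K_def by (intro C') auto
    also have "\<dots> \<le> C * 1 * s K"
      using C b s_nonneg[of K] by (intro mult_right_mono mult_left_mono power_le_one) auto
    also have "\<dots> \<le> C * 1 * (2 * 2 ^ Suc p * s n)"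
      using C sK by (intro mult_left_mono) auto
    finally show ?thesis by (simp add: E_def mult_ac)
  qed
  show thesis
  proof (rule that[of "D * C * E * b"])
    show "D * C * E * b > 0" using D C E b by simp
    fix m n :: nat assume mn: "1 \<le> m" "m \<le> n"
    obtain i where i: "2 ^ i \<le> m" "m < 2 ^ Suc i"
      using ex_power_ivl1[of 2 m] mn by auto
    obtain j where j: "2 ^ j \<le> n" "n < 2 ^ Suc j"
      using ex_power_ivl1[of 2 n] mn by auto
    have "2 ^ i < (2::nat) ^ Suc j" using i j mn by linarith
    then have ij: "i \<le> j" using power_less_imp_less_exp[of "2::nat" i "Suc j"] by simp
    \<comment> \<open>The exponents \<open>i\<close> and \<open>j\<close> locate \<open>m\<close>
      and \<open>n\<close> only within a factor 2, which costs the additional factor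
      \<open>b = 2 powr \<beta>\<close>.\<close>
    have "(1 / b) ^ (j - i) = (1 / 2 ^ (j - i)) powr \<beta>"
      by (simp add: b_def powr_divide powr_realpow[symmetric] powr_powr powr_divide mult.commute)
    also have "\<dots> \<le> (2 * (real m / real n)) powr \<beta>"
    proof (rule powr_mono2)
      have "real n < 2 ^ Suc j"
        using j(2) by (metis of_nat_less_iff of_nat_numeral of_nat_power)
      also have "(2::real) ^ Suc j = 2 * 2 ^ (j - i) * 2 ^ i"
        using ij by (simp flip: power_add)
      also have "\<dots> \<le> 2 * 2 ^ (j - i) * real m"
        using i(1) by (metis mult_left_mono of_nat_le_iff of_nat_numeral of_nat_power zero_le_mult_iff zero_le_numeral zero_le_power)
      finally show "1 / 2 ^ (j - i) \<le> 2 * (real m / real n)"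
        using mn by (simp add: field_simps)
    qed (use \<beta> in auto)
    also have "\<dots> = b * (real m / real n) powr \<beta>"
      by (subst powr_mult) (auto simp: b_def)
    finally have pw: "(1 / b) ^ (j - i) \<le> b * (real m / real n) powr \<beta>" .
    have "s m \<le> D * s (2 ^ i)" by (rule up[OF i(2)])
    also have "\<dots> \<le> D * (C * (1 / b) ^ (j - i) * s (2 ^ j))"
      using D by (intro mult_left_mono C' ij) auto
    also have "\<dots> \<le> D * (C * (1 / b) ^ (j - i) * (E * s n))"
      using D C b by (intro mult_left_mono low j) auto
    also have "\<dots> \<le> D * (C * (b * (real m / real n) powr \<beta>) * (E * s n))"
      using D C E s_nonneg[of n] by (intro mult_left_mono mult_right_mono pw) auto
    finally show "s m \<le> D * C * E * b * (real m / real n) powr \<beta> * s n"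
      by (simp add: mult_ac)
  qed
qed

text \<open>Substitute for monotonicity of \<open>s\<close>: Potter's bound with its factor, at most
  1, dropped.\<close>

lemma s_bounded_by_last:
  obtains C where "\<And>m n. m \<le> n \<Longrightarrow> s m \<le> C * s n"
proof -
  obtain C where C: "C > 0"
    "\<And>m n. 1 \<le> m \<Longrightarrow> m \<le> n \<Longrightarrow> s m \<le> C * (real m / real n) powr (H / 2) * s n"
    using potter_bound[of "H / 2"] H_pos by auto
  show thesis
  proof (rule that)
    fix m n :: nat assume m: "m \<le> n"
    show "s m \<le> C * s n"
    proof (cases "m = 0")
      case True
      then show ?thesis using C(1) s_0 s_nonneg[of n] by simp
    next
      case False
      then have "s m \<le> C * (real m / real n) powr (H / 2) * s n" using m by (intro C) auto
      also have "\<dots> \<le> C * 1 * s n"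
        using C(1) m H_pos s_nonneg[of n]
        by (intro mult_right_mono mult_left_mono powr_le1) (auto simp: divide_le_eq_1)
      finally show ?thesis by simp
    qed
  qed
qed

lemma s_at_top: "filterlim s at_top sequentially"
proof -
  obtain C where C: "C > 0"
    "\<And>m n. 1 \<le> m \<Longrightarrow> m \<le> n \<Longrightarrow> s m \<le> C * (real m / real n) powr (H / 2) * s n"
    using potter_bound[of "H / 2"] H_pos by auto
  have 1: "s 1 / C * real n powr (H / 2) \<le> s n" if "n \<ge> 1" for n
    using C(2)[of 1 n] that C(1) by (simp add: powr_divide field_simps)
  have "filterlim (\<lambda>n. s 1 / C * real n powr (H / 2)) at_top sequentially"
    using s_pos[of 1] C H_pos
    by (intro filterlim_tendsto_pos_mult_at_top[OF tendsto_const] 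
         filterlim_compose[OF real_powr_at_top] filterlim_real_sequentially) auto
  then show ?thesis
    by (rule filterlim_at_top_mono) (use 1 in \<open>auto simp: eventually_sequentially\<close>)
qed

section \<open>Ratios of \<open>s\<close> along real multiples of \<open>n\<close>\<close>

lemma s_bounded_ratio:
  assumes "\<And>n. r n \<le> R"
  shows "(\<lambda>n. s (r n) / s n) \<longlonglongrightarrow> 0"
proof -
  define D where "D = Max (s ` {..R})"
  have D: "s (r n) \<le> D" for n
    using assms[of n] by (simp add: D_def)
  have "(\<lambda>n. D / s n) \<longlonglongrightarrow> 0"
    by (rule real_tendsto_divide_at_top[OF tendsto_const s_at_top])
  then show ?thesis
    by (rule tendsto_sandwich[OF _ _ tendsto_const, rotated 2])
      (use D s_nonneg in \<open>auto intro!: divide_right_mono always_eventually\<close>)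
qed

text \<open>Moving the argument by at most \<open>R\<close> moves \<open>s\<close> by at most its
  maximum over \<open>{..R}\<close>, which is negligible against \<open>s n\<close>. This absorbs
  every rounding by floors and integer divisions below.\<close>

lemma s_ratio_close:
  assumes "\<And>n. f n \<le> g n + R" "\<And>n. g n \<le> f n + R"
  shows "(\<lambda>n. s (f n) / s n - s (g n) / s n) \<longlonglongrightarrow> 0"
proof -
  define r where "r n = (if f n \<le> g n then g n - f n else f n - g n)" for n
  have r: "r n \<le> R" for n using assms[of n] by (auto simp: r_def)
  have *: "\<bar>s (f n) - s (g n)\<bar> \<le> s (r n)" for n
    using s_diff'[of "f n" "g n"] s_diff'[of "g n" "f n"] by (auto simp: r_def abs_minus_commute)
  show ?thesis
  proof (rule Lim_null_comparison[OF _ s_bounded_ratio[OF r]])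
    show "\<forall>\<^sub>F n in sequentially. norm (s (f n) / s n - s (g n) / s n) \<le> s (r n) / s n"
    proof (intro always_eventually allI)
      fix n
      show "norm (s (f n) / s n - s (g n) / s n) \<le> s (r n) / s n"
        using *[of n] s_nonneg[of n] by (auto simp: abs_divide divide_right_mono simp flip: diff_divide_distrib)
    qed
  qed
qed

text \<open>With \<open>k = n div q\<close>, both \<open>p * k\<close> and \<open>q * k\<close> are
  integer dilations of \<open>k\<close>, so the quotient of their norms converges by
  \<open>s_ratio\<close>. Replacing \<open>q * k\<close> by \<open>n\<close> and
  \<open>p * k\<close> by the floor costs bounded shifts only.\<close>

lemma s_ratio_rational:
  assumes p: "p \<ge> 1" and q: "q \<ge> 1"
  shows "(\<lambda>n. s (nat \<lfloor>real n * (real p / real q)\<rfloor>) / s n) \<longlonglongrightarrow> (real p / real q) powr H"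
proof -
  define k where "k n = n div q" for n
  have k: "filterlim k at_top sequentially"
    unfolding k_def using filterlim_at_top_div_const_nat[of q] q by simp
  have "(\<lambda>n. s (p * k n) / s (k n)) \<longlonglongrightarrow> real p powr H"
    by (rule filterlim_compose[OF s_ratio[OF p] k])
  moreover have "(\<lambda>n. s (q * k n) / s (k n)) \<longlonglongrightarrow> real q powr H"
    by (rule filterlim_compose[OF s_ratio[OF q] k])
  ultimately have lim: "(\<lambda>n. (s (p * k n) / s (k n)) / (s (q * k n) / s (k n))) \<longlonglongrightarrow> real p powr H / real q powr H"
    by (rule tendsto_divide) (use q in auto)
  have ev: "\<forall>\<^sub>F n in sequentially. k n \<ge> 1"
    using k by (auto simp: filterlim_at_top)
  have lim': "(\<lambda>n. s (p * k n) / s (q * k n)) \<longlonglongrightarrow> (real p / real q) powr H"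
    using lim
    unfolding powr_divide[of "real p" "real q" H, simplified, symmetric]
  proof (rule Lim_transform_eventually)
    show "\<forall>\<^sub>F n in sequentially. s (p * k n) / s (k n) / (s (q * k n) / s (k n)) = s (p * k n) / s (q * k n)"
      using ev by eventually_elim (use s_pos in \<open>force simp: field_simps\<close>)
  qed
  have "n \<le> q * k n + q" "q * k n \<le> n + q" for n
  proof -
    have "q * k n + n mod q = n" by (simp add: k_def)
    moreover have "n mod q < q" using q by simp
    ultimately show "n \<le> q * k n + q" "q * k n \<le> n + q" by linarith+
  qed
  then have "(\<lambda>n. s n / s n - s (q * k n) / s n) \<longlonglongrightarrow> 0"
    by (intro s_ratio_close[where R = q]) auto
  moreover have "(\<lambda>n. s n / s n) \<longlonglongrightarrow> 1"
  proof (rule tendsto_eventually)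
    show "\<forall>\<^sub>F n in sequentially. s n / s n = 1"
      using eventually_ge_at_top[of 1] by eventually_elim (use s_pos in force)
  qed
  ultimately have "(\<lambda>n. s n / s n - (s n / s n - s (q * k n) / s n)) \<longlonglongrightarrow> 1 - 0"
    by (rule tendsto_diff[rotated])
  then have lq: "(\<lambda>n. s (q * k n) / s n) \<longlonglongrightarrow> 1" by simp
  have "(\<lambda>n. (s (p * k n) / s (q * k n)) * (s (q * k n) / s n)) \<longlonglongrightarrow> (real p / real q) powr H * 1"
    by (intro tendsto_mult lim' lq)
  then have lp: "(\<lambda>n. s (p * k n) / s n) \<longlonglongrightarrow> (real p / real q) powr H"
    unfolding mult_1_right
  proof (rule Lim_transform_eventually)
    show "\<forall>\<^sub>F n in sequentially. s (p * k n) / s (q * k n) * (s (q * k n) / s n) = s (p * k n) / s n"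
      using ev
    proof eventually_elim
      case (elim n)
      then have "s (q * k n) > 0" using q by (intro s_pos) auto
      then show ?case by simp
    qed
  qed
  have floor: "p * k n \<le> nat \<lfloor>real n * (real p / real q)\<rfloor>"
    "nat \<lfloor>real n * (real p / real q)\<rfloor> \<le> p * k n + p" for n
  proof -
    have "real n * (real p / real q) = real (n * p) / real q" by simp
    then have eq: "nat \<lfloor>real n * (real p / real q)\<rfloor> = n * p div q"
      by (simp only: floor_divide_of_nat_eq nat_int)
    have n: "n = q * k n + n mod q" by (simp add: k_def)
    have "n * p = (q * k n + n mod q) * p" using n by simp
    also have "\<dots> = q * (k n * p) + (n mod q) * p" by (simp add: algebra_simps)
    finally have np: "n * p = q * (k n * p) + (n mod q) * p" .
    have "n * p div q = k n * p + (n mod q) * p div q"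
      unfolding np using q by simp
    moreover have "(n mod q) * p \<le> q * p"
      using q by (intro mult_right_mono) (auto intro: less_imp_le)
    then have "(n mod q) * p div q \<le> p"
      using q by (metis div_le_mono nonzero_mult_div_cancel_left not_one_le_zero)
    ultimately show "p * k n \<le> nat \<lfloor>real n * (real p / real q)\<rfloor>"
      "nat \<lfloor>real n * (real p / real q)\<rfloor> \<le> p * k n + p" unfolding eq by (auto simp: mult.commute)
  qed
  have "(\<lambda>n. s (nat \<lfloor>real n * (real p / real q)\<rfloor>) / s n - s (p * k n) / s n) \<longlonglongrightarrow> 0"
    by (rule s_ratio_close[where R = p]) (use floor in \<open>auto intro: trans_le_add1\<close>)
  from tendsto_add[OF this lp] show ?thesis by simp
qed

text \<open>Takes the place of the uniform convergence theorem for slowly varying functions. A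
  rational \<open>u\<close> slightly below \<open>t\<close> leaves a gap of about
  \<open>n * (t - u)\<close> steps, and Potter's bound makes the norm of this gap small relative to
  \<open>s n\<close>, uniformly in large \<open>n\<close>.\<close>

theorem s_ratio_real:
  assumes t: "0 \<le> t" "t \<le> 1"
  shows "(\<lambda>n. s (nat \<lfloor>real n * t\<rfloor>) / s n) \<longlonglongrightarrow> t powr H"
proof (cases "t = 0")
  case True
  then show ?thesis by (simp add: s_0)
next
  case False
  then have t: "0 < t" "t \<le> 1" using t by auto
  obtain C where C: "C > 0"
    "\<And>m n. 1 \<le> m \<Longrightarrow> m \<le> n \<Longrightarrow> s m \<le> C * (real m / real n) powr (H / 2) * s n"
    using potter_bound[of "H / 2"] H_pos by auto
  show ?thesis
  proof (rule LIMSEQ_I)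
    fix e :: real assume e: "e > 0"
    have "((\<lambda>u. u powr H) \<longlongrightarrow> t powr H) (at t)"
      by (rule tendsto_intros) (use t in auto)
    then have "\<forall>\<^sub>F u in at t. dist (u powr H) (t powr H) < e / 3"
      by (rule tendstoD) (use e in auto)
    then have 1: "\<forall>\<^sub>F u in at_left t. dist (u powr H) (t powr H) < e / 3"
      by (auto simp: eventually_at_split)
    have "((\<lambda>u. C * (2 * (t - u)) powr (H / 2)) \<longlongrightarrow> C * (2 * (t - t)) powr (H / 2)) (at_left t)"
      by (intro tendsto_intros) (use H_pos t in \<open>auto simp: eventually_at_left_field intro: exI[of _ 0]\<close>)
    then have 2: "\<forall>\<^sub>F u in at_left t. C * (2 * (t - u)) powr (H / 2) < e / 3"
      by (rule order_tendstoD) (use e H_pos in auto)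
    have 3: "\<forall>\<^sub>F u in at_left t. u > 0"
      using t by (auto simp: eventually_at_left_field intro: exI[of _ 0])
    have "\<forall>\<^sub>F u in at_left t. dist (u powr H) (t powr H) < e / 3 \<and>
       C * (2 * (t - u)) powr (H / 2) < e / 3 \<and> u > 0"
      using 1 2 3 by eventually_elim auto
    then obtain b where b: "b < t" "\<And>u. b < u \<Longrightarrow> u < t \<Longrightarrow>
       dist (u powr H) (t powr H) < e / 3 \<and> C * (2 * (t - u)) powr (H / 2) < e / 3 \<and> u > 0"
      unfolding eventually_at_left_field by blast
    obtain u where u: "u \<in> \<rat>" "b < u" "u < t" using Rats_dense_in_real[OF b(1)] by auto
    note bu = b(2)[OF u(2,3)]
    have upos: "u > 0" using bu by simp
    obtain p q :: nat where pq: "q \<noteq> 0" "\<bar>u\<bar> = real p / real q"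
      using Rats_abs_nat_div_natE[OF u(1)] by metis
    then have uq: "u = real p / real q" using upos by simp
    then have "p \<ge> 1" using upos by (cases p) auto
    then have "(\<lambda>n. s (nat \<lfloor>real n * u\<rfloor>) / s n) \<longlonglongrightarrow> u powr H"
      unfolding uq using pq by (intro s_ratio_rational) auto
    then obtain n1 where n1: "\<And>n. n \<ge> n1 \<Longrightarrow> norm (s (nat \<lfloor>real n * u\<rfloor>) / s n - u powr H) < e / 3"
      using LIMSEQ_D[of _ _ "e / 3"] e by fastforce
    \<comment> \<open>From \<open>n2\<close> on, \<open>n * (t - u)\<close> is at least 1, so the
      error of the two floors at most doubles the gap; this is the factor 2 in the bound on
      \<open>x - y\<close>.\<close>
    define n2 where "n2 = nat \<lceil>1 / (t - u)\<rceil>"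
    show "\<exists>no. \<forall>n\<ge>no. norm (s (nat \<lfloor>real n * t\<rfloor>) / s n - t powr H) < e"
    proof (intro exI[of _ "max 1 (max n1 n2)"] allI impI)
      fix n assume n: "n \<ge> max 1 (max n1 n2)"
      define x where "x = nat \<lfloor>real n * t\<rfloor>"
      define y where "y = nat \<lfloor>real n * u\<rfloor>"
      have "1 / (t - u) \<le> real n" using n by (auto simp: n2_def)
      then have nt: "1 \<le> real n * (t - u)" using u by (simp add: field_simps)
      have "y \<le> x" unfolding x_def y_def using u by (intro nat_mono floor_mono mult_left_mono) auto
      have rx: "real x \<le> real n * t" unfolding x_def using t by (simp add: of_nat_nat of_int_floor_le)
      have ry: "real y > real n * u - 1" unfolding y_def using upos by (simp add: of_nat_nat)
      have d: "real (x - y) \<le> 2 * (real n * (t - u))"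
        using rx ry nt \<open>y \<le> x\<close> by (simp add: of_nat_diff algebra_simps)
      have "real x \<le> real n * 1" using rx t by (meson mult_left_mono of_nat_0_le_iff order_trans)
      then have "x \<le> n" by simp
      have xy: "s (x - y) / s n \<le> C * (2 * (t - u)) powr (H / 2)"
      proof (cases "x = y")
        case True
        then show ?thesis using C by (simp add: s_0)
      next
        case False
        then have "s (x - y) \<le> C * (real (x - y) / real n) powr (H / 2) * s n"
          using \<open>x \<le> n\<close> \<open>y \<le> x\<close> by (intro C(2)) auto
        then have "s (x - y) / s n \<le> C * (real (x - y) / real n) powr (H / 2)"
          using s_pos[of n] n by (simp add: field_simps)
        also have "\<dots> \<le> C * (2 * (t - u)) powr (H / 2)"
          using C d n H_pos by (intro mult_left_mono powr_mono2) (auto simp: field_simps)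
        finally show ?thesis .
      qed
      have "\<bar>s x / s n - s y / s n\<bar> \<le> s (x - y) / s n"
        using s_diff'[OF \<open>y \<le> x\<close>] s_pos[of n] n
        by (auto simp: abs_divide divide_right_mono simp flip: diff_divide_distrib)
      then have "\<bar>s x / s n - s y / s n\<bar> < e / 3" using xy bu by linarith
      moreover have "\<bar>s y / s n - u powr H\<bar> < e / 3" using n1[of n] n by (simp add: y_def)
      moreover have "\<bar>u powr H - t powr H\<bar> < e / 3" using bu by (simp add: dist_real_def)
      ultimately show "norm (s (nat \<lfloor>real n * t\<rfloor>) / s n - t powr H) < e"
        unfolding x_def[symmetric] real_norm_def by linarith
    qed
  qed
qed

end

section \<open>Step paths in \<open>D[0,1]\<close>\<close>

text \<open>Serves twice: with mesh \<open>1 / n\<close> it is the partial sum process, with mesh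
  \<open>1 / m\<close> it interpolates a path from its values on a coarse grid.\<close>

definition step_path :: "nat \<Rightarrow> (nat \<Rightarrow> real) \<Rightarrow> real \<Rightarrow> real" where
  "step_path m x = (\<lambda>t\<in>{0..1}. x (nat \<lfloor>real m * t\<rfloor>))"

lemma nat_floor_le: "t \<in> {0..1} \<Longrightarrow> nat \<lfloor>real m * t\<rfloor> \<le> m"
proof -
  assume "t \<in> {0..1}"
  then have "real m * t \<le> real m" by (simp add: mult_left_le)
  then show ?thesis by linarith
qed

text \<open>Just left of \<open>t\<close> the floor has not yet reached \<open>m * t\<close>, even
  if that is an integer; the ceiling minus one covers both cases.\<close>

lemma floor_mult_eventually_const_left:
  assumes "t > 0" "m > 0"
  shows "\<forall>\<^sub>F s in at_left t. \<lfloor>real m * s\<rfloor> = \<lceil>real m * t\<rceil> - 1"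
proof -
  define b where "b = (of_int \<lceil>real m * t\<rceil> - 1) / real m"
  have "b < t" using assms unfolding b_def by (simp add: field_simps) linarith
  moreover have "\<lfloor>real m * s\<rfloor> = \<lceil>real m * t\<rceil> - 1" if "b < s" "s < t" for s
  proof (rule floor_unique)
    show "of_int (\<lceil>real m * t\<rceil> - 1) \<le> real m * s"
      using that assms by (simp add: b_def field_simps)
    have "real m * s < real m * t" using that assms by simp
    then show "real m * s < of_int (\<lceil>real m * t\<rceil> - 1) + 1"
      by (simp add: of_int_ceiling_cancel less_ceiling_iff) linarith
  qed
  ultimately show ?thesis unfolding eventually_at_left_field by blast
qed

lemma floor_mult_eventually_const_right:
  "\<forall>\<^sub>F s in at_right t. \<lfloor>real m * s\<rfloor> = \<lfloor>real m * t\<rfloor>"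
proof (cases "m = 0")
  case False
  define b where "b = (of_int \<lfloor>real m * t\<rfloor> + 1) / real m"
  have "t < b" using False unfolding b_def by (simp add: field_simps) linarith
  moreover have "\<lfloor>real m * s\<rfloor> = \<lfloor>real m * t\<rfloor>" if "t < s" "s < b" for s
  proof (rule floor_unique)
    show "of_int \<lfloor>real m * t\<rfloor> \<le> real m * s"
      using that False by (meson le_of_int_ceiling mult_left_mono of_int_floor_le of_nat_0_le_iff order_less_imp_le order_trans)
    show "real m * s < of_int \<lfloor>real m * t\<rfloor> + 1"
      using that False by (simp add: b_def field_simps)
  qed
  ultimately show ?thesis unfolding eventually_at_right_field by blast
qed simp

lemma step_path_D01: "step_path m x \<in> D01"
  unfolding D01_def
proof (intro CollectI conjI ballI)
  fix t :: real assume t: "t \<in> {0..<1}"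
  have "\<forall>\<^sub>F s in at_right t. s < 1" using t by (auto simp: eventually_at_right_field)
  moreover have "\<forall>\<^sub>F s in at_right t. s > t" by (auto simp: eventually_at_right_field intro: exI[of _ "t + 1"])
  ultimately have "\<forall>\<^sub>F s in at_right t. step_path m x t = step_path m x s"
    using floor_mult_eventually_const_right[of m t]
    by eventually_elim (use t in \<open>auto simp: step_path_def\<close>)
  then show "(step_path m x \<longlongrightarrow> step_path m x t) (at_right t)"
    by (rule Lim_transform_eventually[OF tendsto_const])
next
  fix t :: real assume t: "t \<in> {0<..1}"
  show "\<exists>l. (step_path m x \<longlongrightarrow> l) (at_left t)"
  proof (intro exI)
    have 1: "\<forall>\<^sub>F s in at_left t. s > 0" using t by (auto simp: eventually_at_left_field)
    have 2: "\<forall>\<^sub>F s in at_left t. s < t" by (auto simp: eventually_at_left_field intro: exI[of _ "t - 1"])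
    have 3: "\<forall>\<^sub>F s in at_left t. \<lfloor>real m * s\<rfloor> = (if m = 0 then 0 else \<lceil>real m * t\<rceil> - 1)"
      using floor_mult_eventually_const_left[of t m] t by auto
    have "\<forall>\<^sub>F s in at_left t. x (nat (if m = 0 then 0 else \<lceil>real m * t\<rceil> - 1)) = step_path m x s"
      using 1 2 3 by eventually_elim (use t in \<open>auto simp: step_path_def\<close>)
    then show "(step_path m x \<longlongrightarrow> x (nat (if m = 0 then 0 else \<lceil>real m * t\<rceil> - 1))) (at_left t)"
      by (rule Lim_transform_eventually[OF tendsto_const])
  qed
qed (simp add: step_path_def)

section \<open>Measurability of random step paths and of their limits\<close>

lemma skorokhod_dist_le_uniform:
  assumes "f \<in> D01" "g \<in> D01" "\<And>t. t \<in> {0..1} \<Longrightarrow> \<bar>f t - g t\<bar> \<le> e"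
  shows "skorokhod_dist f g \<le> e"
proof (rule dense_ge)
  fix e' assume "e < e'"
  moreover have "0 \<le> e" using assms(3)[of 0] by auto
  ultimately have "skorokhod_dist f g < e'"
    unfolding skorokhod_dist_less_iff[OF assms(1,2)]
    by (intro bexI[OF _ time_changes_id] exI[of _ e]) (use assms(3) in auto)
  then show "skorokhod_dist f g \<le> e'" by simp
qed

lemma open_finite_box: "open {x :: nat \<Rightarrow> real. \<forall>i\<le>m. \<bar>x i - y i\<bar> < e}"
proof -
  have "open {x :: nat \<Rightarrow> real. \<bar>x i - y i\<bar> < e}" for i
    by (intro open_Collect_less continuous_intros continuous_on_product_coordinates)
  then have "open (\<Inter>i\<in>{..m}. {x :: nat \<Rightarrow> real. \<bar>x i - y i\<bar> < e})"
    by (intro open_INT) auto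
  also have "(\<Inter>i\<in>{..m}. {x :: nat \<Rightarrow> real. \<bar>x i - y i\<bar> < e}) = {x. \<forall>i\<le>m. \<bar>x i - y i\<bar> < e}"
    by auto
  finally show ?thesis .
qed

text \<open>Continuity of \<open>step_path m\<close> from the product topology to Skorokhod's: a
  path depends on the coordinates up to \<open>m\<close> only, and uniform closeness implies
  Skorokhod closeness through the identity time change.\<close>

lemma step_path_preimage_open:
  assumes U: "openin skorokhod_topology U"
  shows "open {x. step_path m x \<in> U}"
proof (subst open_subopen, intro ballI)
  fix y assume "y \<in> {x. step_path m x \<in> U}"
  then have "step_path m y \<in> U" by simp
  then obtain r where r: "r > 0" "Skorokhod.mball (step_path m y) r \<subseteq> U"
    using U unfolding skorokhod_topology_def Skorokhod.openin_mtopology by blast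
  have "step_path m x \<in> U" if x: "\<forall>i\<le>m. \<bar>x i - y i\<bar> < r / 2" for x
  proof -
    have "\<bar>step_path m y t - step_path m x t\<bar> \<le> r / 2" if t: "t \<in> {0..1}" for t
    proof -
      have "\<bar>x (nat \<lfloor>real m * t\<rfloor>) - y (nat \<lfloor>real m * t\<rfloor>)\<bar> < r / 2"
        using x nat_floor_le[OF t, of m] by blast
      then show ?thesis using t by (simp add: step_path_def abs_minus_commute)
    qed
    then have "skorokhod_dist (step_path m y) (step_path m x) \<le> r / 2"
      by (intro skorokhod_dist_le_uniform step_path_D01)
    then show ?thesis using r step_path_D01 by (auto simp: Skorokhod.mball_def intro!: subsetD[OF r(2)])
  qed
  then show "\<exists>T. open T \<and> y \<in> T \<and> T \<subseteq> {x. step_path m x \<in> U}"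
    using open_finite_box[of m y "r / 2"] r(1)
    by (intro exI[of _ "{x. \<forall>i\<le>m. \<bar>x i - y i\<bar> < r / 2}"]) auto
qed

lemma measurable_skorokhod_borelI:
  assumes "\<And>x. x \<in> space M \<Longrightarrow> f x \<in> D01"
    and "\<And>U. openin skorokhod_topology U \<Longrightarrow> {x \<in> space M. f x \<in> U} \<in> sets M"
  shows "f \<in> measurable M skorokhod_borel"
  unfolding skorokhod_borel_def
proof (rule measurable_measure_of)
  show "{U. openin skorokhod_topology U} \<subseteq> Pow D01"
    using openin_subset[of skorokhod_topology] unfolding topspace_skorokhod_topology by blast
  show "f \<in> space M \<rightarrow> D01" using assms by auto
  fix U assume "U \<in> {U. openin skorokhod_topology U}"
  then show "f -` U \<inter> space M \<in> sets M"
    using assms(2)[of U] by (simp add: vimage_def Collect_conj_eq Int_commute)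
qed

lemma open_in_skorokhod_borel: "openin skorokhod_topology U \<Longrightarrow> U \<in> sets skorokhod_borel"
  unfolding skorokhod_borel_def
  using openin_subset[of skorokhod_topology]
  by (subst sets_measure_of) (auto simp: topspace_skorokhod_topology[symmetric])

lemma measurable_step_path [measurable]:
  assumes "\<And>i. (\<lambda>\<omega>. x \<omega> i) \<in> borel_measurable M"
  shows "(\<lambda>\<omega>. step_path m (x \<omega>)) \<in> measurable M skorokhod_borel"
proof (rule measurable_skorokhod_borelI)
  have x: "x \<in> borel_measurable M"
    using assms by (rule measurable_coordinatewise_then_product)
  fix U assume "openin skorokhod_topology U"
  then have "{y. step_path m y \<in> U} \<in> sets borel"
    using step_path_preimage_open by auto
  from measurable_sets[OF x this] show "{\<omega> \<in> space M. step_path m (x \<omega>) \<in> U} \<in> sets M"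
    by (simp add: vimage_def Collect_conj_eq Int_commute)
qed (rule step_path_D01)

text \<open>An open set \<open>U\<close> is exhausted by the open sets \<open>V k\<close> of points
  that have a ball of radius larger than \<open>1 / Suc k\<close> inside \<open>U\<close>. A limit
  belongs to \<open>U\<close> exactly if the sequence eventually stays in one \<open>V k\<close>,
  which is a countable combination of measurable conditions.\<close>

lemma measurable_uniform_limit_skorokhod:
  assumes f: "\<And>n::nat. f n \<in> measurable M skorokhod_borel"
    and g: "\<And>x. x \<in> space M \<Longrightarrow> g x \<in> D01"
    and lim: "\<And>x. x \<in> space M \<Longrightarrow> (\<lambda>n. skorokhod_dist (f n x) (g x)) \<longlonglongrightarrow> 0"
  shows "g \<in> measurable M skorokhod_borel"
proof (rule measurable_skorokhod_borelI[OF g])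
  have fD: "f n x \<in> D01" if "x \<in> space M" for n x
    using measurable_space[OF f that] by (simp add: space_skorokhod_borel)
  fix U assume U: "openin skorokhod_topology U"
  \<comment> \<open>The strict inequality for \<open>r\<close> makes \<open>V k\<close> open: half
    of the excess over \<open>1 / Suc k\<close> may be spent on moving the centre.\<close>
  define V where "V k = {u \<in> D01. \<exists>r>1 / real (Suc k). Skorokhod.mball u r \<subseteq> U}" for k
  have V: "openin skorokhod_topology (V k)" for k
    unfolding skorokhod_topology_def Skorokhod.openin_mtopology
  proof (intro conjI ballI allI impI)
    show "V k \<subseteq> D01" by (auto simp: V_def)
    fix u assume "u \<in> V k"
    then obtain r where u: "u \<in> D01" and r: "r > 1 / real (Suc k)" "Skorokhod.mball u r \<subseteq> U"
      by (auto simp: V_def)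
    define c where "c = 1 / real (Suc k)"
    define d where "d = (r - c) / 2"
    have "r > c" using r(1) unfolding c_def .
    then have d: "d > 0" "r - d > c" by (simp_all add: d_def field_simps)
    have "Skorokhod.mball u d \<subseteq> V k"
    proof
      fix v assume v: "v \<in> Skorokhod.mball u d"
      have "Skorokhod.mball v (r - d) \<subseteq> U"
      proof
        fix w assume w: "w \<in> Skorokhod.mball v (r - d)"
        have "skorokhod_dist u w \<le> skorokhod_dist u v + skorokhod_dist v w"
          using u v w by (intro Skorokhod.triangle) auto
        then have "w \<in> Skorokhod.mball u r" using u v w by auto
        then show "w \<in> U" using r by blast
      qed
      then show "v \<in> V k" using v d by (auto simp: V_def c_def)
    qed
    then show "\<exists>r>0. Skorokhod.mball u r \<subseteq> V k" using d by blast
  qed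
  have "g x \<in> U \<longleftrightarrow> (\<exists>k m. \<forall>n\<ge>m. f n x \<in> V k)" if x: "x \<in> space M" for x
  proof
    assume "g x \<in> U"
    then obtain r where r: "r > 0" "Skorokhod.mball (g x) r \<subseteq> U"
      using U unfolding skorokhod_topology_def Skorokhod.openin_mtopology by blast
    obtain k where k: "1 / real (Suc k) < r / 2"
      using r(1) reals_Archimedean[of "r / 2"] by (auto simp: inverse_eq_divide)
    have "\<forall>\<^sub>F n in sequentially. skorokhod_dist (f n x) (g x) < r / 2"
      by (rule order_tendstoD(2)[OF lim[OF x]]) (use r in auto)
    then obtain m where m: "\<And>n. n \<ge> m \<Longrightarrow> skorokhod_dist (f n x) (g x) < r / 2"
      by (auto simp: eventually_sequentially)
    have "f n x \<in> V k" if "n \<ge> m" for n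
    proof -
      have "Skorokhod.mball (f n x) (r / 2) \<subseteq> U"
      proof
        fix w assume w: "w \<in> Skorokhod.mball (f n x) (r / 2)"
        have "skorokhod_dist (g x) w \<le> skorokhod_dist (g x) (f n x) + skorokhod_dist (f n x) w"
          using w g[OF x] by (intro Skorokhod.triangle) auto
        moreover have "skorokhod_dist (g x) (f n x) < r / 2"
          using m[OF that] by (simp add: Skorokhod.commute)
        ultimately have "w \<in> Skorokhod.mball (g x) r" using w g[OF x] by auto
        then show "w \<in> U" using r by blast
      qed
      then show ?thesis using fD[OF x] k unfolding V_def by blast
    qed
    then show "\<exists>k m. \<forall>n\<ge>m. f n x \<in> V k" by blast
  next
    assume "\<exists>k m. \<forall>n\<ge>m. f n x \<in> V k"
    then obtain k m where km: "\<And>n. n \<ge> m \<Longrightarrow> f n x \<in> V k" by blast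
    have "\<forall>\<^sub>F n in sequentially. skorokhod_dist (f n x) (g x) < 1 / real (Suc k)"
      by (rule order_tendstoD(2)[OF lim[OF x]]) auto
    then obtain m' where m': "\<And>n. n \<ge> m' \<Longrightarrow> skorokhod_dist (f n x) (g x) < 1 / real (Suc k)"
      by (auto simp: eventually_sequentially)
    obtain r where r: "r > 1 / real (Suc k)" "Skorokhod.mball (f (max m m') x) r \<subseteq> U"
      using km[of "max m m'"] by (auto simp: V_def)
    have "g x \<in> Skorokhod.mball (f (max m m') x) r"
      using m'[of "max m m'"] r(1) g[OF x] fD[OF x] by auto
    then show "g x \<in> U" using r by blast
  qed
  then have eq: "{x \<in> space M. g x \<in> U} = (\<Union>k. \<Union>m. \<Inter>n\<in>{m..}. (f n -` V k \<inter> space M))"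
    by (auto simp: Ball_def) blast+
  have "f n -` V k \<inter> space M \<in> sets M" for n k
    by (rule measurable_sets[OF f open_in_skorokhod_borel[OF V]])
  then show "{x \<in> space M. g x \<in> U} \<in> sets M"
    unfolding eq by (intro sets.countable_UN sets.countable_INT image_subsetI) (simp_all only: atLeast_iff, auto)
qed

section \<open>Convergence of characteristic functions in finite dimension\<close>

text \<open>The real functions whose expectations are determined by the characteristic function in
  the coordinates up to \<open>d\<close>. Products are not a closure rule, so that statements about
  expectations can be proved by induction using linearity alone.\<close>

inductive trig_poly :: "nat \<Rightarrow> ((nat \<Rightarrow> real) \<Rightarrow> real) \<Rightarrow> bool" for d where
  cos: "trig_poly d (\<lambda>x. cos (\<Sum>i\<le>d. \<theta> i * x i))"
| sin: "trig_poly d (\<lambda>x. sin (\<Sum>i\<le>d. \<theta> i * x i))"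
| add: "trig_poly d f \<Longrightarrow> trig_poly d g \<Longrightarrow> trig_poly d (\<lambda>x. f x + g x)"
| scale: "trig_poly d f \<Longrightarrow> trig_poly d (\<lambda>x. c * f x)"

lemma trig_poly_const: "trig_poly d (\<lambda>_. c)"
  using trig_poly.scale[OF trig_poly.cos[of d "\<lambda>_. 0"], of c] by simp

lemma trig_poly_continuous: "trig_poly d f \<Longrightarrow> continuous_on UNIV f"
  by (induction rule: trig_poly.induct)
    (intro continuous_intros continuous_on_product_coordinates | assumption)+

lemma trig_poly_bounded: "trig_poly d f \<Longrightarrow> \<exists>B. \<forall>x. \<bar>f x\<bar> \<le> B"
proof (induction rule: trig_poly.induct)
  case (add f g)
  then obtain B C where "\<And>x. \<bar>f x\<bar> \<le> B" "\<And>x. \<bar>g x\<bar> \<le> C" by blast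
  then have "\<bar>f x + g x\<bar> \<le> B + C" for x by (meson abs_triangle_ineq add_mono order_trans)
  then show ?case by blast
next
  case (scale f c)
  then obtain B where "\<And>x. \<bar>f x\<bar> \<le> B" by blast
  then have "\<bar>c * f x\<bar> \<le> \<bar>c\<bar> * B" for x by (simp add: abs_mult mult_left_mono)
  then show ?case by blast
qed (auto intro: exI[of _ 1])

text \<open>Product-to-sum formulas turn a product of two waves into a sum of waves; the resulting
  closure under products is what Stone-Weierstrass requires.\<close>

lemma trig_poly_mult_cos:
  "trig_poly d g \<Longrightarrow> trig_poly d (\<lambda>x. cos (\<Sum>i\<le>d. \<theta> i * x i) * g x)"
proof (induction rule: trig_poly.induct)
  case (cos \<eta>)
  have "trig_poly d (\<lambda>x. (1 / 2) * (cos (\<Sum>i\<le>d. (\<theta> i - \<eta> i) * x i) + cos (\<Sum>i\<le>d. (\<theta> i + \<eta> i) * x i)))"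
    by (intro trig_poly.intros)
  then show ?case by (simp add: cos_times_cos left_diff_distrib distrib_right sum.distrib sum_subtractf)
next
  case (sin \<eta>)
  have "trig_poly d (\<lambda>x. (1 / 2) * (sin (\<Sum>i\<le>d. (\<theta> i + \<eta> i) * x i) + (-1) * sin (\<Sum>i\<le>d. (\<theta> i - \<eta> i) * x i)))"
    by (intro trig_poly.intros)
  then show ?case by (simp add: cos_times_sin left_diff_distrib distrib_right sum.distrib sum_subtractf)
next
  case (add f g)
  from trig_poly.add[OF add.IH] show ?case by (simp add: algebra_simps)
next
  case (scale f c)
  from trig_poly.scale[OF scale.IH, of c] show ?case by (simp add: algebra_simps)
qed

lemma trig_poly_mult_sin:
  "trig_poly d g \<Longrightarrow> trig_poly d (\<lambda>x. sin (\<Sum>i\<le>d. \<theta> i * x i) * g x)"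
proof (induction rule: trig_poly.induct)
  case (cos \<eta>)
  have "trig_poly d (\<lambda>x. (1 / 2) * (sin (\<Sum>i\<le>d. (\<theta> i + \<eta> i) * x i) + sin (\<Sum>i\<le>d. (\<theta> i - \<eta> i) * x i)))"
    by (intro trig_poly.intros)
  then show ?case by (simp add: sin_times_cos left_diff_distrib distrib_right sum.distrib sum_subtractf)
next
  case (sin \<eta>)
  have "trig_poly d (\<lambda>x. (1 / 2) * (cos (\<Sum>i\<le>d. (\<theta> i - \<eta> i) * x i) + (-1) * cos (\<Sum>i\<le>d. (\<theta> i + \<eta> i) * x i)))"
    by (intro trig_poly.intros)
  then show ?case by (simp add: sin_times_sin left_diff_distrib distrib_right sum.distrib sum_subtractf)
next
  case (add f g)
  from trig_poly.add[OF add.IH] show ?case by (simp add: algebra_simps)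
next
  case (scale f c)
  from trig_poly.scale[OF scale.IH, of c] show ?case by (simp add: algebra_simps)
qed

lemma trig_poly_mult:
  assumes g: "trig_poly d g"
  shows "trig_poly d f \<Longrightarrow> trig_poly d (\<lambda>x. f x * g x)"
proof (induction rule: trig_poly.induct)
  case (add f h)
  from trig_poly.add[OF add.IH] show ?case by (simp add: algebra_simps)
next
  case (scale f c)
  from trig_poly.scale[OF scale.IH, of c] show ?case by (simp add: algebra_simps)
qed (rule trig_poly_mult_cos[OF g] trig_poly_mult_sin[OF g])+

lemma trig_poly_compose_polynomial:
  assumes f: "trig_poly d f"
  shows "real_polynomial_function p \<Longrightarrow> trig_poly d (\<lambda>x. p (f x))"
proof (induction rule: real_polynomial_function.induct)
  case (linear p)
  then obtain c where "\<And>y. p y = y * c" using real_bounded_linear by auto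
  then show ?case using trig_poly.scale[OF f, of c] by (simp add: mult.commute)
qed (auto intro: trig_poly_const trig_poly.add trig_poly_mult)

text \<open>A trigonometric polynomial that is close to \<open>\<Phi>\<close> on a box may be large outside of it;
  composing it with a polynomial approximation of the truncation to \<open>[-B, B]\<close> keeps the
  algebra and restores the bound.\<close>

lemma trig_poly_approx:
  assumes \<Phi>: "continuous_on UNIV \<Phi>" "\<And>x. \<bar>\<Phi> x\<bar> \<le> B" and e: "e > 0"
  obtains f where "trig_poly d f" "\<And>x. \<bar>f x\<bar> \<le> B + e"
    "\<And>x. (\<And>i. i > d \<Longrightarrow> x i = 0) \<Longrightarrow> (\<And>i. i \<le> d \<Longrightarrow> \<bar>x i\<bar> \<le> R) \<Longrightarrow> \<bar>\<Phi> x - f x\<bar> \<le> 2 * e"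
proof -
  \<comment> \<open>Coordinates beyond \<open>d\<close> are pinned to 0: the trigonometric
    polynomials do not see them and could not separate points that differ there.\<close>
  define S :: "(nat \<Rightarrow> real) set" where "S = (\<Pi>\<^sub>E i\<in>UNIV. if i \<le> d then {-R..R} else {0})"
  have "compactin euclidean S"
    unfolding S_def euclidean_product_topology[symmetric] compactin_PiE by auto
  then have S: "compact S" by simp
  interpret function_ring_on "{f. trig_poly d f}" S
  proof
    fix x y assume xy: "x \<in> S" "y \<in> S" "x \<noteq> y"
    then obtain i where i: "x i \<noteq> y i" by auto
    have id: "i \<le> d"
    proof (rule ccontr)
      assume "\<not> i \<le> d"
      then have "x i = 0" "y i = 0" using xy by (auto simp: S_def PiE_iff split: if_splits)
      then show False using i by simp
    qed
    \<comment> \<open>This scale moves both coordinates into the interval on which sine is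
      injective.\<close>
    define c where "c = 1 / (1 + \<bar>x i\<bar> + \<bar>y i\<bar>)"
    have c: "c > 0" by (auto simp: c_def intro!: divide_pos_pos)
    have b: "\<bar>c * z\<bar> \<le> pi / 2" if "\<bar>z\<bar> \<le> \<bar>x i\<bar> + \<bar>y i\<bar>" for z
    proof -
      have "\<bar>c * z\<bar> \<le> 1" using that by (simp add: c_def abs_mult)
      then show ?thesis using pi_ge_two by linarith
    qed
    have "- (pi / 2) \<le> c * x i" "c * x i \<le> pi / 2" "- (pi / 2) \<le> c * y i" "c * y i \<le> pi / 2"
      using b[of "x i"] b[of "y i"] by (simp_all add: abs_le_iff)
    then have "sin (c * x i) \<noteq> sin (c * y i)"
      using sin_inj_pi[of "c * x i" "c * y i"] i c by auto
    moreover have "(\<Sum>j\<le>d. (if j = i then c else 0) * z j) = c * z i" for z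
      using id by (simp add: if_distrib[of "\<lambda>u. u * _"] sum.delta cong: if_cong)
    ultimately show "\<exists>f\<in>{f. trig_poly d f}. f x \<noteq> f y"
      using trig_poly.sin[of d "\<lambda>j. if j = i then c else 0"] by (intro bexI[of _ "\<lambda>z. sin (\<Sum>j\<le>d. (if j = i then c else 0) * z j)"]) auto
  qed (use S in \<open>auto intro: trig_poly_const trig_poly.add trig_poly_mult continuous_on_subset[OF trig_poly_continuous]\<close>)
  have "continuous_on S \<Phi>" using \<Phi>(1) by (rule continuous_on_subset) auto
  from Stone_Weierstrass_basic[OF this e] obtain p where p: "trig_poly d p" "\<And>x. x \<in> S \<Longrightarrow> \<bar>\<Phi> x - p x\<bar> < e"
    by auto
  \<comment> \<open>Since \<open>p\<close> is bounded on the whole space, a polynomial approximation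
    on the single interval \<open>{-Q..Q}\<close> controls the composition everywhere.\<close>
  obtain Q where Q: "\<And>x. \<bar>p x\<bar> \<le> Q" using trig_poly_bounded[OF p(1)] by blast
  define c where "c y = max (- B) (min B y)" for y :: real
  have "continuous_on {-Q..Q} c" unfolding c_def by (intro continuous_intros)
  from Stone_Weierstrass_real_polynomial_function[OF compact_Icc this e]
  obtain g where g: "real_polynomial_function g" "\<And>y. y \<in> {-Q..Q} \<Longrightarrow> \<bar>c y - g y\<bar> < e" by blast
  have gp: "\<bar>c (p x) - g (p x)\<bar> < e" for x using g(2)[of "p x"] Q[of x] by (auto simp: abs_le_iff)
  have B: "B \<ge> 0" using \<Phi>(2)[of undefined] by linarith
  show thesis
  proof (rule that)
    show "trig_poly d (\<lambda>x. g (p x))" by (rule trig_poly_compose_polynomial[OF p(1) g(1)])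
    show "\<bar>g (p x)\<bar> \<le> B + e" for x
    proof -
      have "\<bar>c (p x)\<bar> \<le> B" using B by (auto simp: c_def)
      then show ?thesis using gp[of x] by linarith
    qed
    fix x :: "nat \<Rightarrow> real" assume x: "\<And>i. i > d \<Longrightarrow> x i = 0" "\<And>i. i \<le> d \<Longrightarrow> \<bar>x i\<bar> \<le> R"
    have "x \<in> S" unfolding S_def PiE_iff using x by (auto simp: abs_le_iff minus_le_iff)
    then have "\<bar>\<Phi> x - p x\<bar> < e" by (rule p(2))
    then have "\<bar>\<Phi> x - c (p x)\<bar> < e" using \<Phi>(2)[of x] unfolding c_def by linarith
    then show "\<bar>\<Phi> x - g (p x)\<bar> \<le> 2 * e" using gp[of x] by linarith
  qed
qed

section \<open>From characteristic functions to bounded continuous functions\<close>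

lemma trig_poly_expectation_tendsto:
  fixes X :: "nat \<Rightarrow> 'a \<Rightarrow> nat \<Rightarrow> real" and Z :: "'b \<Rightarrow> nat \<Rightarrow> real"
  assumes M: "prob_space M" and N: "prob_space N"
    and X: "\<And>n. X n \<in> borel_measurable M" and Z: "Z \<in> borel_measurable N"
    and char: "\<And>\<theta>. (\<lambda>n. \<integral>\<omega>. iexp (\<Sum>i\<le>d. \<theta> i * X n \<omega> i) \<partial>M) \<longlonglongrightarrow> (\<integral>\<omega>. iexp (\<Sum>i\<le>d. \<theta> i * Z \<omega> i) \<partial>N)"
    and f: "trig_poly d f"
  shows "(\<lambda>n. \<integral>\<omega>. f (X n \<omega>) \<partial>M) \<longlonglongrightarrow> (\<integral>\<omega>. f (Z \<omega>) \<partial>N)"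
proof -
  interpret M: prob_space M by fact
  interpret N: prob_space N by fact
  have mX: "(\<lambda>\<omega>. X n \<omega> i) \<in> borel_measurable M" for n i
    by (rule measurable_product_then_coordinatewise[OF X])
  have mZ: "(\<lambda>\<omega>. Z \<omega> i) \<in> borel_measurable N" for i
    by (rule measurable_product_then_coordinatewise[OF Z])
  have iX: "integrable M (\<lambda>\<omega>. iexp (\<Sum>i\<le>d. \<theta> i * X n \<omega> i))" for n \<theta>
    using mX by (intro M.integrable_iexp) auto
  have iZ: "integrable N (\<lambda>\<omega>. iexp (\<Sum>i\<le>d. \<theta> i * Z \<omega> i))" for \<theta>
    using mZ by (intro N.integrable_iexp) auto
  have int: "integrable M (\<lambda>\<omega>. g (X n \<omega>))" "integrable N (\<lambda>\<omega>. g (Z \<omega>))" if g: "trig_poly d g" for g n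
  proof -
    obtain B where B: "\<And>x. \<bar>g x\<bar> \<le> B" using trig_poly_bounded[OF g] by blast
    have m: "g \<in> borel_measurable borel"
      by (rule borel_measurable_continuous_onI[OF trig_poly_continuous[OF g]])
    show "integrable M (\<lambda>\<omega>. g (X n \<omega>))" 
      by (rule M.integrable_const_bound[of _ B]) (use B measurable_compose[OF X m] in auto)
    show "integrable N (\<lambda>\<omega>. g (Z \<omega>))" 
      by (rule N.integrable_const_bound[of _ B]) (use B measurable_compose[OF Z m] in auto)
  qed
  show ?thesis using f
  proof (induction rule: trig_poly.induct)
    case (cos \<theta>)
    have "(\<lambda>n. Re (\<integral>\<omega>. iexp (\<Sum>i\<le>d. \<theta> i * X n \<omega> i) \<partial>M)) \<longlonglongrightarrow> Re (\<integral>\<omega>. iexp (\<Sum>i\<le>d. \<theta> i * Z \<omega> i) \<partial>N)"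
      by (intro tendsto_Re char)
    then show ?case
      unfolding integral_Re[OF iX, symmetric] integral_Re[OF iZ, symmetric] Re_exp by simp
  next
    case (sin \<theta>)
    have "(\<lambda>n. Im (\<integral>\<omega>. iexp (\<Sum>i\<le>d. \<theta> i * X n \<omega> i) \<partial>M)) \<longlonglongrightarrow> Im (\<integral>\<omega>. iexp (\<Sum>i\<le>d. \<theta> i * Z \<omega> i) \<partial>N)"
      by (intro tendsto_Im char)
    then show ?case
      unfolding integral_Im[OF iX, symmetric] integral_Im[OF iZ, symmetric] Im_exp by simp
  next
    case (add f g)
    then show ?case
      using int[OF add.hyps(1)] int[OF add.hyps(2)] by (simp add: tendsto_add)
  next
    case (scale f c)
    then show ?case by (simp add: tendsto_mult_left)
  qed
qed

text \<open>A multivariate continuity theorem in which a uniform bound on second moments plays the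
  part of tightness: Chebyshev's inequality controls what happens outside the box where the
  trigonometric polynomial is a good approximation.\<close>

theorem char_tendsto_imp_expectation_tendsto:
  fixes X :: "nat \<Rightarrow> 'a \<Rightarrow> nat \<Rightarrow> real" and Z :: "'b \<Rightarrow> nat \<Rightarrow> real"
    and \<Phi> :: "(nat \<Rightarrow> real) \<Rightarrow> real"
  assumes M: "prob_space M" and N: "prob_space N"
    and X: "\<And>n. X n \<in> borel_measurable M" and Z: "Z \<in> borel_measurable N"
    and X0: "\<And>n \<omega> i. i > d \<Longrightarrow> X n \<omega> i = 0" and Z0: "\<And>\<omega> i. i > d \<Longrightarrow> Z \<omega> i = 0"
    and X2: "\<And>n i. integrable M (\<lambda>\<omega>. (X n \<omega> i)\<^sup>2)" "\<And>n i. (\<integral>\<omega>. (X n \<omega> i)\<^sup>2 \<partial>M) \<le> V"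
    and Z2: "\<And>i. integrable N (\<lambda>\<omega>. (Z \<omega> i)\<^sup>2)" "\<And>i. (\<integral>\<omega>. (Z \<omega> i)\<^sup>2 \<partial>N) \<le> V"
    and char: "\<And>\<theta>. (\<lambda>n. \<integral>\<omega>. iexp (\<Sum>i\<le>d. \<theta> i * X n \<omega> i) \<partial>M) \<longlonglongrightarrow> (\<integral>\<omega>. iexp (\<Sum>i\<le>d. \<theta> i * Z \<omega> i) \<partial>N)"
    and \<Phi>: "continuous_on UNIV \<Phi>" "\<And>x. \<bar>\<Phi> x\<bar> \<le> B"
  shows "(\<lambda>n. \<integral>\<omega>. \<Phi> (X n \<omega>) \<partial>M) \<longlonglongrightarrow> (\<integral>\<omega>. \<Phi> (Z \<omega>) \<partial>N)"
proof (rule LIMSEQ_I)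
  fix e0 :: real assume e0: "e0 > 0"
  \<comment> \<open>Two approximation errors of \<open>3 * e\<close> and one limit error of
    \<open>e\<close> stay below \<open>e0\<close>; \<open>e \<le> 1\<close> allows
    \<open>2 * B + 1\<close> to dominate \<open>2 * B + e\<close>.\<close>
  define e where "e = min 1 (e0 / 10)"
  have e: "e > 0" "e \<le> 1" "e \<le> e0 / 10" using e0 by (auto simp: e_def)
  have B: "B \<ge> 0" using \<Phi>(2)[of undefined] by linarith
  have V: "V \<ge> 0" using order_trans[OF integral_nonneg_AE X2(2)] by (metis AE_I2 zero_le_power2)
  define K where "K = (2 * B + 1) * (real d + 1) * V"
  have K: "K \<ge> 0" using B V by (simp add: K_def)
  \<comment> \<open>With this radius the second moments contribute
    \<open>K / R\<^sup>2 = e * (K / (K + 1))\<close>, hence at most \<open>e\<close>; adding 1 to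
    \<open>K\<close> covers \<open>K = 0\<close>.\<close>
  define R where "R = sqrt ((K + 1) / e)"
  have R: "R > 0" "R\<^sup>2 = (K + 1) / e" using K e by (simp_all add: R_def)
  obtain f where f: "trig_poly d f" "\<And>x. \<bar>f x\<bar> \<le> B + e"
    "\<And>x. (\<And>i. i > d \<Longrightarrow> x i = 0) \<Longrightarrow> (\<And>i. i \<le> d \<Longrightarrow> \<bar>x i\<bar> \<le> R) \<Longrightarrow> \<bar>\<Phi> x - f x\<bar> \<le> 2 * e"
    using trig_poly_approx[OF \<Phi> e(1)] by blast
  \<comment> \<open>Chebyshev's inequality in pointwise form: outside the box the sum of squares
    over \<open>R\<^sup>2\<close> is at least 1 and pays for the crude bound on the
    difference.\<close>
  have pw: "\<bar>\<Phi> x - f x\<bar> \<le> 2 * e + (2 * B + 1) * (\<Sum>i\<le>d. (x i)\<^sup>2) / R\<^sup>2" if x: "\<And>i. i > d \<Longrightarrow> x i = 0" for x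
  proof (cases "\<forall>i\<le>d. \<bar>x i\<bar> \<le> R")
    case True
    then have "\<bar>\<Phi> x - f x\<bar> \<le> 2 * e" using f(3) x by blast
    moreover have "0 \<le> (2 * B + 1) * (\<Sum>i\<le>d. (x i)\<^sup>2) / R\<^sup>2"
      using B by (intro divide_nonneg_nonneg mult_nonneg_nonneg sum_nonneg) auto
    ultimately show ?thesis by linarith
  next
    case False
    then obtain i where i: "i \<le> d" "\<bar>x i\<bar> > R" by auto
    have "R\<^sup>2 \<le> \<bar>x i\<bar>\<^sup>2" using i R by (intro power_mono) auto
    also have "\<dots> = (x i)\<^sup>2" by simp
    also have "\<dots> \<le> (\<Sum>i\<le>d. (x i)\<^sup>2)" by (rule member_le_sum) (use i in auto)
    finally have "(2 * B + 1) * 1 \<le> (2 * B + 1) * ((\<Sum>i\<le>d. (x i)\<^sup>2) / R\<^sup>2)"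
      using B R(1) by (intro mult_left_mono) (auto simp: field_simps)
    moreover have "\<bar>\<Phi> x - f x\<bar> \<le> B + (B + e)" using \<Phi>(2)[of x] f(2)[of x] by linarith
    ultimately show ?thesis using e by simp
  qed
  \<comment> \<open>Stated for an arbitrary probability space, since \<open>X n\<close> and
    \<open>Z\<close> live on different ones.\<close>
  have approx: "\<bar>(\<integral>\<omega>. \<Phi> (W \<omega>) \<partial>P) - (\<integral>\<omega>. f (W \<omega>) \<partial>P)\<bar> \<le> 3 * e"
    if P: "prob_space P" and W: "W \<in> borel_measurable P" and W0: "\<And>\<omega> i. i > d \<Longrightarrow> W \<omega> i = 0"
      and W2: "\<And>i. integrable P (\<lambda>\<omega>. (W \<omega> i)\<^sup>2)" "\<And>i. (\<integral>\<omega>. (W \<omega> i)\<^sup>2 \<partial>P) \<le> V"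
    for P :: "'c measure" and W :: "'c \<Rightarrow> nat \<Rightarrow> real"
  proof -
    interpret P: prob_space P by fact
    have i1: "integrable P (\<lambda>\<omega>. \<Phi> (W \<omega>))"
      by (rule P.integrable_const_bound[of _ B])
        (use \<Phi> measurable_compose[OF W borel_measurable_continuous_onI[OF \<Phi>(1)]] in auto)
    have i2: "integrable P (\<lambda>\<omega>. f (W \<omega>))"
      by (rule P.integrable_const_bound[of _ "B + e"])
        (use f measurable_compose[OF W borel_measurable_continuous_onI[OF trig_poly_continuous[OF f(1)]]] in auto)
    have "\<bar>(\<integral>\<omega>. \<Phi> (W \<omega>) \<partial>P) - (\<integral>\<omega>. f (W \<omega>) \<partial>P)\<bar> = \<bar>\<integral>\<omega>. \<Phi> (W \<omega>) - f (W \<omega>) \<partial>P\<bar>"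
      using i1 i2 by simp
    also have "\<dots> \<le> (\<integral>\<omega>. \<bar>\<Phi> (W \<omega>) - f (W \<omega>)\<bar> \<partial>P)"
      by (rule integral_abs_bound)
    also have "\<dots> \<le> (\<integral>\<omega>. 2 * e + (2 * B + 1) * (\<Sum>i\<le>d. (W \<omega> i)\<^sup>2) / R\<^sup>2 \<partial>P)"
      by (intro integral_mono pw W0) (use i1 i2 W2 in auto)
    also have "\<dots> = 2 * e + (2 * B + 1) * (\<Sum>i\<le>d. (\<integral>\<omega>. (W \<omega> i)\<^sup>2 \<partial>P)) / R\<^sup>2"
      using W2 by (simp add: P.prob_space Bochner_Integration.integral_sum)
    also have "\<dots> \<le> 2 * e + (2 * B + 1) * (\<Sum>i\<le>d. V) / R\<^sup>2"
      using B by (intro add_left_mono divide_right_mono mult_left_mono sum_mono W2) auto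
    also have "(2 * B + 1) * (\<Sum>i\<le>d. V) / R\<^sup>2 = e * (K / (K + 1))"
      using e K by (simp add: R(2) K_def field_simps)
    also have "\<dots> \<le> e * 1" using e K by (intro mult_left_mono) auto
    finally show ?thesis by simp
  qed
  have "(\<lambda>n. \<integral>\<omega>. f (X n \<omega>) \<partial>M) \<longlonglongrightarrow> (\<integral>\<omega>. f (Z \<omega>) \<partial>N)"
    by (rule trig_poly_expectation_tendsto[OF M N X Z char f(1)])
  from LIMSEQ_D[OF this e(1)] obtain n0 where n0: "\<And>n. n \<ge> n0 \<Longrightarrow> norm ((\<integral>\<omega>. f (X n \<omega>) \<partial>M) - (\<integral>\<omega>. f (Z \<omega>) \<partial>N)) < e"
    by blast
  show "\<exists>n0. \<forall>n\<ge>n0. norm ((\<integral>\<omega>. \<Phi> (X n \<omega>) \<partial>M) - (\<integral>\<omega>. \<Phi> (Z \<omega>) \<partial>N)) < e0"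
  proof (intro exI[of _ n0] allI impI)
    fix n assume "n \<ge> n0"
    note n0[OF this]
    moreover have "\<bar>(\<integral>\<omega>. \<Phi> (X n \<omega>) \<partial>M) - (\<integral>\<omega>. f (X n \<omega>) \<partial>M)\<bar> \<le> 3 * e"
      by (rule approx[OF M X X0 X2])
    moreover have "\<bar>(\<integral>\<omega>. \<Phi> (Z \<omega>) \<partial>N) - (\<integral>\<omega>. f (Z \<omega>) \<partial>N)\<bar> \<le> 3 * e"
      by (rule approx[OF N Z Z0 Z2])
    ultimately show "norm ((\<integral>\<omega>. \<Phi> (X n \<omega>) \<partial>M) - (\<integral>\<omega>. \<Phi> (Z \<omega>) \<partial>N)) < e0"
      using e unfolding real_norm_def by linarith
  qed
qed

section \<open>A criterion for C-convergence\<close>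

definition unif_dist :: "(real \<Rightarrow> real) \<Rightarrow> (real \<Rightarrow> real) \<Rightarrow> real" where
  "unif_dist f g = (SUP t\<in>{0..1}. \<bar>f t - g t\<bar>)"

lemma D01_diff_bdd:
  assumes "f \<in> D01" "g \<in> D01"
  shows "bdd_above ((\<lambda>t. \<bar>f t - g t\<bar>) ` {0..1})"
proof -
  obtain A where A: "\<And>t. t \<in> {0..1} \<Longrightarrow> \<bar>f t\<bar> \<le> A"
    using D01_bounded[OF assms(1)] unfolding bounded_iff real_norm_def by blast
  obtain B where B: "\<And>t. t \<in> {0..1} \<Longrightarrow> \<bar>g t\<bar> \<le> B"
    using D01_bounded[OF assms(2)] unfolding bounded_iff real_norm_def by blast
  show ?thesis
  proof (rule bdd_aboveI2)
    show "\<bar>f t - g t\<bar> \<le> A + B" if "t \<in> {0..1}" for t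
      using A[OF that] B[OF that] by linarith
  qed
qed

lemma unif_dist_ge:
  "f \<in> D01 \<Longrightarrow> g \<in> D01 \<Longrightarrow> t \<in> {0..1} \<Longrightarrow> \<bar>f t - g t\<bar> \<le> unif_dist f g"
  unfolding unif_dist_def by (rule cSUP_upper[OF _ D01_diff_bdd])

lemma unif_dist_le: "(\<And>t. t \<in> {0..1} \<Longrightarrow> \<bar>f t - g t\<bar> \<le> e) \<Longrightarrow> unif_dist f g \<le> e"
  unfolding unif_dist_def by (rule cSUP_least) auto

lemma unif_dist_commute: "unif_dist f g = unif_dist g f"
  unfolding unif_dist_def by (simp add: abs_minus_commute)

lemma unif_dist_nonneg: "f \<in> D01 \<Longrightarrow> g \<in> D01 \<Longrightarrow> 0 \<le> unif_dist f g"
  using unif_dist_ge[of f g 0] by (meson abs_ge_zero atLeastAtMost_iff order_refl order_trans zero_le_one)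

lemma unif_dist_triangle:
  assumes "f \<in> D01" "g \<in> D01" "h \<in> D01"
  shows "unif_dist f h \<le> unif_dist f g + unif_dist g h"
proof (rule unif_dist_le)
  fix t :: real assume t: "t \<in> {0..1}"
  show "\<bar>f t - h t\<bar> \<le> unif_dist f g + unif_dist g h"
    using unif_dist_ge[OF assms(1,2) t] unif_dist_ge[OF assms(2,3) t] by linarith
qed

lemma unif_dist_self: "unif_dist f f = 0"
  unfolding unif_dist_def by simp

text \<open>On \<open>D01\<close> the metric of the function space is \<open>unif_dist\<close>, so
  topological continuity takes the usual \<epsilon>-\<delta> form.\<close>

lemma topcontinuous_at_uniformD:
  assumes F: "topcontinuous_at uniform_topology euclideanreal F f" and e: "e > 0"
  obtains d where "d > 0" "\<And>g. g \<in> D01 \<Longrightarrow> unif_dist f g < d \<Longrightarrow> \<bar>F g - F f\<bar> < e"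
proof -
  let ?m = "funspace {0..1} euclidean_metric :: (real \<Rightarrow> real) metric"
  have fD: "f \<in> D01" using F by (simp add: topcontinuous_at_def topspace_uniform_topology)
  have "openin euclideanreal (ball (F f) e)" by simp
  then obtain U where U: "openin uniform_topology U" "f \<in> U" "\<And>g. g \<in> U \<Longrightarrow> F g \<in> ball (F f) e"
    using F e unfolding topcontinuous_at_def by (metis centre_in_ball)
  obtain V where V: "openin (mtopology_of ?m) V" "U = V \<inter> D01"
    using U(1) unfolding uniform_topology_def openin_subtopology by blast
  then obtain r where r: "r > 0" "mball_of ?m f r \<subseteq> V"
    using U(2) unfolding mtopology_of_def mball_of_def
    by (metis IntE Metric_space.openin_mtopology Metric_space_mspace_mdist)
  show thesis
  proof (rule that[OF r(1)])
    fix g assume g: "g \<in> D01" "unif_dist f g < r"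
    have "mdist ?m f g = unif_dist f g"
      using fD g(1) D01_subset_funspace
      by (auto simp: Met_TC.fdist_def unif_dist_def dist_real_def)
    then have "g \<in> mball_of ?m f r"
      using fD g D01_subset_funspace by auto
    then have "g \<in> U" using r V g by auto
    from U(3)[OF this] show "\<bar>F g - F f\<bar> < e" by (simp add: dist_real_def abs_minus_commute)
  qed
qed

text \<open>The Pasch-Hausdorff envelope: for bounded \<open>G\<close>, the largest minorant of
  \<open>G\<close> that is \<open>k\<close>-Lipschitz in the uniform distance.\<close>

definition lip_reg :: "real \<Rightarrow> ((real \<Rightarrow> real) \<Rightarrow> real) \<Rightarrow> (real \<Rightarrow> real) \<Rightarrow> real" where
  "lip_reg k G f = (INF g\<in>D01. G g + k * unif_dist f g)"

context
  fixes k :: real and G :: "(real \<Rightarrow> real) \<Rightarrow> real"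
  assumes k: "k \<ge> 0" and G: "\<And>f. f \<in> D01 \<Longrightarrow> 0 \<le> G f" "\<And>f. f \<in> D01 \<Longrightarrow> G f \<le> 1"
begin

lemma lip_reg_lower:
  assumes "f \<in> D01" "g \<in> D01"
  shows "lip_reg k G f \<le> G g + k * unif_dist f g"
  unfolding lip_reg_def
proof (rule cINF_lower[OF _ assms(2)])
  show "bdd_below ((\<lambda>g. G g + k * unif_dist f g) ` D01)"
    by (rule bdd_belowI2[where m = 0]) (use G k assms(1) unif_dist_nonneg in auto)
qed

lemma lip_reg_le: "f \<in> D01 \<Longrightarrow> lip_reg k G f \<le> G f"
  using lip_reg_lower[of f f] by (simp add: unif_dist_self)

lemma lip_reg_greatest:
  "f \<in> D01 \<Longrightarrow> (\<And>g. g \<in> D01 \<Longrightarrow> c \<le> G g + k * unif_dist f g) \<Longrightarrow> c \<le> lip_reg k G f"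
  unfolding lip_reg_def by (rule cINF_greatest) auto

lemma lip_reg_nonneg: "f \<in> D01 \<Longrightarrow> 0 \<le> lip_reg k G f"
  by (rule lip_reg_greatest) (use G k unif_dist_nonneg in auto)

lemma lip_reg_lipschitz:
  assumes f: "f \<in> D01" "f' \<in> D01"
  shows "lip_reg k G f - k * unif_dist f f' \<le> lip_reg k G f'"
proof (rule lip_reg_greatest[OF f(2)])
  fix g assume g: "g \<in> D01"
  have "lip_reg k G f \<le> G g + k * unif_dist f g" by (rule lip_reg_lower[OF f(1) g])
  also have "\<dots> \<le> G g + k * (unif_dist f f' + unif_dist f' g)"
    using k by (intro add_left_mono mult_left_mono unif_dist_triangle f g)
  finally show "lip_reg k G f - k * unif_dist f f' \<le> G g + k * unif_dist f' g"
    by (simp add: algebra_simps)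
qed

lemma lip_reg_lipschitz_abs:
  assumes f: "f \<in> D01" "f' \<in> D01"
  shows "\<bar>lip_reg k G f - lip_reg k G f'\<bar> \<le> k * unif_dist f f'"
  using lip_reg_lipschitz[OF f] lip_reg_lipschitz[OF f(2,1)] unif_dist_commute[of f f']
  by (simp add: abs_le_iff algebra_simps)

text \<open>The infimum in \<open>lip_reg\<close> runs over an uncountable set, so measurability of
  the envelope is not automatic. On step paths it is a continuous function of finitely many values,
  and this is where it gets evaluated.\<close>

lemma continuous_lip_reg_step_path: "continuous_on UNIV (\<lambda>x. lip_reg k G (step_path m x))"
proof (intro continuous_at_imp_continuous_on ballI)
  fix y
  show "isCont (\<lambda>x. lip_reg k G (step_path m x)) y"
    unfolding isCont_def
  proof (rule tendstoI)
    fix e :: real assume e: "e > 0"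
    define d where "d = e / (k + 1)"
    have d: "d > 0" "k * d < e" using e k by (auto simp: d_def field_simps)
    have "dist (lip_reg k G (step_path m x)) (lip_reg k G (step_path m y)) < e"
      if x: "\<forall>i\<le>m. \<bar>x i - y i\<bar> < d" for x
    proof -
      have "unif_dist (step_path m x) (step_path m y) \<le> d"
      proof (rule unif_dist_le)
        fix t :: real assume t: "t \<in> {0..1}"
        have "\<bar>x (nat \<lfloor>real m * t\<rfloor>) - y (nat \<lfloor>real m * t\<rfloor>)\<bar> < d"
          using x nat_floor_le[OF t, of m] by blast
        then show "\<bar>step_path m x t - step_path m y t\<bar> \<le> d" using t by (simp add: step_path_def)
      qed
      then have "k * unif_dist (step_path m x) (step_path m y) \<le> k * d"
        using k by (rule mult_left_mono)
      then show ?thesis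
        using lip_reg_lipschitz_abs[OF step_path_D01 step_path_D01, of m x m y] d
        by (simp add: dist_real_def)
    qed
    then show "\<forall>\<^sub>F x in at y. dist (lip_reg k G (step_path m x)) (lip_reg k G (step_path m y)) < e"
      unfolding eventually_at_topological
      using open_finite_box[of m y d] d(1)
      by (intro exI[of _ "{x. \<forall>i\<le>m. \<bar>x i - y i\<bar> < d}"]) auto
  qed
qed

end

text \<open>Competitors within distance \<open>d\<close> of \<open>f\<close> have values above
  \<open>G f - e / 2\<close> by lower semicontinuity. The others pay the penalty
  \<open>k * d\<close>, which is at least 1 and hence at least \<open>G f\<close> once
  \<open>k \<ge> 1 / d\<close>.\<close>

lemma lip_reg_tendsto:
  assumes G: "\<And>f. f \<in> D01 \<Longrightarrow> 0 \<le> G f" "\<And>f. f \<in> D01 \<Longrightarrow> G f \<le> 1"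
    and f: "f \<in> D01"
    and lsc: "\<And>e. e > 0 \<Longrightarrow> \<exists>d>0. \<forall>g\<in>D01. unif_dist f g < d \<longrightarrow> G f - e < G g"
  shows "(\<lambda>k. lip_reg (real k) G f) \<longlonglongrightarrow> G f"
proof (rule LIMSEQ_I)
  fix e :: real assume e: "e > 0"
  then obtain d where d: "d > 0" "\<And>g. g \<in> D01 \<Longrightarrow> unif_dist f g < d \<Longrightarrow> G f - e / 2 < G g"
    using lsc[of "e / 2"] by auto
  show "\<exists>k0. \<forall>k\<ge>k0. norm (lip_reg (real k) G f - G f) < e"
  proof (intro exI[of _ "nat \<lceil>1 / d\<rceil>"] allI impI)
    fix k assume "k \<ge> nat \<lceil>1 / d\<rceil>"
    then have k: "1 \<le> real k * d" using d(1) by (simp add: field_simps nat_le_iff ceiling_le_iff)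
    have "G f - e / 2 \<le> lip_reg (real k) G f"
    proof (rule lip_reg_greatest[OF _ G f])
      fix g assume g: "g \<in> D01"
      have n: "0 \<le> real k * unif_dist f g" using unif_dist_nonneg[OF f g] by simp
      show "G f - e / 2 \<le> G g + real k * unif_dist f g"
      proof (cases "unif_dist f g < d")
        case True
        then show ?thesis using d(2)[OF g] n by fastforce
      next
        case False
        then have "real k * d \<le> real k * unif_dist f g" by (intro mult_left_mono) auto
        then show ?thesis using k G(1)[OF g] G(2)[OF f] e by linarith
      qed
    qed auto
    moreover have "lip_reg (real k) G f \<le> G f" by (rule lip_reg_le[OF _ G f]) auto
    ultimately show "norm (lip_reg (real k) G f - G f) < e" using e by (simp add: abs_less_iff)
  qed
qed

text \<open>Grid values padded with 0, so that all grid sizes share the type and product topology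
  used in the continuity theorem.\<close>

definition skeleton :: "nat \<Rightarrow> (real \<Rightarrow> real) \<Rightarrow> nat \<Rightarrow> real" where
  "skeleton m f = (\<lambda>i. if i \<le> m then f (real i / real m) else 0)"

lemma step_path_skeleton:
  assumes "t \<in> {0..1}"
  shows "step_path m (skeleton m f) t = f (real (nat \<lfloor>real m * t\<rfloor>) / real m)"
  using assms nat_floor_le[OF assms, of m] by (simp add: step_path_def skeleton_def)

lemma grid_point_close:
  assumes "t \<in> {0..1}" "m \<ge> 1"
  shows "real (nat \<lfloor>real m * t\<rfloor>) / real m \<in> {0..1}" "\<bar>real (nat \<lfloor>real m * t\<rfloor>) / real m - t\<bar> \<le> 1 / real m"
proof -
  have "real (nat \<lfloor>real m * t\<rfloor>) \<le> real m" using nat_floor_le[OF assms(1), of m] by simp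
  then show "real (nat \<lfloor>real m * t\<rfloor>) / real m \<in> {0..1}" using assms by simp
  have "\<bar>real (nat \<lfloor>real m * t\<rfloor>) - real m * t\<bar> \<le> 1" using assms by (simp add: of_nat_nat) linarith
  then have "\<bar>(real (nat \<lfloor>real m * t\<rfloor>) - real m * t) / real m\<bar> \<le> 1 / real m"
    unfolding abs_divide by (simp add: divide_right_mono)
  moreover have "(real (nat \<lfloor>real m * t\<rfloor>) - real m * t) / real m = real (nat \<lfloor>real m * t\<rfloor>) / real m - t"
    using assms by (simp add: diff_divide_distrib)
  ultimately show "\<bar>real (nat \<lfloor>real m * t\<rfloor>) / real m - t\<bar> \<le> 1 / real m" by simp
qed

lemma step_path_skeleton_tendsto:
  assumes f: "f \<in> C01"
  shows "(\<lambda>m. unif_dist (step_path m (skeleton m f)) f) \<longlonglongrightarrow> 0"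
proof (rule LIMSEQ_I)
  fix e :: real assume e: "e > 0"
  have "uniformly_continuous_on {0..1} f"
    using f by (intro compact_uniformly_continuous) (auto simp: C01_def)
  then obtain d where d: "d > 0" "\<And>s t. s \<in> {0..1} \<Longrightarrow> t \<in> {0..1} \<Longrightarrow> \<bar>s - t\<bar> < d \<Longrightarrow> \<bar>f s - f t\<bar> < e / 2"
    using e unfolding uniformly_continuous_on_def dist_real_def by (metis half_gt_zero)
  obtain m0 where m0: "m0 \<ge> 1" "1 / real m0 < d"
    using reals_Archimedean[OF d(1)] by (metis One_nat_def Suc_le_mono inverse_eq_divide le0)
  show "\<exists>m0. \<forall>m\<ge>m0. norm (unif_dist (step_path m (skeleton m f)) f - 0) < e"
  proof (intro exI[of _ m0] allI impI)
    fix m assume m: "m \<ge> m0"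
    then have m1: "m \<ge> 1" using m0 by simp
    have "1 / real m \<le> 1 / real m0" using m m0 by (intro divide_left_mono) auto
    then have m2: "1 / real m < d" using m0 by linarith
    have "unif_dist (step_path m (skeleton m f)) f \<le> e / 2"
    proof (rule unif_dist_le)
      fix t :: real assume t: "t \<in> {0..1}"
      show "\<bar>step_path m (skeleton m f) t - f t\<bar> \<le> e / 2"
        unfolding step_path_skeleton[OF t]
        using d(2)[OF grid_point_close(1)[OF t m1] t] grid_point_close(2)[OF t m1] m2
        by linarith
    qed
    moreover have "0 \<le> unif_dist (step_path m (skeleton m f)) f"
      using f C01_subset_D01 by (intro unif_dist_nonneg step_path_D01) auto
    ultimately show "norm (unif_dist (step_path m (skeleton m f)) f - 0) < e" using e by simp
  qed
qed

text \<open>Convergence on every grid together with small oscillation between grid points, where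
  only the limit process needs continuous paths. \<open>skeleton_close\<close> asks for an
  integrable majorant \<open>U\<close> rather than for the expectation of the distance, whose
  supremum runs over uncountably many times.\<close>

locale skeleton_approx = M: prob_space M + N: prob_space N
  for M :: "'a measure" and N :: "'b measure" +
  fixes Y :: "nat \<Rightarrow> 'a \<Rightarrow> real \<Rightarrow> real" and Z :: "'b \<Rightarrow> real \<Rightarrow> real"
  assumes Y [measurable]: "\<And>n. Y n \<in> measurable M skorokhod_borel"
    and Yt: "\<And>n t. t \<in> {0..1} \<Longrightarrow> (\<lambda>\<omega>. Y n \<omega> t) \<in> borel_measurable M"
    and Z: "\<And>\<omega>. \<omega> \<in> space N \<Longrightarrow> Z \<omega> \<in> C01"
    and Zt: "\<And>t. t \<in> {0..1} \<Longrightarrow> (\<lambda>\<omega>. Z \<omega> t) \<in> borel_measurable N"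
    and skeleton_tendsto: "\<And>m \<Phi> B. m \<ge> 1 \<Longrightarrow> continuous_on UNIV \<Phi> \<Longrightarrow> (\<And>x. \<bar>\<Phi> x\<bar> \<le> B) \<Longrightarrow>
      (\<lambda>n. \<integral>\<omega>. \<Phi> (skeleton m (Y n \<omega>)) \<partial>M) \<longlonglongrightarrow> (\<integral>\<omega>. (\<Phi> (skeleton m (Z \<omega>)) :: real) \<partial>N)"
    and skeleton_close: "\<And>e. e > 0 \<Longrightarrow> \<forall>\<^sub>F m in sequentially. \<forall>\<^sub>F n in sequentially.
      \<exists>U. integrable M U \<and> (\<forall>\<omega>\<in>space M. unif_dist (Y n \<omega>) (step_path m (skeleton m (Y n \<omega>))) \<le> U \<omega>) \<and>
        (\<integral>\<omega>. U \<omega> \<partial>M) \<le> e"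
begin

lemma Y_D01: "\<omega> \<in> space M \<Longrightarrow> Y n \<omega> \<in> D01"
  using measurable_space[OF Y] by (simp add: space_skorokhod_borel)

lemma Z_D01: "\<omega> \<in> space N \<Longrightarrow> Z \<omega> \<in> D01"
  using Z C01_subset_D01 by blast

lemma skeleton_Y_measurable: "(\<lambda>\<omega>. skeleton m (Y n \<omega>)) \<in> borel_measurable M"
proof (rule measurable_coordinatewise_then_product)
  fix i
  show "(\<lambda>\<omega>. skeleton m (Y n \<omega>) i) \<in> borel_measurable M"
    using Yt[of "real i / real m" n] by (cases "i \<le> m") (auto simp: skeleton_def divide_le_eq_1)
qed

lemma skeleton_Z_measurable: "(\<lambda>\<omega>. skeleton m (Z \<omega>)) \<in> borel_measurable N"
proof (rule measurable_coordinatewise_then_product)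
  fix i
  show "(\<lambda>\<omega>. skeleton m (Z \<omega>) i) \<in> borel_measurable N"
    using Zt[of "real i / real m"] by (cases "i \<le> m") (auto simp: skeleton_def divide_le_eq_1)
qed

text \<open>Continuous paths are uniform limits of their step interpolations, and these depend
  measurably on finitely many values.\<close>

lemma Z_measurable: "Z \<in> measurable N skorokhod_borel"
proof (rule measurable_uniform_limit_skorokhod)
  fix m
  show "(\<lambda>\<omega>. step_path m (skeleton m (Z \<omega>))) \<in> measurable N skorokhod_borel"
    by (rule measurable_step_path)
      (rule measurable_product_then_coordinatewise[OF skeleton_Z_measurable])
next
  fix \<omega> assume \<omega>: "\<omega> \<in> space N"
  show "(\<lambda>m. skorokhod_dist (step_path m (skeleton m (Z \<omega>))) (Z \<omega>)) \<longlonglongrightarrow> 0"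
  proof (rule tendsto_sandwich[OF _ _ tendsto_const step_path_skeleton_tendsto[OF Z[OF \<omega>]]])
    show "\<forall>\<^sub>F m in sequentially. 0 \<le> skorokhod_dist (step_path m (skeleton m (Z \<omega>))) (Z \<omega>)"
      by (simp add: skorokhod_dist_nonneg)
    show "\<forall>\<^sub>F m in sequentially. skorokhod_dist (step_path m (skeleton m (Z \<omega>))) (Z \<omega>)
        \<le> unif_dist (step_path m (skeleton m (Z \<omega>))) (Z \<omega>)"
      by (intro always_eventually allI skorokhod_dist_le_uniform step_path_D01 Z_D01 \<omega> unif_dist_ge)
  qed
qed (rule Z_D01)

text \<open>Four errors of \<open>e / 4\<close> connect the two sides: from \<open>G\<close> to its
  envelope at \<open>Z\<close>, from \<open>Z\<close> to its step interpolation, from the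
  interpolation of \<open>Z\<close> to that of \<open>Y n\<close>, and from the latter to
  \<open>Y n\<close>. The return from the envelope to \<open>G\<close> at \<open>Y n\<close> is
  free, as the envelope lies below \<open>G\<close>.\<close>

lemma expectation_lower_bound:
  fixes G :: "(real \<Rightarrow> real) \<Rightarrow> real"
  assumes Gm: "G \<in> borel_measurable skorokhod_borel"
    and G: "\<And>f. f \<in> D01 \<Longrightarrow> 0 \<le> G f" "\<And>f. f \<in> D01 \<Longrightarrow> G f \<le> 1"
    and lsc: "\<And>f e. f \<in> C01 \<Longrightarrow> e > 0 \<Longrightarrow> \<exists>d>0. \<forall>g\<in>D01. unif_dist f g < d \<longrightarrow> G f - e < G g"
    and e: "e > 0"
  shows "\<forall>\<^sub>F n in sequentially. (\<integral>\<omega>. G (Z \<omega>) \<partial>N) - e \<le> (\<integral>\<omega>. G (Y n \<omega>) \<partial>M)"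
proof -
  define L where "L k = lip_reg (real k) G" for k :: nat
  have L01: "0 \<le> L k f" "L k f \<le> 1" if "f \<in> D01" for f k
    using lip_reg_nonneg[of "real k" G f, OF _ G that] lip_reg_le[of "real k" G f, OF _ G that] G(2)[OF that]
    by (auto simp: L_def)
  have Lstep: "continuous_on UNIV (\<lambda>x. L k (step_path m x))" for k m
    unfolding L_def by (rule continuous_lip_reg_step_path[OF _ G]) auto
  have LZm_meas: "(\<lambda>\<omega>. L k (step_path m (skeleton m (Z \<omega>)))) \<in> borel_measurable N" for k m
    using measurable_compose[OF skeleton_Z_measurable borel_measurable_continuous_onI[OF Lstep]] .
  have LYm_meas: "(\<lambda>\<omega>. L k (step_path m (skeleton m (Y n \<omega>)))) \<in> borel_measurable M" for k m n
    using measurable_compose[OF skeleton_Y_measurable borel_measurable_continuous_onI[OF Lstep]] .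
  have LZ_lim: "(\<lambda>m. L k (step_path m (skeleton m (Z \<omega>)))) \<longlonglongrightarrow> L k (Z \<omega>)" if \<omega>: "\<omega> \<in> space N" for k \<omega>
  proof (rule Lim_transform2[OF tendsto_const])
    have "(\<lambda>m. real k * unif_dist (step_path m (skeleton m (Z \<omega>))) (Z \<omega>)) \<longlonglongrightarrow> real k * 0"
      by (intro tendsto_mult tendsto_const step_path_skeleton_tendsto Z \<omega>)
    then have lim: "(\<lambda>m. real k * unif_dist (step_path m (skeleton m (Z \<omega>))) (Z \<omega>)) \<longlonglongrightarrow> 0" by simp
    show "(\<lambda>m. L k (Z \<omega>) - L k (step_path m (skeleton m (Z \<omega>)))) \<longlonglongrightarrow> 0"
    proof (rule Lim_null_comparison[OF always_eventually lim], intro allI)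
      fix m
      show "norm (L k (Z \<omega>) - L k (step_path m (skeleton m (Z \<omega>))))
        \<le> real k * unif_dist (step_path m (skeleton m (Z \<omega>))) (Z \<omega>)"
        using lip_reg_lipschitz_abs[of "real k" G, OF _ G step_path_D01 Z_D01[OF \<omega>], of m "skeleton m (Z \<omega>)"]
        by (simp add: L_def abs_minus_commute)
    qed
  qed
  \<comment> \<open>The envelope is not claimed to be measurable on \<open>D01\<close>; its
    composition with \<open>Z\<close> is, as a limit along step interpolations.\<close>
  have LZ_meas: "(\<lambda>\<omega>. L k (Z \<omega>)) \<in> borel_measurable N" for k
    by (rule borel_measurable_LIMSEQ_real[OF LZ_lim LZm_meas])
  have GZ_meas: "(\<lambda>\<omega>. G (Z \<omega>)) \<in> borel_measurable N"
    by (rule measurable_compose[OF Z_measurable Gm])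
  have "(\<lambda>k. \<integral>\<omega>. L k (Z \<omega>) \<partial>N) \<longlonglongrightarrow> (\<integral>\<omega>. G (Z \<omega>) \<partial>N)"
  proof (rule integral_dominated_convergence[where w = "\<lambda>_. 1"])
    show "AE \<omega> in N. (\<lambda>k. L k (Z \<omega>)) \<longlonglongrightarrow> G (Z \<omega>)"
      unfolding L_def by (intro AE_I2 lip_reg_tendsto G lsc Z Z_D01)
    show "\<And>k. AE \<omega> in N. norm (L k (Z \<omega>)) \<le> 1"
      by (intro AE_I2) (use L01 Z_D01 in auto)
  qed (use LZ_meas GZ_meas in auto)
  then have "\<forall>\<^sub>F k in sequentially. (\<integral>\<omega>. G (Z \<omega>) \<partial>N) - e / 4 < (\<integral>\<omega>. L k (Z \<omega>) \<partial>N)"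
    by (rule order_tendstoD) (use e in auto)
  then have "\<forall>\<^sub>F k in sequentially. (\<integral>\<omega>. G (Z \<omega>) \<partial>N) - e / 4 < (\<integral>\<omega>. L k (Z \<omega>) \<partial>N) \<and> k \<ge> 1"
    using eventually_ge_at_top[of 1] by eventually_elim auto
  then obtain k where k: "(\<integral>\<omega>. G (Z \<omega>) \<partial>N) - e / 4 < (\<integral>\<omega>. L k (Z \<omega>) \<partial>N)" "k \<ge> 1"
    by (auto simp: eventually_sequentially)
  have "(\<lambda>m. \<integral>\<omega>. L k (step_path m (skeleton m (Z \<omega>))) \<partial>N) \<longlonglongrightarrow> (\<integral>\<omega>. L k (Z \<omega>) \<partial>N)"
  proof (rule integral_dominated_convergence[where w = "\<lambda>_. 1"])
    show "AE \<omega> in N. (\<lambda>m. L k (step_path m (skeleton m (Z \<omega>)))) \<longlonglongrightarrow> L k (Z \<omega>)"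
      by (intro AE_I2 LZ_lim)
    show "\<And>m. AE \<omega> in N. norm (L k (step_path m (skeleton m (Z \<omega>)))) \<le> 1"
      by (intro AE_I2) (use L01 step_path_D01 in auto)
  qed (use LZ_meas LZm_meas in auto)
  then have "\<forall>\<^sub>F m in sequentially. (\<integral>\<omega>. L k (Z \<omega>) \<partial>N) - e / 4 < (\<integral>\<omega>. L k (step_path m (skeleton m (Z \<omega>))) \<partial>N)"
    by (rule order_tendstoD) (use e in auto)
  \<comment> \<open>The Lipschitz constant \<open>k\<close> is already fixed, so the oscillation can
    be required to be small relative to it.\<close>
  moreover have "e / (4 * real k) > 0" using e k by simp
  note skeleton_close[OF this]
  ultimately have "\<forall>\<^sub>F m in sequentially. (\<integral>\<omega>. L k (Z \<omega>) \<partial>N) - e / 4 < (\<integral>\<omega>. L k (step_path m (skeleton m (Z \<omega>))) \<partial>N) \<and>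
     (\<forall>\<^sub>F n in sequentially.
      \<exists>U. integrable M U \<and> (\<forall>\<omega>\<in>space M. unif_dist (Y n \<omega>) (step_path m (skeleton m (Y n \<omega>))) \<le> U \<omega>) \<and>
        (\<integral>\<omega>. U \<omega> \<partial>M) \<le> e / (4 * real k)) \<and> m \<ge> 1"
    using eventually_ge_at_top[of 1] by eventually_elim auto
  then obtain m where m: "(\<integral>\<omega>. L k (Z \<omega>) \<partial>N) - e / 4 < (\<integral>\<omega>. L k (step_path m (skeleton m (Z \<omega>))) \<partial>N)"
    "\<forall>\<^sub>F n in sequentially.
      \<exists>U. integrable M U \<and> (\<forall>\<omega>\<in>space M. unif_dist (Y n \<omega>) (step_path m (skeleton m (Y n \<omega>))) \<le> U \<omega>) \<and>
        (\<integral>\<omega>. U \<omega> \<partial>M) \<le> e / (4 * real k)" "m \<ge> 1"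
    unfolding eventually_sequentially by (meson order_refl)
  have "(\<lambda>n. \<integral>\<omega>. L k (step_path m (skeleton m (Y n \<omega>))) \<partial>M) \<longlonglongrightarrow> (\<integral>\<omega>. L k (step_path m (skeleton m (Z \<omega>))) \<partial>N)"
    by (rule skeleton_tendsto[OF m(3) Lstep[of k m], where B = 1]) (use L01 step_path_D01 in auto)
  then have "\<forall>\<^sub>F n in sequentially. (\<integral>\<omega>. L k (step_path m (skeleton m (Z \<omega>))) \<partial>N) - e / 4
      < (\<integral>\<omega>. L k (step_path m (skeleton m (Y n \<omega>))) \<partial>M)"
    by (rule order_tendstoD) (use e in auto)
  with m(2) show ?thesis
  proof eventually_elim
    case (elim n)
    then obtain U where U: "integrable M U"
      "\<And>\<omega>. \<omega> \<in> space M \<Longrightarrow> unif_dist (Y n \<omega>) (step_path m (skeleton m (Y n \<omega>))) \<le> U \<omega>"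
      "(\<integral>\<omega>. U \<omega> \<partial>M) \<le> e / (4 * real k)" by blast
    have i1: "integrable M (\<lambda>\<omega>. L k (step_path m (skeleton m (Y n \<omega>))))"
      by (rule M.integrable_const_bound[of _ 1]) (use L01 step_path_D01 LYm_meas in auto)
    have i2: "integrable M (\<lambda>\<omega>. G (Y n \<omega>))"
      by (rule M.integrable_const_bound[of _ 1]) (use G Y_D01 measurable_compose[OF Y Gm] in auto)
    have "(\<integral>\<omega>. L k (step_path m (skeleton m (Y n \<omega>))) \<partial>M) - real k * (\<integral>\<omega>. U \<omega> \<partial>M) =
      (\<integral>\<omega>. L k (step_path m (skeleton m (Y n \<omega>))) - real k * U \<omega> \<partial>M)"
      using i1 U(1) by simp
    also have "\<dots> \<le> (\<integral>\<omega>. G (Y n \<omega>) \<partial>M)"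
    proof (rule integral_mono)
      fix \<omega> assume \<omega>: "\<omega> \<in> space M"
      have "L k (step_path m (skeleton m (Y n \<omega>))) - real k * unif_dist (step_path m (skeleton m (Y n \<omega>))) (Y n \<omega>) \<le> L k (Y n \<omega>)"
        unfolding L_def by (rule lip_reg_lipschitz[OF _ G step_path_D01 Y_D01[OF \<omega>]]) auto
      moreover have "L k (Y n \<omega>) \<le> G (Y n \<omega>)"
        unfolding L_def by (rule lip_reg_le[OF _ G Y_D01[OF \<omega>]]) auto
      moreover have "real k * unif_dist (step_path m (skeleton m (Y n \<omega>))) (Y n \<omega>) \<le> real k * U \<omega>"
        using U(2)[OF \<omega>] by (intro mult_left_mono) (auto simp: unif_dist_commute)
      ultimately show "L k (step_path m (skeleton m (Y n \<omega>))) - real k * U \<omega> \<le> G (Y n \<omega>)" by linarith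
    qed (use i1 i2 U in auto)
    finally have 1: "(\<integral>\<omega>. L k (step_path m (skeleton m (Y n \<omega>))) \<partial>M) - real k * (\<integral>\<omega>. U \<omega> \<partial>M) \<le> (\<integral>\<omega>. G (Y n \<omega>) \<partial>M)" .
    have "real k * (\<integral>\<omega>. U \<omega> \<partial>M) \<le> real k * (e / (4 * real k))"
      using U(3) by (intro mult_left_mono) auto
    also have "\<dots> = e / 4" using k by simp
    finally show ?case using 1 elim k m by linarith
  qed
qed

text \<open>The upper estimate is the lower one for \<open>1 - G\<close>, which again has values in
  [0,1] and is continuous at continuous paths.\<close>

lemma expectation_tendsto:
  fixes G :: "(real \<Rightarrow> real) \<Rightarrow> real"
  assumes Gm: "G \<in> borel_measurable skorokhod_borel"
    and G: "\<And>f. f \<in> D01 \<Longrightarrow> 0 \<le> G f" "\<And>f. f \<in> D01 \<Longrightarrow> G f \<le> 1"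
    and cont: "\<And>f e. f \<in> C01 \<Longrightarrow> e > 0 \<Longrightarrow> \<exists>d>0. \<forall>g\<in>D01. unif_dist f g < d \<longrightarrow> \<bar>G g - G f\<bar> < e"
  shows "(\<lambda>n. \<integral>\<omega>. G (Y n \<omega>) \<partial>M) \<longlonglongrightarrow> (\<integral>\<omega>. G (Z \<omega>) \<partial>N)"
proof (rule tendstoI)
  fix e :: real assume e: "e > 0"
  have i1: "integrable M (\<lambda>\<omega>. G (Y n \<omega>))" for n
    by (rule M.integrable_const_bound[of _ 1]) (use G Y_D01 measurable_compose[OF Y Gm] in auto)
  have i2: "integrable N (\<lambda>\<omega>. G (Z \<omega>))"
    by (rule N.integrable_const_bound[of _ 1]) (use G Z_D01 measurable_compose[OF Z_measurable Gm] in auto)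
  have "\<forall>\<^sub>F n in sequentially. (\<integral>\<omega>. G (Z \<omega>) \<partial>N) - e / 2 \<le> (\<integral>\<omega>. G (Y n \<omega>) \<partial>M)"
  proof (rule expectation_lower_bound[OF Gm G])
    fix f e assume "f \<in> C01" "(e::real) > 0"
    from cont[OF this] obtain d where "d > 0" "\<forall>g\<in>D01. unif_dist f g < d \<longrightarrow> \<bar>G g - G f\<bar> < e" by blast
    then show "\<exists>d>0. \<forall>g\<in>D01. unif_dist f g < d \<longrightarrow> G f - e < G g"
      by (intro exI[of _ d]) (auto simp: abs_less_iff)
  qed (use e in auto)
  moreover have "\<forall>\<^sub>F n in sequentially. (\<integral>\<omega>. 1 - G (Z \<omega>) \<partial>N) - e / 2 \<le> (\<integral>\<omega>. 1 - G (Y n \<omega>) \<partial>M)"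
  proof (rule expectation_lower_bound)
    show "(\<lambda>f. 1 - G f) \<in> borel_measurable skorokhod_borel" using Gm by simp
    fix f e assume "f \<in> C01" "(e::real) > 0"
    from cont[OF this] obtain d where "d > 0" "\<forall>g\<in>D01. unif_dist f g < d \<longrightarrow> \<bar>G g - G f\<bar> < e" by blast
    then show "\<exists>d>0. \<forall>g\<in>D01. unif_dist f g < d \<longrightarrow> 1 - G f - e < 1 - G g"
      by (intro exI[of _ d]) (auto simp: abs_less_iff)
  qed (use e G in auto)
  ultimately show "\<forall>\<^sub>F n in sequentially. dist (\<integral>\<omega>. G (Y n \<omega>) \<partial>M) (\<integral>\<omega>. G (Z \<omega>) \<partial>N) < e"
  proof eventually_elim
    case (elim n)
    then show ?case using e i1[of n] i2 M.prob_space N.prob_space by (simp add: dist_real_def abs_less_iff)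
  qed
qed

text \<open>Weak convergence on the line is tested with the piecewise linear functions
  \<open>cts_step\<close>. Composed with \<open>F\<close> they take values in [0,1], and their
  uniform continuity preserves continuity of \<open>F\<close> at continuous paths.\<close>

theorem C_convergesI: "C_converges M Y N Z"
  unfolding C_converges_def
proof (intro conjI allI ballI impI)
  fix F assume Fm: "F \<in> borel_measurable skorokhod_borel"
    and F: "\<forall>f\<in>C01. topcontinuous_at uniform_topology euclideanreal F f"
  have FY: "(\<lambda>\<omega>. F (Y n \<omega>)) \<in> borel_measurable M" for n by (rule measurable_compose[OF Y Fm])
  have FZ: "(\<lambda>\<omega>. F (Z \<omega>)) \<in> borel_measurable N" by (rule measurable_compose[OF Z_measurable Fm])
  show "weak_conv_m (\<lambda>n. distr M borel (\<lambda>\<omega>. F (Y n \<omega>))) (distr N borel (\<lambda>\<omega>. F (Z \<omega>)))"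
  proof (rule integral_cts_step_conv_imp_weak_conv)
    show "real_distribution (distr M borel (\<lambda>\<omega>. F (Y n \<omega>)))" for n
      by (rule M.real_distribution_distr[OF FY])
    show "real_distribution (distr N borel (\<lambda>\<omega>. F (Z \<omega>)))"
      by (rule N.real_distribution_distr[OF FZ])
    fix x y :: real assume xy: "x < y"
    have uc: "uniformly_continuous_on UNIV (cts_step x y)" by (rule cts_step_uniformly_continuous[OF xy])
    then have cm: "cts_step x y \<in> borel_measurable borel"
      by (intro borel_measurable_continuous_onI uniformly_continuous_imp_continuous)
    have "(\<lambda>n. \<integral>\<omega>. cts_step x y (F (Y n \<omega>)) \<partial>M) \<longlonglongrightarrow> (\<integral>\<omega>. cts_step x y (F (Z \<omega>)) \<partial>N)"
    proof (rule expectation_tendsto)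
      show "(\<lambda>f. cts_step x y (F f)) \<in> borel_measurable skorokhod_borel"
        by (rule measurable_compose[OF Fm cm])
      fix f and e :: real assume f: "f \<in> C01" and e: "e > 0"
      obtain d where d: "d > 0" "\<And>u v. \<bar>u - v\<bar> < d \<Longrightarrow> \<bar>cts_step x y u - cts_step x y v\<bar> < e"
        using uc e unfolding uniformly_continuous_on_def dist_real_def by (metis UNIV_I)
      obtain d' where "d' > 0" "\<And>g. g \<in> D01 \<Longrightarrow> unif_dist f g < d' \<Longrightarrow> \<bar>F g - F f\<bar> < d"
        using topcontinuous_at_uniformD[OF F[rule_format, OF f] d(1)] by blast
      then show "\<exists>d>0. \<forall>g\<in>D01. unif_dist f g < d \<longrightarrow> \<bar>cts_step x y (F g) - cts_step x y (F f)\<bar> < e"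
        using d(2) by blast
    qed (use xy in \<open>auto simp: cts_step_def divide_simps\<close>)
    then show "(\<lambda>n. integral\<^sup>L (distr M borel (\<lambda>\<omega>. F (Y n \<omega>))) (cts_step x y)) \<longlonglongrightarrow>
        integral\<^sup>L (distr N borel (\<lambda>\<omega>. F (Z \<omega>))) (cts_step x y)"
      by (simp add: integral_distr[OF FY cm] integral_distr[OF FZ cm])
  qed
qed (use Z_measurable Z in auto)

end

section \<open>Almost sure convergence of random series\<close>

text \<open>The random walk stopped when its modulus first reaches \<open>e\<close>. Written as a
  recursion, each new term is multiplied by an indicator of the past, hence by something independent
  of it when the terms are independent.\<close>

fun stopped_sum :: "real \<Rightarrow> (nat \<Rightarrow> real) \<Rightarrow> nat \<Rightarrow> real" where
  "stopped_sum e x 0 = 0"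
| "stopped_sum e x (Suc n) = stopped_sum e x n + (if \<bar>stopped_sum e x n\<bar> < e then x n else 0)"

lemma stopped_sum_eq:
  "(\<And>j. j \<le> n \<Longrightarrow> \<bar>\<Sum>i<j. x i\<bar> < e) \<Longrightarrow> stopped_sum e x n = (\<Sum>i<n. x i)"
proof (induction n)
  case (Suc n)
  have "\<bar>\<Sum>i<n. x i\<bar> < e" using Suc.prems[of n] by simp
  then show ?case using Suc.IH Suc.prems by simp
qed simp

lemma stopped_sum_ge: "j \<le> n \<Longrightarrow> e \<le> \<bar>\<Sum>i<j. x i\<bar> \<Longrightarrow> e \<le> \<bar>stopped_sum e x n\<bar>"
proof (induction n arbitrary: j)
  case (Suc n)
  show ?case
  proof (cases "\<exists>j\<le>n. e \<le> \<bar>\<Sum>i<j. x i\<bar>")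
    case True
    then have "e \<le> \<bar>stopped_sum e x n\<bar>" using Suc.IH by blast
    then show ?thesis by simp
  next
    case False
    then have "j = Suc n" using Suc.prems le_Suc_eq by blast
    moreover have "stopped_sum e x n = (\<Sum>i<n. x i)"
      by (rule stopped_sum_eq) (use False in \<open>meson not_le\<close>)
    ultimately show ?thesis using False Suc.prems(2) by (auto simp: not_le)
  qed
qed simp

lemma stopped_sum_cong: "(\<And>i. i < n \<Longrightarrow> x i = y i) \<Longrightarrow> stopped_sum e x n = stopped_sum e y n"
  by (induction n) auto

lemma stopped_sum_measurable:
  "n \<le> N \<Longrightarrow> (\<lambda>x. stopped_sum e x n) \<in> borel_measurable (PiM {..<N} (\<lambda>_. borel))"
proof (induction n)
  case (Suc n)
  then have [measurable]: "(\<lambda>x. stopped_sum e x n) \<in> borel_measurable (PiM {..<N} (\<lambda>_. borel))" by simp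
  have [measurable]: "(\<lambda>x. x n) \<in> borel_measurable (PiM {..<N} (\<lambda>_. borel :: real measure))"
    using Suc.prems by (intro measurable_component_singleton) auto
  show ?case by simp
qed simp

section \<open>Kolmogorov's maximal inequality and the one-series theorem\<close>

context prob_space
begin

lemma indep_vars_reindex_inj:
  assumes X: "indep_vars (\<lambda>_. N) X I" and f: "inj_on f L" "f ` L \<subseteq> I"
  shows "indep_vars (\<lambda>_. N) (\<lambda>j. X (f j)) L"
proof -
  have "indep_vars (\<lambda>j. PiM {f j} (\<lambda>_. N)) (\<lambda>j \<omega>. restrict (\<lambda>i. X i \<omega>) {f j}) L"
    using f by (intro indep_vars_restrict[OF X]) (auto simp: disjoint_family_on_def inj_on_def)
  from indep_vars_compose2[OF this, of "\<lambda>j x. x (f j)" "\<lambda>_. N"] show ?thesis by simp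
qed

lemma indep_var_past:
  fixes X :: "nat \<Rightarrow> 'a \<Rightarrow> real"
  assumes X: "indep_vars (\<lambda>_. borel) X UNIV"
    and g: "g \<in> borel_measurable (PiM {..<n} (\<lambda>_. borel :: real measure))"
  shows "indep_var borel (\<lambda>\<omega>. g (\<lambda>i\<in>{..<n}. X i \<omega>)) borel (X n)"
proof -
  have "indep_var borel (g \<circ> (\<lambda>\<omega>. \<lambda>i\<in>{..<n}. X i \<omega>)) borel ((\<lambda>x. x n) \<circ> (\<lambda>\<omega>. \<lambda>i\<in>{n}. X i \<omega>))"
    by (rule indep_var_compose[OF indep_var_restrict[OF X] g]) auto
  then show ?thesis by (simp add: comp_def)
qed

lemma indep_var_mult_mean_zero:
  assumes "indep_var borel X borel (Y :: 'a \<Rightarrow> real)" "integrable M X" "integrable M Y" "expectation Y = 0"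
  shows "integrable M (\<lambda>\<omega>. X \<omega> * Y \<omega>)" "expectation (\<lambda>\<omega>. X \<omega> * Y \<omega>) = 0"
  using indep_var_integrable[OF assms(1-3)] indep_var_lebesgue_integral[OF assms(1-3)] assms(4) by auto

text \<open>The cross term is a function of the past times an independent centred variable and has
  mean zero; stopping can only remove squares from what remains.\<close>

lemma stopped_sum_second_moment:
  fixes X :: "nat \<Rightarrow> 'a \<Rightarrow> real"
  assumes X: "indep_vars (\<lambda>_. borel) X UNIV"
    and X2: "\<And>i. integrable M (\<lambda>\<omega>. (X i \<omega>)\<^sup>2)" and X0: "\<And>i. expectation (X i) = 0"
  shows "integrable M (\<lambda>\<omega>. (stopped_sum e (\<lambda>i. X i \<omega>) n)\<^sup>2) \<and>
    expectation (\<lambda>\<omega>. (stopped_sum e (\<lambda>i. X i \<omega>) n)\<^sup>2) \<le> (\<Sum>i<n. expectation (\<lambda>\<omega>. (X i \<omega>)\<^sup>2))"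
proof (induction n)
  case (Suc n)
  have Xm [measurable]: "X i \<in> borel_measurable M" for i
    using X by (auto simp: indep_vars_def)
  have X1: "integrable M (X i)" for i
    by (rule square_integrable_imp_integrable[OF Xm X2])
  define T where "T \<omega> = stopped_sum e (\<lambda>i. X i \<omega>) n" for \<omega>
  have T_eq: "T \<omega> = stopped_sum e (\<lambda>i\<in>{..<n}. X i \<omega>) n" for \<omega>
    unfolding T_def by (rule stopped_sum_cong) auto
  \<comment> \<open>The truncation keeps the factor of \<open>X n\<close> bounded, so the product is
    integrable by independence.\<close>
  define g where "g t = (if \<bar>t\<bar> < e then t else 0)" for t :: real
  have gm [measurable]: "g \<in> borel_measurable borel" unfolding g_def by measurable
  have Tm [measurable]: "T \<in> borel_measurable M"
    unfolding T_eq[abs_def]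
    by (rule measurable_compose[OF measurable_restrict stopped_sum_measurable]) auto
  have ind: "indep_var borel (\<lambda>\<omega>. g (T \<omega>)) borel (X n)"
    unfolding T_eq by (rule indep_var_past[OF X]) (use stopped_sum_measurable[of n n e] in measurable)
  have gi: "integrable M (\<lambda>\<omega>. g (T \<omega>))"
    by (rule integrable_const_bound[of _ "\<bar>e\<bar>"]) (auto simp: g_def)
  note c = indep_var_mult_mean_zero[OF ind gi X1 X0]
  have pw: "(T \<omega> + (if \<bar>T \<omega>\<bar> < e then X n \<omega> else 0))\<^sup>2 =
      (T \<omega>)\<^sup>2 + 2 * (g (T \<omega>) * X n \<omega>) + (if \<bar>T \<omega>\<bar> < e then (X n \<omega>)\<^sup>2 else 0)" for \<omega>
    by (simp add: g_def power2_eq_square algebra_simps)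
  have i3: "integrable M (\<lambda>\<omega>. if \<bar>T \<omega>\<bar> < e then (X n \<omega>)\<^sup>2 else 0)"
    by (rule Bochner_Integration.integrable_bound[OF X2[of n]]) auto
  have IH: "integrable M (\<lambda>\<omega>. (T \<omega>)\<^sup>2)" "expectation (\<lambda>\<omega>. (T \<omega>)\<^sup>2) \<le> (\<Sum>i<n. expectation (\<lambda>\<omega>. (X i \<omega>)\<^sup>2))"
    using Suc.IH by (auto simp: T_def)
  have "expectation (\<lambda>\<omega>. if \<bar>T \<omega>\<bar> < e then (X n \<omega>)\<^sup>2 else 0) \<le> expectation (\<lambda>\<omega>. (X n \<omega>)\<^sup>2)"
    by (intro integral_mono i3 X2) auto
  then show ?case
    unfolding stopped_sum.simps T_def[symmetric] pw
    using IH c i3 by simp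
qed simp

text \<open>Once the walk has reached modulus \<open>e\<close>, the stopped walk keeps it up to time
  \<open>n\<close>, so the event is contained in one to which Chebyshev's inequality
  applies.\<close>

theorem kolmogorov_maximal_inequality:
  fixes X :: "nat \<Rightarrow> 'a \<Rightarrow> real"
  assumes X: "indep_vars (\<lambda>_. borel) X UNIV"
    and X2: "\<And>i. integrable M (\<lambda>\<omega>. (X i \<omega>)\<^sup>2)" and X0: "\<And>i. expectation (X i) = 0"
    and e: "e > 0"
  shows "prob {\<omega> \<in> space M. \<exists>j\<le>n. e \<le> \<bar>\<Sum>i<j. X i \<omega>\<bar>} \<le> (\<Sum>i<n. expectation (\<lambda>\<omega>. (X i \<omega>)\<^sup>2)) / e\<^sup>2"
proof -
  let ?T = "\<lambda>\<omega>. stopped_sum e (\<lambda>i. X i \<omega>) n"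
  note T = stopped_sum_second_moment[OF X X2 X0, of e n]
  have [measurable]: "(\<lambda>\<omega>. (?T \<omega>)\<^sup>2) \<in> borel_measurable M" using T by auto
  have "prob {\<omega> \<in> space M. \<exists>j\<le>n. e \<le> \<bar>\<Sum>i<j. X i \<omega>\<bar>} \<le> prob {\<omega> \<in> space M. e\<^sup>2 \<le> (?T \<omega>)\<^sup>2}"
  proof (rule finite_measure_mono)
    show "{\<omega> \<in> space M. \<exists>j\<le>n. e \<le> \<bar>\<Sum>i<j. X i \<omega>\<bar>} \<subseteq> {\<omega> \<in> space M. e\<^sup>2 \<le> (?T \<omega>)\<^sup>2}"
      using stopped_sum_ge e by (auto simp: abs_le_square_iff[symmetric])
  qed measurable
  also have "\<dots> \<le> expectation (\<lambda>\<omega>. (?T \<omega>)\<^sup>2) / e\<^sup>2"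
    by (rule integral_Markov_inequality_measure[where A = "{}"]) (use T e in auto)
  also have "\<dots> \<le> (\<Sum>i<n. expectation (\<lambda>\<omega>. (X i \<omega>)\<^sup>2)) / e\<^sup>2"
    using T by (intro divide_right_mono) auto
  finally show ?thesis .
qed

text \<open>By the maximal inequality, the probability that the sum started at \<open>m\<close> ever
  reaches modulus \<open>e\<close> is at most a tail of the variance series over
  \<open>e\<^sup>2\<close>. Letting \<open>m\<close> grow, almost surely some tail never does; along
  \<open>e = 1 / Suc k\<close> this is Cauchy's criterion.\<close>

theorem summable_indep_AE:
  fixes X :: "nat \<Rightarrow> 'a \<Rightarrow> real"
  assumes X: "indep_vars (\<lambda>_. borel) X UNIV"
    and X2: "\<And>i. integrable M (\<lambda>\<omega>. (X i \<omega>)\<^sup>2)" and X0: "\<And>i. expectation (X i) = 0"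
    and sum: "summable (\<lambda>i. expectation (\<lambda>\<omega>. (X i \<omega>)\<^sup>2))"
  shows "AE \<omega> in M. summable (\<lambda>i. X i \<omega>)"
proof -
  define v where "v i = expectation (\<lambda>\<omega>. (X i \<omega>)\<^sup>2)" for i
  have v: "v i \<ge> 0" "summable v" for i using sum by (auto simp: v_def[abs_def])
  have Xm [measurable]: "X i \<in> borel_measurable M" for i
    using X by (auto simp: indep_vars_def)
  define A where "A e m n = {\<omega> \<in> space M. \<exists>j\<le>n. e \<le> \<bar>\<Sum>i<j. X (i + m) \<omega>\<bar>}" for e m n
  have A [measurable]: "A e m n \<in> sets M" for e m n unfolding A_def by measurable
  have Un: "prob (\<Union>n. A e m n) \<le> (\<Sum>i. v (i + m)) / e\<^sup>2" if e: "e > 0" for e m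
  proof (rule LIMSEQ_le_const2)
    show "(\<lambda>n. prob (A e m n)) \<longlonglongrightarrow> prob (\<Union>n. A e m n)"
    proof (rule finite_Lim_measure_incseq)
      show "incseq (A e m)" unfolding A_def incseq_def by (auto intro: order_trans)
    qed (use A in auto)
    have ind: "indep_vars (\<lambda>_. borel) (\<lambda>i. X (i + m)) UNIV"
      by (rule indep_vars_reindex_inj[OF X]) auto
    show "\<exists>N. \<forall>n\<ge>N. prob (A e m n) \<le> (\<Sum>i. v (i + m)) / e\<^sup>2"
    proof (intro exI allI impI)
      fix n
      have "prob (A e m n) \<le> (\<Sum>i<n. v (i + m)) / e\<^sup>2"
        unfolding A_def v_def by (rule kolmogorov_maximal_inequality[OF ind X2 X0 e])
      also have "\<dots> \<le> (\<Sum>i. v (i + m)) / e\<^sup>2"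
        using v by (intro divide_right_mono sum_le_suminf) (auto simp: summable_iff_shift)
      finally show "prob (A e m n) \<le> (\<Sum>i. v (i + m)) / e\<^sup>2" .
    qed
  qed
  have "AE \<omega> in M. \<exists>m. \<forall>n. \<omega> \<notin> A e m n" if e: "e > 0" for e
  proof (rule AE_I)
    define N where "N = (\<Inter>m. \<Union>n. A e m n)"
    have N [measurable]: "N \<in> sets M" unfolding N_def by measurable
    have "prob N \<le> 0"
    proof (rule LIMSEQ_le_const)
      have "(\<lambda>m. (\<Sum>i. v (i + m)) / e\<^sup>2) \<longlonglongrightarrow> 0 / e\<^sup>2"
        using v e by (intro tendsto_divide suminf_exist_split2 tendsto_const) auto
      then show "(\<lambda>m. (\<Sum>i. v (i + m)) / e\<^sup>2) \<longlonglongrightarrow> 0" by simp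
      show "\<exists>N'. \<forall>m\<ge>N'. prob N \<le> (\<Sum>i. v (i + m)) / e\<^sup>2"
      proof (intro exI allI impI)
        fix m
        have "prob N \<le> prob (\<Union>n. A e m n)"
          by (rule finite_measure_mono) (auto simp: N_def)
        then show "prob N \<le> (\<Sum>i. v (i + m)) / e\<^sup>2" using Un[OF e, of m] by linarith
      qed
    qed
    then have "prob N = 0" using measure_nonneg[of M N] by linarith
    then show "emeasure M N = 0" by (simp add: emeasure_eq_measure)
    show "N \<in> sets M" by fact
    show "{\<omega> \<in> space M. \<not> (\<exists>m. \<forall>n. \<omega> \<notin> A e m n)} \<subseteq> N" by (auto simp: N_def)
  qed
  then have "AE \<omega> in M. \<forall>k. \<exists>m. \<forall>n. \<omega> \<notin> A (1 / real (Suc k)) m n"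
    unfolding AE_all_countable by auto
  with AE_space show ?thesis
  proof (eventually_elim, goal_cases)
    case (1 \<omega>)
    show ?case
      unfolding summable_Cauchy
    proof (intro allI impI)
      fix e :: real assume "e > 0"
      obtain k where k: "1 / real (Suc k) < e / 2"
        using reals_Archimedean[of "e / 2"] \<open>e > 0\<close> by (auto simp: inverse_eq_divide)
      obtain m where m: "\<And>n. \<omega> \<notin> A (1 / real (Suc k)) m n" using 1(2) by blast
      \<comment> \<open>Half of \<open>e\<close>, because a block sum from \<open>p\<close> to
        \<open>n\<close> is the difference of two sums that start at \<open>m\<close>.\<close>
      have b: "\<bar>\<Sum>i<j. X (i + m) \<omega>\<bar> < e / 2" for j
        using m[of j] k 1(1) by (force simp: A_def)
      have S: "(\<Sum>i<j. X (i + m) \<omega>) = sum (\<lambda>i. X i \<omega>) {m..<m + j}" for j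
        using sum.shift_bounds_nat_ivl[of "\<lambda>i. X i \<omega>" 0 m j] by (simp add: atLeast0LessThan add.commute)
      show "\<exists>N. \<forall>p\<ge>N. \<forall>n. norm (sum (\<lambda>i. X i \<omega>) {p..<n}) < e"
      proof (intro exI[of _ m] allI impI)
        fix p n assume p: "m \<le> p"
        show "norm (sum (\<lambda>i. X i \<omega>) {p..<n}) < e"
        proof (cases "p \<le> n")
          case True
          have "sum (\<lambda>i. X i \<omega>) {m..<p} + sum (\<lambda>i. X i \<omega>) {p..<n} = sum (\<lambda>i. X i \<omega>) {m..<n}"
            using p True by (rule sum.atLeastLessThan_concat)
          then show ?thesis using b[of "p - m"] b[of "n - m"] p True unfolding S by (auto simp: abs_less_iff)
        qed (use \<open>e > 0\<close> in auto)
      qed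
    qed
  qed
qed

end

section \<open>Power inequalities\<close>

lemma powr_Bernoulli:
  fixes r x :: real
  assumes "r \<ge> 1" "x \<ge> 0"
  shows "1 + r * x \<le> (1 + x) powr r"
proof (cases "x = 0")
  case False
  then have x: "x > 0" using assms by simp
  have "\<exists>z. 1 < z \<and> z < 1 + x \<and> (1 + x) powr r - 1 powr r = (1 + x - 1) * (r * z powr (r - 1))"
    by (rule MVT2) (use x in \<open>auto intro!: derivative_eq_intros\<close>)
  then obtain z where z: "1 < z" "(1 + x) powr r - 1 = x * (r * z powr (r - 1))" by auto
  have "1 \<le> z powr (r - 1)" using z assms by (intro ge_one_powr_ge_zero) auto
  then have "x * (r * 1) \<le> x * (r * z powr (r - 1))"
    using assms x by (intro mult_left_mono) auto
  then show ?thesis using z by (simp add: mult.commute)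
qed simp

text \<open>Convexity puts the power function above its tangent at \<open>s\<close>; dividing by
  \<open>s\<close> reduces this to Bernoulli's inequality.\<close>

lemma powr_add_ge_tangent:
  fixes r s d :: real
  assumes "r \<ge> 1" "s > 0" "d \<ge> 0"
  shows "s powr r + r * s powr (r - 1) * d \<le> (s + d) powr r"
proof -
  have "s powr r * (1 + r * (d / s)) \<le> s powr r * (1 + d / s) powr r"
    using assms by (intro mult_left_mono powr_Bernoulli) auto
  also have "\<dots> = (s * (1 + d / s)) powr r" using assms by (simp add: powr_mult)
  also have "s * (1 + d / s) = s + d" using assms by (simp add: field_simps)
  finally show ?thesis using assms by (simp add: powr_diff algebra_simps)
qed

lemma powr_superadditive:
  fixes r s d :: real
  assumes "r \<ge> 1" "s \<ge> 0" "d \<ge> 0"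
  shows "s powr r + d powr r \<le> (s + d) powr r"
proof (cases "s = 0 \<or> d = 0")
  case False
  then have sd: "s > 0" "d > 0" using assms by auto
  have "s powr r = s powr (r - 1) * s" "d powr r = d powr (r - 1) * d"
    using sd by (simp_all add: powr_diff)
  moreover have "(s + d) powr r = (s + d) powr (r - 1) * s + (s + d) powr (r - 1) * d"
    using sd by (simp add: powr_diff add_divide_distrib[symmetric] distrib_left[symmetric])
  moreover have "s powr (r - 1) * s \<le> (s + d) powr (r - 1) * s" "d powr (r - 1) * d \<le> (s + d) powr (r - 1) * d"
    using sd assms by (auto intro!: mult_right_mono powr_mono2)
  ultimately show ?thesis by linarith
qed auto

text \<open>For small \<open>t\<close> this is Taylor's formula of second order; away from 0 the
  power of order \<open>p\<close> dominates all other terms.\<close>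

lemma abs_powr_expand_one:
  fixes p :: real
  assumes p: "p \<ge> 2"
  obtains C where "C > 0"
    "\<And>t. \<bar>1 + t\<bar> powr p \<le> 1 + p * t + C * (t\<^sup>2 + \<bar>t\<bar> powr p)"
proof
  \<comment> \<open>The first summand bounds the second derivative near 1. For
    \<open>\<bar>t\<bar> > 1 / 2\<close>, the second comes from
    \<open>\<bar>1 + t\<bar> \<le> 3 * \<bar>t\<bar>\<close>, and the third compensates a negative
    linear term through \<open>\<bar>t\<bar> \<le> (2 * \<bar>t\<bar>) powr p\<close>.\<close>
  define C where "C = p * (p - 1) * 2 powr p + 3 powr p + p * 2 powr p"
  have C1: "0 \<le> p * (p - 1) * 2 powr p" "0 < (3::real) powr p" "0 \<le> p * 2 powr p" using p by auto
  then show C: "C > 0" unfolding C_def by linarith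
  fix t :: real
  show "\<bar>1 + t\<bar> powr p \<le> 1 + p * t + C * (t\<^sup>2 + \<bar>t\<bar> powr p)"
  proof (cases "\<bar>t\<bar> \<le> 1 / 2")
    case True
    show ?thesis
    proof (cases "t = 0")
      case False
      define D where "D m u = (if m = 0 then u powr p else if m = 1 then p * u powr (p - 1) else p * ((p - 1) * u powr (p - 2)))" for m :: nat and u :: real
      have "\<exists>z. (if 1 + t < 1 then 1 + t < z \<and> z < 1 else 1 < z \<and> z < 1 + t) \<and>
        (1 + t) powr p = (\<Sum>m<2. (D m 1 / fact m) * ((1 + t) - 1) ^ m) + (D 2 z / fact 2) * ((1 + t) - 1) ^ 2"
      proof (rule Taylor[where a = "1/2" and b = "3/2"])
        show "\<forall>m u. m < 2 \<and> 1 / 2 \<le> u \<and> u \<le> 3 / 2 \<longrightarrow> (D m has_real_derivative D (Suc m) u) (at u)"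
        proof (intro allI impI)
          fix m :: nat and u :: real assume "m < 2 \<and> 1 / 2 \<le> u \<and> u \<le> 3 / 2"
          then have "m = 0 \<or> m = 1" "u > 0" by auto
          then show "(D m has_real_derivative D (Suc m) u) (at u)"
            unfolding D_def by (auto intro!: derivative_eq_intros)
        qed
      qed (use True False in \<open>auto simp: D_def abs_le_iff\<close>)
      then obtain z where z: "(if 1 + t < 1 then 1 + t < z \<and> z < 1 else 1 < z \<and> z < 1 + t)"
        "(1 + t) powr p = 1 + p * t + p * ((p - 1) * z powr (p - 2)) / 2 * t\<^sup>2"
        by (auto simp: D_def lessThan_Suc numeral_2_eq_2 power2_eq_square)
      have z2: "0 < z" "z \<le> 2" using z(1) True by (auto split: if_splits simp: abs_le_iff)
      have "z powr (p - 2) \<le> 2 powr (p - 2)" using z2 p by (intro powr_mono2) auto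
      also have "\<dots> \<le> 2 powr p" by (intro powr_mono) auto
      finally have "p * ((p - 1) * z powr (p - 2)) / 2 * t\<^sup>2 \<le> p * ((p - 1) * 2 powr p) / 2 * t\<^sup>2"
        using p by (intro mult_right_mono divide_right_mono mult_left_mono) auto
      also have "\<dots> \<le> C * t\<^sup>2"
      proof (intro mult_right_mono)
        have "p * ((p - 1) * 2 powr p) / 2 \<le> p * (p - 1) * 2 powr p" using C1 by simp
        then show "p * ((p - 1) * 2 powr p) / 2 \<le> C" using C1 unfolding C_def by linarith
      qed auto
      also have "\<dots> \<le> C * (t\<^sup>2 + \<bar>t\<bar> powr p)" using C by (intro mult_left_mono) auto
      finally show ?thesis using z(2) True by (simp add: abs_le_iff)
    qed simp
  next
    case False
    define w where "w = 2 * \<bar>t\<bar>"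
    have w: "w \<ge> 1" using False by (simp add: w_def)
    have "\<bar>1 + t\<bar> powr p \<le> (3 * \<bar>t\<bar>) powr p" using False p by (intro powr_mono2) auto
    also have "\<dots> = 3 powr p * \<bar>t\<bar> powr p" by (simp add: powr_mult)
    finally have 1: "\<bar>1 + t\<bar> powr p \<le> 3 powr p * \<bar>t\<bar> powr p" .
    have "\<bar>t\<bar> \<le> w" using w_def by simp
    also have "w = w powr 1" using w by simp
    also have "\<dots> \<le> w powr p" using w p by (intro powr_mono) auto
    also have "\<dots> = 2 powr p * \<bar>t\<bar> powr p" by (simp add: w_def powr_mult)
    finally have "p * \<bar>t\<bar> \<le> p * (2 powr p * \<bar>t\<bar> powr p)" using p by (intro mult_left_mono) auto
    moreover have "- p * t \<le> p * \<bar>t\<bar>" using p by (simp add: abs_if)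
    ultimately have 2: "0 \<le> p * t + p * 2 powr p * \<bar>t\<bar> powr p" by (simp add: algebra_simps)
    have "3 powr p * \<bar>t\<bar> powr p + p * 2 powr p * \<bar>t\<bar> powr p = (3 powr p + p * 2 powr p) * \<bar>t\<bar> powr p"
      by (simp add: algebra_simps)
    also have "\<dots> \<le> C * \<bar>t\<bar> powr p" using C1 by (intro mult_right_mono) (auto simp: C_def)
    also have "\<dots> \<le> C * (t\<^sup>2 + \<bar>t\<bar> powr p)" using C by (intro mult_left_mono) auto
    finally show ?thesis using 1 2 by linarith
  qed
qed

text \<open>The quotient \<open>\<bar>x\<bar> powr p / x\<close> encodes the signed power of order
  \<open>p - 1\<close> without case distinction. At \<open>x = 0\<close> division yields 0, and a
  constant of at least 1 leaves room for the term in \<open>y\<close>.\<close>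

lemma abs_powr_expand:
  fixes p :: real
  assumes p: "p \<ge> 2"
  obtains C where "C > 0"
    "\<And>x y. \<bar>x + y\<bar> powr p \<le> \<bar>x\<bar> powr p + p * (\<bar>x\<bar> powr p / x) * y + C * (\<bar>x\<bar> powr p / x\<^sup>2 * y\<^sup>2 + \<bar>y\<bar> powr p)"
proof -
  obtain C where C: "C > 0" "\<And>t. \<bar>1 + t\<bar> powr p \<le> 1 + p * t + C * (t\<^sup>2 + \<bar>t\<bar> powr p)"
    using abs_powr_expand_one[OF p] by blast
  have "\<bar>x + y\<bar> powr p \<le> \<bar>x\<bar> powr p + p * (\<bar>x\<bar> powr p / x) * y + max 1 C * (\<bar>x\<bar> powr p / x\<^sup>2 * y\<^sup>2 + \<bar>y\<bar> powr p)" for x y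
  proof (cases "x = 0")
    case True
    have "1 * \<bar>y\<bar> powr p \<le> max 1 C * \<bar>y\<bar> powr p" by (intro mult_right_mono) auto
    then show ?thesis using True by simp
  next
    case False
    have "\<bar>x + y\<bar> powr p = \<bar>x\<bar> powr p * \<bar>1 + y / x\<bar> powr p"
      using False by (simp add: powr_mult[symmetric] abs_mult[symmetric] distrib_left)
    also have "\<dots> \<le> \<bar>x\<bar> powr p * (1 + p * (y / x) + C * ((y / x)\<^sup>2 + \<bar>y / x\<bar> powr p))"
      by (intro mult_left_mono C) auto
    also have "\<dots> \<le> \<bar>x\<bar> powr p * (1 + p * (y / x) + max 1 C * ((y / x)\<^sup>2 + \<bar>y / x\<bar> powr p))"
      by (intro mult_left_mono add_left_mono mult_right_mono) auto
    also have "\<dots> = \<bar>x\<bar> powr p + p * (\<bar>x\<bar> powr p / x) * y + max 1 C * (\<bar>x\<bar> powr p / x\<^sup>2 * y\<^sup>2 + \<bar>x\<bar> powr p * \<bar>y / x\<bar> powr p)"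
      by (simp add: algebra_simps power_divide)
    also have "\<bar>x\<bar> powr p * \<bar>y / x\<bar> powr p = (\<bar>x\<bar> * \<bar>y / x\<bar>) powr p"
      by (simp only: powr_mult)
    also have "\<bar>x\<bar> * \<bar>y / x\<bar> = \<bar>y\<bar>"
      using False by (simp add: abs_divide)
    finally show ?thesis .
  qed
  then show thesis by (intro that[of "max 1 C"]) auto
qed

text \<open>A Young-type splitting of the power of order \<open>p - 2\<close> at
  \<open>x\<^sup>2 = s / \<eta>\<close>: above this level dividing by \<open>x\<^sup>2\<close> gains
  \<open>\<eta> / s\<close>, below it the power is bounded by its value at the level.\<close>

lemma powr_div_square_le:
  fixes p \<eta> s x :: real
  assumes p: "p \<ge> 2" and \<eta>: "\<eta> > 0" and s: "s > 0"
  shows "\<bar>x\<bar> powr p / x\<^sup>2 \<le> \<eta> * \<bar>x\<bar> powr p / s + (s / \<eta>) powr (p / 2 - 1)"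
proof (cases "x\<^sup>2 \<ge> s / \<eta>")
  case True
  have "s / \<eta> > 0" using s \<eta> by simp
  then have "\<bar>x\<bar> powr p / x\<^sup>2 \<le> \<bar>x\<bar> powr p / (s / \<eta>)"
    using True by (intro divide_left_mono mult_pos_pos) auto
  also have "\<dots> = \<eta> * \<bar>x\<bar> powr p / s" by simp
  finally show ?thesis by (smt (verit) powr_ge_zero)
next
  case False
  have "\<bar>x\<bar> powr p / x\<^sup>2 \<le> (s / \<eta>) powr (p / 2 - 1)"
  proof (cases "x = 0")
    case False
    have "\<bar>x\<bar> powr p / x\<^sup>2 = (x\<^sup>2) powr (p / 2) / (x\<^sup>2) powr 1"
    proof -
      have "x\<^sup>2 = \<bar>x\<bar> powr 2" using False by simp
      then have "(x\<^sup>2) powr (p / 2) = \<bar>x\<bar> powr p" by (simp only: powr_powr) simp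
      then show ?thesis by simp
    qed
    also have "\<dots> = (x\<^sup>2) powr (p / 2 - 1)" by (simp add: powr_diff)
    also have "\<dots> \<le> (s / \<eta>) powr (p / 2 - 1)" using \<open>\<not> s / \<eta> \<le> x\<^sup>2\<close> p by (intro powr_mono2) auto
    finally show ?thesis .
  qed simp
  moreover have "0 \<le> \<eta> * \<bar>x\<bar> powr p / s" using \<eta> s by simp
  ultimately show ?thesis by linarith
qed

section \<open>Series with square summable coefficients\<close>

text \<open>Fatou's lemma, in the form that carries bounds from finite windows to the
  series.\<close>

lemma integrable_limit_bound:
  fixes f :: "nat \<Rightarrow> 'a \<Rightarrow> real"
  assumes f: "\<And>n. integrable M (f n)" "\<And>n x. x \<in> space M \<Longrightarrow> 0 \<le> f n x"
    and g: "g \<in> borel_measurable M"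
    and lim: "AE x in M. (\<lambda>n. f n x) \<longlonglongrightarrow> g x"
    and le: "\<forall>\<^sub>F n in sequentially. (\<integral>x. f n x \<partial>M) \<le> B"
  shows "integrable M g" "(\<integral>x. g x \<partial>M) \<le> B"
proof -
  have [measurable]: "f n \<in> borel_measurable M" for n using f(1) by auto
  note g [measurable]
  have "0 \<le> (\<integral>x. f n x \<partial>M)" for n by (intro integral_nonneg_AE AE_I2 f)
  then have B: "0 \<le> B" using le by (auto simp: eventually_sequentially intro: order_trans)
  have pos: "AE x in M. 0 \<le> g x"
    using lim AE_space
  proof eventually_elim
    case (elim x)
    then show ?case by (intro LIMSEQ_le_const[OF elim(1)]) (use f(2) in auto)
  qed
  have "(\<integral>\<^sup>+x. ennreal (g x) \<partial>M) = (\<integral>\<^sup>+x. liminf (\<lambda>n. ennreal (f n x)) \<partial>M)"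
  proof (rule nn_integral_cong_AE)
    show "AE x in M. ennreal (g x) = liminf (\<lambda>n. ennreal (f n x))"
      using lim
    proof eventually_elim
      case (elim x)
      then have "(\<lambda>n. ennreal (f n x)) \<longlonglongrightarrow> ennreal (g x)" by (rule tendsto_ennrealI)
      then show ?case by (intro lim_imp_Liminf[symmetric]) auto
    qed
  qed
  also have "\<dots> \<le> liminf (\<lambda>n. \<integral>\<^sup>+x. ennreal (f n x) \<partial>M)"
    by (intro nn_integral_liminf) auto
  also have "\<dots> = liminf (\<lambda>n. ennreal (\<integral>x. f n x \<partial>M))"
    by (intro Liminf_eq always_eventually allI nn_integral_eq_integral f AE_I2)
  also have "\<dots> \<le> ennreal B"
  proof (rule Liminf_le)
    show "\<forall>\<^sub>F n in sequentially. ennreal (\<integral>x. f n x \<partial>M) \<le> ennreal B"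
      using le by eventually_elim (rule ennreal_leI)
  qed auto
  finally have le': "(\<integral>\<^sup>+x. ennreal (g x) \<partial>M) \<le> ennreal B" .
  show int: "integrable M g"
    using le' pos by (intro integrableI_nonneg) (auto intro: order_le_less_trans)
  have "ennreal (\<integral>x. g x \<partial>M) \<le> ennreal B"
    using le' nn_integral_eq_integral[OF int pos] by simp
  then show "(\<integral>x. g x \<partial>M) \<le> B" using B by simp
qed

definition l2 :: "(int \<Rightarrow> real) \<Rightarrow> bool" where
  "l2 c \<longleftrightarrow> (\<lambda>k. (c k)\<^sup>2) summable_on UNIV"

definition l2sq :: "(int \<Rightarrow> real) \<Rightarrow> real" where
  "l2sq c = (\<Sum>\<^sub>\<infinity>k. (c k)\<^sup>2)"

text \<open>Half open, so that \<open>window m\<close> consists of exactly the first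
  \<open>m\<close> indices of each of the two one-sided series.\<close>

definition window :: "nat \<Rightarrow> int set" where
  "window m = {- int m..<int m}"

lemma finite_window [simp]: "finite (window m)"
  by (simp add: window_def)

lemma window_mono: "m \<le> n \<Longrightarrow> window m \<subseteq> window n"
  by (auto simp: window_def)

text \<open>Lets unordered sums of squares be computed along the same windows as the random
  series.\<close>

lemma filterlim_window: "filterlim window (finite_subsets_at_top UNIV) sequentially"
  unfolding filterlim_finite_subsets_at_top
proof (intro allI impI)
  fix X :: "int set" assume "finite X \<and> X \<subseteq> UNIV"
  then have X: "finite X" by simp
  define N where "N = (\<Sum>x\<in>X. nat \<bar>x\<bar>)"
  have "nat \<bar>x\<bar> \<le> N" if "x \<in> X" for x
    unfolding N_def by (rule member_le_sum[OF that _ X]) simp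
  then have "X \<subseteq> window n" if "n \<ge> Suc N" for n using that by (force simp: window_def)
  then show "\<forall>\<^sub>F n in sequentially. finite (window n) \<and> X \<subseteq> window n \<and> window n \<subseteq> UNIV"
    unfolding eventually_sequentially by (intro exI[of _ "Suc N"]) auto
qed

lemma l2sq_window: "l2 c \<Longrightarrow> (\<lambda>m. \<Sum>k\<in>window m. (c k)\<^sup>2) \<longlonglongrightarrow> l2sq c"
  unfolding l2_def l2sq_def
  using filterlim_compose[OF _ filterlim_window] has_sum_infsum unfolding has_sum_def by blast

lemma l2sq_ge_sum: "l2 c \<Longrightarrow> finite I \<Longrightarrow> (\<Sum>k\<in>I. (c k)\<^sup>2) \<le> l2sq c"
  unfolding l2_def l2sq_def by (intro finite_sum_le_infsum) auto

lemma l2sq_nonneg: "0 \<le> l2sq c"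
  unfolding l2sq_def by (intro infsum_nonneg) auto

lemma l2_reindex: "inj f \<Longrightarrow> l2 c \<Longrightarrow> (\<lambda>k. (c (f k))\<^sup>2) summable_on UNIV"
  unfolding l2_def
  using summable_on_reindex[of f UNIV "\<lambda>k. (c k)\<^sup>2"] summable_on_subset_banach[of "\<lambda>k. (c k)\<^sup>2" UNIV "range f"]
  by (auto simp: comp_def)

lemma l2_summable: "inj f \<Longrightarrow> l2 c \<Longrightarrow> summable (\<lambda>k::nat. (c (f k))\<^sup>2)"
  using l2_reindex[of f c] by (simp add: summable_on_UNIV_nonneg_real_iff)

lemma l2_shift: "l2 c \<Longrightarrow> l2 (\<lambda>k. c (j - k))"
  unfolding l2_def[of "\<lambda>k. c (j - k)"] by (rule l2_reindex) (auto intro: injI)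

lemma l2_scale: "l2 c \<Longrightarrow> l2 (\<lambda>k. r * c k)"
  unfolding l2_def power_mult_distrib by (rule summable_on_cmult_right)

lemma l2_add: "l2 c \<Longrightarrow> l2 d \<Longrightarrow> l2 (\<lambda>k. c k + d k)"
proof -
  assume "l2 c" "l2 d"
  then have "(\<lambda>k. 2 * (c k)\<^sup>2 + 2 * (d k)\<^sup>2) summable_on UNIV"
    unfolding l2_def by (intro summable_on_add summable_on_cmult_right)
  then show "l2 (\<lambda>k. c k + d k)"
    unfolding l2_def
  proof (rule summable_on_comparison_test)
    fix k
    show "(c k + d k)\<^sup>2 \<le> 2 * (c k)\<^sup>2 + 2 * (d k)\<^sup>2"
      using sum_squares_bound[of "c k" "d k"] by (simp add: power2_sum)
  qed auto
qed

lemma l2_0: "l2 (\<lambda>_. 0)"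
  by (simp add: l2_def)

lemma l2_sum: "(\<And>i. i \<in> A \<Longrightarrow> l2 (c i)) \<Longrightarrow> l2 (\<lambda>k. \<Sum>i\<in>A. c i k)"
  by (induction A rule: infinite_finite_induct) (auto simp: l2_0 intro: l2_add)

section \<open>Series of independent centred variables\<close>

locale std_iid = prob_space M for M :: "'a measure" +
  fixes \<xi> :: "int \<Rightarrow> 'a \<Rightarrow> real"
  assumes indep: "indep_vars (\<lambda>_. borel) \<xi> UNIV"
    and same_distr: "\<And>j k. distr M borel (\<xi> j) = distr M borel (\<xi> k)"
    and integrable_\<xi>: "\<And>k. integrable M (\<xi> k)"
    and mean_\<xi>: "\<And>k. expectation (\<xi> k) = 0"
    and var_\<xi>: "\<And>k. variance (\<xi> k) = 1"
begin

lemma \<xi>_measurable [measurable]: "\<xi> k \<in> borel_measurable M"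
  using indep by (auto simp: indep_vars_def)

lemma second_moment_\<xi>: "expectation (\<lambda>\<omega>. (\<xi> k \<omega>)\<^sup>2) = 1"
  using var_\<xi>[of k] mean_\<xi>[of k] by simp

text \<open>The integral of a function that is not integrable is 0 by convention, but here it is
  1.\<close>

lemma integrable_\<xi>_square: "integrable M (\<lambda>\<omega>. (\<xi> k \<omega>)\<^sup>2)"
  using second_moment_\<xi>[of k] not_integrable_integral_eq[of M "\<lambda>\<omega>. (\<xi> k \<omega>)\<^sup>2"] by auto

definition psum :: "int set \<Rightarrow> (int \<Rightarrow> real) \<Rightarrow> 'a \<Rightarrow> real" where
  "psum I c \<omega> = (\<Sum>k\<in>I. c k * \<xi> k \<omega>)"

text \<open>Split exactly as in \<open>linear_process\<close>, so that the two agree at every point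
  and not merely almost surely.\<close>

definition series :: "(int \<Rightarrow> real) \<Rightarrow> 'a \<Rightarrow> real" where
  "series c \<omega> = (\<Sum>k. c (int k) * \<xi> (int k) \<omega>) + (\<Sum>k. c (- int (Suc k)) * \<xi> (- int (Suc k)) \<omega>)"

lemma psum_measurable [measurable]: "psum I c \<in> borel_measurable M"
  unfolding psum_def[abs_def] by measurable

lemma series_measurable [measurable]: "series c \<in> borel_measurable M"
  unfolding series_def[abs_def] by measurable

lemma indep_scaled: "indep_vars (\<lambda>_. borel) (\<lambda>k \<omega>. c k * \<xi> k \<omega>) I"
  by (rule indep_vars_compose2[OF indep_vars_subset[OF indep]]) auto

lemma indep_psum:
  assumes "finite I" "k \<notin> I"
  shows "indep_var borel (\<lambda>\<omega>. c k * \<xi> k \<omega>) borel (psum I c)"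
  unfolding psum_def[abs_def] by (rule indep_vars_sum[OF assms indep_scaled])

lemma psum_insert: "finite I \<Longrightarrow> k \<notin> I \<Longrightarrow> psum (insert k I) c \<omega> = psum I c \<omega> + c k * \<xi> k \<omega>"
  by (simp add: psum_def)

lemma integrable_psum: "integrable M (psum I c)"
  unfolding psum_def[abs_def] by (intro Bochner_Integration.integrable_sum integrable_mult_right integrable_\<xi>)

lemma expectation_psum: "expectation (psum I c) = 0"
  unfolding psum_def[abs_def] by (subst Bochner_Integration.integral_sum) (auto simp: integrable_\<xi> mean_\<xi>)

lemma psum_second_moment:
  assumes "finite I"
  shows "integrable M (\<lambda>\<omega>. (psum I c \<omega>)\<^sup>2) \<and> expectation (\<lambda>\<omega>. (psum I c \<omega>)\<^sup>2) = (\<Sum>k\<in>I. (c k)\<^sup>2)"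
  using assms
proof (induction I)
  case (insert k I)
  have i: "integrable M (\<lambda>\<omega>. c k * \<xi> k \<omega>)" "expectation (\<lambda>\<omega>. c k * \<xi> k \<omega>) = 0"
    using integrable_\<xi> mean_\<xi> by auto
  note ind = indep_psum[OF insert.hyps(1,2), of c]
  have p: "integrable M (\<lambda>\<omega>. c k * \<xi> k \<omega> * psum I c \<omega>)" "expectation (\<lambda>\<omega>. c k * \<xi> k \<omega> * psum I c \<omega>) = 0"
    using indep_var_integrable[OF ind i(1) integrable_psum] indep_var_lebesgue_integral[OF ind i(1) integrable_psum] i(2)
    by auto
  have pw: "(psum (insert k I) c \<omega>)\<^sup>2 = (psum I c \<omega>)\<^sup>2 + 2 * (c k * \<xi> k \<omega> * psum I c \<omega>) + (c k)\<^sup>2 * (\<xi> k \<omega>)\<^sup>2" for \<omega>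
    using insert.hyps by (simp add: psum_insert power2_sum power_mult_distrib algebra_simps)
  show ?case
    unfolding pw using insert p integrable_\<xi>_square[of k] second_moment_\<xi>[of k] by simp
qed (simp add: psum_def)

lemma psum_window:
  "psum (window m) c \<omega> = (\<Sum>k<m. c (int k) * \<xi> (int k) \<omega>) + (\<Sum>k<m. c (- int (Suc k)) * \<xi> (- int (Suc k)) \<omega>)"
proof -
  have "window m = int ` {..<m} \<union> (\<lambda>k. - int (Suc k)) ` {..<m}"
  proof (intro set_eqI iffI)
    fix x assume x: "x \<in> window m"
    show "x \<in> int ` {..<m} \<union> (\<lambda>k. - int (Suc k)) ` {..<m}"
    proof (cases "x \<ge> 0")
      case True
      then have "x = int (nat x)" "nat x < m" using x by (auto simp: window_def)
      then show ?thesis by blast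
    next
      case False
      then have "x = - int (Suc (nat (- x - 1)))" "nat (- x - 1) < m" using x by (auto simp: window_def)
      then show ?thesis by blast
    qed
  qed (auto simp: window_def)
  moreover have "int ` {..<m} \<inter> (\<lambda>k. - int (Suc k)) ` {..<m} = {}" by auto
  ultimately show ?thesis
    unfolding psum_def
    by (simp add: sum.union_disjoint sum.reindex inj_on_def)
qed

lemma AE_summable:
  assumes c: "l2 c" and f: "inj (f :: nat \<Rightarrow> int)"
  shows "AE \<omega> in M. summable (\<lambda>k. c (f k) * \<xi> (f k) \<omega>)"
proof (rule summable_indep_AE)
  show "indep_vars (\<lambda>_. borel) (\<lambda>k \<omega>. c (f k) * \<xi> (f k) \<omega>) UNIV"
    by (rule indep_vars_reindex_inj[OF indep_scaled[of c UNIV] f]) auto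
  show "integrable M (\<lambda>\<omega>. (c (f k) * \<xi> (f k) \<omega>)\<^sup>2)" for k
    using integrable_\<xi>_square by (simp add: power_mult_distrib)
  show "expectation (\<lambda>\<omega>. c (f k) * \<xi> (f k) \<omega>) = 0" for k using mean_\<xi> by simp
  show "summable (\<lambda>k. expectation (\<lambda>\<omega>. (c (f k) * \<xi> (f k) \<omega>)\<^sup>2))"
    using l2_summable[OF f c] by (simp add: power_mult_distrib second_moment_\<xi>)
qed

lemma AE_summable_both:
  assumes "l2 c"
  shows "AE \<omega> in M. summable (\<lambda>k. c (int k) * \<xi> (int k) \<omega>) \<and>
    summable (\<lambda>k. c (- int (Suc k)) * \<xi> (- int (Suc k)) \<omega>)"
  using AE_summable[OF assms, of int] AE_summable[OF assms, of "\<lambda>k. - int (Suc k)"]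
  by (simp add: inj_def)

lemma AE_psum_tendsto:
  assumes "l2 c"
  shows "AE \<omega> in M. (\<lambda>m. psum (window m) c \<omega>) \<longlonglongrightarrow> series c \<omega>"
  using AE_summable_both[OF assms]
  by eventually_elim (auto simp only: psum_window series_def intro!: tendsto_add summable_LIMSEQ)

text \<open>Linearity is inherited from the windows wherever all the series converge; where one of
  them diverges, \<open>suminf\<close> need not respect it.\<close>

lemma AE_series_sum:
  assumes "finite A" "\<And>i. i \<in> A \<Longrightarrow> l2 (c i)"
  shows "AE \<omega> in M. series (\<lambda>k. \<Sum>i\<in>A. \<theta> i * c i k) \<omega> = (\<Sum>i\<in>A. \<theta> i * series (c i) \<omega>)"
proof -
  have "AE \<omega> in M. \<forall>i\<in>A. (\<lambda>m. psum (window m) (c i) \<omega>) \<longlonglongrightarrow> series (c i) \<omega>"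
    using assms AE_psum_tendsto by (intro AE_finite_allI) auto
  moreover have "AE \<omega> in M. (\<lambda>m. psum (window m) (\<lambda>k. \<Sum>i\<in>A. \<theta> i * c i k) \<omega>) \<longlonglongrightarrow> series (\<lambda>k. \<Sum>i\<in>A. \<theta> i * c i k) \<omega>"
    using assms by (intro AE_psum_tendsto l2_sum l2_scale) auto
  ultimately show ?thesis
  proof eventually_elim
    case (elim \<omega>)
    have "psum (window m) (\<lambda>k. \<Sum>i\<in>A. \<theta> i * c i k) \<omega> = (\<Sum>i\<in>A. \<theta> i * psum (window m) (c i) \<omega>)" for m
      unfolding psum_def sum_distrib_right sum_distrib_left
      by (subst sum.swap) (simp add: mult_ac)
    moreover have "(\<lambda>m. \<Sum>i\<in>A. \<theta> i * psum (window m) (c i) \<omega>) \<longlonglongrightarrow> (\<Sum>i\<in>A. \<theta> i * series (c i) \<omega>)"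
      using elim(1) by (intro tendsto_sum tendsto_mult tendsto_const) auto
    ultimately show ?case using elim(2) LIMSEQ_unique by simp
  qed
qed

text \<open>Fatou's lemma for differences of windows. The case \<open>m = 0\<close>, with empty
  window, bounds the second moment of the whole series.\<close>

lemma series_remainder:
  assumes c: "l2 c"
  shows "integrable M (\<lambda>\<omega>. (series c \<omega> - psum (window m) c \<omega>)\<^sup>2)"
    "expectation (\<lambda>\<omega>. (series c \<omega> - psum (window m) c \<omega>)\<^sup>2) \<le> l2sq c - (\<Sum>k\<in>window m. (c k)\<^sup>2)"
proof -
  define f where "f n \<omega> = (psum (window (m + n) - window m) c \<omega>)\<^sup>2" for n \<omega>
  have f_eq: "f n \<omega> = (psum (window (m + n)) c \<omega> - psum (window m) c \<omega>)\<^sup>2" for n \<omega>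
    unfolding f_def psum_def by (subst sum_diff) (auto simp: window_mono)
  have 1: "integrable M (f n)" for n
    unfolding f_def[abs_def] using psum_second_moment by auto
  have 2: "expectation (f n) \<le> l2sq c - (\<Sum>k\<in>window m. (c k)\<^sup>2)" for n
  proof -
    have "expectation (f n) = (\<Sum>k\<in>window (m + n) - window m. (c k)\<^sup>2)"
      unfolding f_def[abs_def] using psum_second_moment by auto
    also have "\<dots> = (\<Sum>k\<in>window (m + n). (c k)\<^sup>2) - (\<Sum>k\<in>window m. (c k)\<^sup>2)"
      by (rule sum_diff) (auto simp: window_mono)
    also have "\<dots> \<le> l2sq c - (\<Sum>k\<in>window m. (c k)\<^sup>2)" using l2sq_ge_sum[OF c] by simp
    finally show ?thesis .
  qed
  have 3: "AE \<omega> in M. (\<lambda>n. f n \<omega>) \<longlonglongrightarrow> (series c \<omega> - psum (window m) c \<omega>)\<^sup>2"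
    using AE_psum_tendsto[OF c]
  proof eventually_elim
    case (elim \<omega>)
    have "(\<lambda>n. psum (window (n + m)) c \<omega>) \<longlonglongrightarrow> series c \<omega>" by (rule LIMSEQ_ignore_initial_segment[OF elim])
    then show ?case unfolding f_eq by (intro tendsto_intros) (simp add: add.commute)
  qed
  have 4: "0 \<le> f n \<omega>" for n \<omega> by (simp add: f_def)
  show "integrable M (\<lambda>\<omega>. (series c \<omega> - psum (window m) c \<omega>)\<^sup>2)"
    by (rule integrable_limit_bound(1)[OF 1 4 _ 3 always_eventually]) (use 2 in auto)
  show "expectation (\<lambda>\<omega>. (series c \<omega> - psum (window m) c \<omega>)\<^sup>2) \<le> l2sq c - (\<Sum>k\<in>window m. (c k)\<^sup>2)"
    by (rule integrable_limit_bound(2)[OF 1 4 _ 3 always_eventually]) (use 2 in auto)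
qed

lemma integrable_series_square:
  assumes c: "l2 c"
  shows "integrable M (\<lambda>\<omega>. (series c \<omega>)\<^sup>2)"
  using series_remainder(1)[OF c, of 0] by (simp add: window_def psum_def)

lemma integrable_series: "l2 c \<Longrightarrow> integrable M (series c)"
  by (rule square_integrable_imp_integrable[OF _ integrable_series_square]) auto

text \<open>Windows have mean zero, so the mean equals that of the remainder, whose square is at
  most the second moment of the remainder.\<close>

lemma expectation_series:
  assumes c: "l2 c"
  shows "expectation (series c) = 0"
proof -
  have "(expectation (series c))\<^sup>2 \<le> l2sq c - (\<Sum>k\<in>window m. (c k)\<^sup>2)" for m
  proof -
    define R where "R \<omega> = series c \<omega> - psum (window m) c \<omega>" for \<omega>
    have i: "integrable M R" "integrable M (\<lambda>\<omega>. (R \<omega>)\<^sup>2)"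
      using integrable_series[OF c] integrable_psum series_remainder[OF c] by (auto simp: R_def[abs_def])
    have "expectation (series c) = expectation R"
      unfolding R_def using integrable_series[OF c] integrable_psum expectation_psum by simp
    moreover have "(expectation R)\<^sup>2 \<le> expectation (\<lambda>\<omega>. (R \<omega>)\<^sup>2)"
      using variance_eq[OF i] variance_positive[of R] by simp
    ultimately show ?thesis using series_remainder(2)[OF c, of m] by (simp add: R_def)
  qed
  moreover have "(\<lambda>m. l2sq c - (\<Sum>k\<in>window m. (c k)\<^sup>2)) \<longlonglongrightarrow> l2sq c - l2sq c"
    by (intro tendsto_intros l2sq_window c)
  ultimately have "(expectation (series c))\<^sup>2 \<le> l2sq c - l2sq c"
    by (intro LIMSEQ_le_const) auto
  then show ?thesis by simp
qed

text \<open>Fatou's lemma gives one inequality only. For the other, the window is compared with the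
  series by a triangle inequality for squares, at the price of a factor
  \<open>1 + \<eta>\<close>.\<close>

lemma second_moment_series:
  assumes c: "l2 c"
  shows "expectation (\<lambda>\<omega>. (series c \<omega>)\<^sup>2) = l2sq c"
proof (rule antisym)
  show "expectation (\<lambda>\<omega>. (series c \<omega>)\<^sup>2) \<le> l2sq c"
    using series_remainder(2)[OF c, of 0] by (simp add: window_def psum_def)
  define E where "E = expectation (\<lambda>\<omega>. (series c \<omega>)\<^sup>2)"
  have E: "E \<ge> 0" unfolding E_def by simp
  have "l2sq c \<le> (1 + \<eta>) * E" if \<eta>: "\<eta> > 0" for \<eta>
  proof -
    define t where "t m = l2sq c - (\<Sum>k\<in>window m. (c k)\<^sup>2)" for m
    have "(\<Sum>k\<in>window m. (c k)\<^sup>2) \<le> (1 + \<eta>) * E + (1 + 1 / \<eta>) * t m" for m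
    proof -
      have "(psum (window m) c \<omega>)\<^sup>2 \<le> (1 + \<eta>) * (series c \<omega>)\<^sup>2 + (1 + 1 / \<eta>) * (series c \<omega> - psum (window m) c \<omega>)\<^sup>2" for \<omega>
      proof -
        define x where "x = series c \<omega>"
        define y where "y = psum (window m) c \<omega>"
        have "0 \<le> (\<eta> * x + (x - y))\<^sup>2 / \<eta>" using \<eta> by simp
        also have "\<dots> = (1 + \<eta>) * x\<^sup>2 + (1 + 1 / \<eta>) * (x - y)\<^sup>2 - y\<^sup>2"
          using \<eta> by (simp add: field_simps power2_eq_square)
        finally show ?thesis by (simp add: x_def y_def)
      qed
      then have "expectation (\<lambda>\<omega>. (psum (window m) c \<omega>)\<^sup>2) \<le>
          expectation (\<lambda>\<omega>. (1 + \<eta>) * (series c \<omega>)\<^sup>2 + (1 + 1 / \<eta>) * (series c \<omega> - psum (window m) c \<omega>)\<^sup>2)"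
        using psum_second_moment[of "window m" c] series_remainder[OF c] integrable_series_square[OF c]
        by (intro integral_mono) auto
      also have "\<dots> = (1 + \<eta>) * E + (1 + 1 / \<eta>) * expectation (\<lambda>\<omega>. (series c \<omega> - psum (window m) c \<omega>)\<^sup>2)"
        using series_remainder[OF c] integrable_series_square[OF c] by (simp add: E_def)
      also have "\<dots> \<le> (1 + \<eta>) * E + (1 + 1 / \<eta>) * t m"
        unfolding t_def using series_remainder(2)[OF c] \<eta> by (intro add_left_mono mult_left_mono) auto
      finally show ?thesis using psum_second_moment[of "window m" c] by simp
    qed
    moreover have "(\<lambda>m. (1 + \<eta>) * E + (1 + 1 / \<eta>) * t m) \<longlonglongrightarrow> (1 + \<eta>) * E + (1 + 1 / \<eta>) * (l2sq c - l2sq c)"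
      unfolding t_def by (intro tendsto_intros l2sq_window c)
    ultimately have "l2sq c \<le> (1 + \<eta>) * E + (1 + 1 / \<eta>) * (l2sq c - l2sq c)"
      by (intro LIMSEQ_le[OF l2sq_window[OF c]]) auto
    then show ?thesis by simp
  qed
  note le = this
  show "l2sq c \<le> expectation (\<lambda>\<omega>. (series c \<omega>)\<^sup>2)"
    unfolding E_def[symmetric]
  proof (rule field_le_epsilon)
    fix e :: real assume e: "e > 0"
    \<comment> \<open>This choice of \<eta> keeps \<open>\<eta> * E\<close> below \<open>e\<close>,
      also for \<open>E = 0\<close>.\<close>
    have "l2sq c \<le> (1 + e / (E + 1)) * E" using e E by (intro le) auto
    also have "\<dots> = E + e * (E / (E + 1))" by (simp add: algebra_simps)
    also have "\<dots> \<le> E + e * 1" using e E by (intro add_left_mono mult_left_mono) auto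
    finally show "l2sq c \<le> E + e" by simp
  qed
qed

end

section \<open>Moments and characteristic functions of the series\<close>

lemma abs_powr_le_one_add:
  fixes x :: real
  assumes "0 \<le> q" "q \<le> p"
  shows "\<bar>x\<bar> powr q \<le> 1 + \<bar>x\<bar> powr p"
proof (cases "\<bar>x\<bar> \<le> 1")
  case True
  then have "\<bar>x\<bar> powr q \<le> 1 powr q" using assms by (intro powr_mono2) auto
  then show ?thesis by (smt (verit) powr_ge_zero powr_one_eq_one)
next
  case False
  then have "\<bar>x\<bar> powr q \<le> \<bar>x\<bar> powr p" using assms by (intro powr_mono) auto
  then show ?thesis by simp
qed

lemma abs_powr_div_le:
  fixes x :: real
  assumes "p \<ge> 2"
  shows "\<bar>\<bar>x\<bar> powr p / x\<bar> \<le> 1 + \<bar>x\<bar> powr p" "\<bar>\<bar>x\<bar> powr p / x\<^sup>2\<bar> \<le> 1 + \<bar>x\<bar> powr p"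
proof -
  show "\<bar>\<bar>x\<bar> powr p / x\<bar> \<le> 1 + \<bar>x\<bar> powr p"
  proof (cases "x = 0")
    case False
    then have "\<bar>\<bar>x\<bar> powr p / x\<bar> = \<bar>x\<bar> powr (p - 1)" by (simp add: powr_diff abs_divide)
    then show ?thesis using abs_powr_le_one_add[of "p - 1" p x] assms by simp
  qed simp
  show "\<bar>\<bar>x\<bar> powr p / x\<^sup>2\<bar> \<le> 1 + \<bar>x\<bar> powr p"
  proof (cases "x = 0")
    case False
    then have "\<bar>\<bar>x\<bar> powr p / x\<^sup>2\<bar> = \<bar>x\<bar> powr (p - 2)" by (simp add: powr_diff abs_divide)
    then show ?thesis using abs_powr_le_one_add[of "p - 2" p x] assms by simp
  qed simp
qed

context std_iid
begin

lemma expectation_\<xi>_cong: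
  fixes f :: "real \<Rightarrow> real"
  assumes [measurable]: "f \<in> borel_measurable borel"
  shows "integrable M (\<lambda>\<omega>. f (\<xi> k \<omega>)) \<longleftrightarrow> integrable M (\<lambda>\<omega>. f (\<xi> j \<omega>))"
    "expectation (\<lambda>\<omega>. f (\<xi> k \<omega>)) = expectation (\<lambda>\<omega>. f (\<xi> j \<omega>))"
proof -
  have "integrable (distr M borel (\<xi> k)) f \<longleftrightarrow> integrable (distr M borel (\<xi> j)) f"
    using same_distr[of k j] by simp
  then show "integrable M (\<lambda>\<omega>. f (\<xi> k \<omega>)) \<longleftrightarrow> integrable M (\<lambda>\<omega>. f (\<xi> j \<omega>))"
    by (simp add: integrable_distr_eq)
  have "integral\<^sup>L (distr M borel (\<xi> k)) f = integral\<^sup>L (distr M borel (\<xi> j)) f"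
    using same_distr[of k j] by simp
  then show "expectation (\<lambda>\<omega>. f (\<xi> k \<omega>)) = expectation (\<lambda>\<omega>. f (\<xi> j \<omega>))"
    by (simp add: integral_distr)
qed

text \<open>Induction on the index set adds an independent centred \<open>Y\<close> to the sum
  \<open>P\<close>. The linear term of the expansion vanishes, the quadratic one is
  \<open>(c k)\<^sup>2\<close> times a moment of \<open>P\<close> of order \<open>p - 2\<close>, and
  convexity of the power \<open>r = p / 2\<close> makes the constant reproduce itself.\<close>

theorem psum_moment_bound:
  assumes p: "p \<ge> 2" and m: "integrable M (\<lambda>\<omega>. \<bar>\<xi> j \<omega>\<bar> powr p)"
  obtains K where "K > 0" "\<And>I c. finite I \<Longrightarrow> integrable M (\<lambda>\<omega>. \<bar>psum I c \<omega>\<bar> powr p) \<and>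
    expectation (\<lambda>\<omega>. \<bar>psum I c \<omega>\<bar> powr p) \<le> K * (\<Sum>k\<in>I. (c k)\<^sup>2) powr (p / 2)"
proof -
  define r where "r = p / 2"
  have r: "r \<ge> 1" using p by (simp add: r_def)
  define m where "m = expectation (\<lambda>\<omega>. \<bar>\<xi> j \<omega>\<bar> powr p)"
  have mk: "integrable M (\<lambda>\<omega>. \<bar>\<xi> k \<omega>\<bar> powr p)" "expectation (\<lambda>\<omega>. \<bar>\<xi> k \<omega>\<bar> powr p) = m" for k
    using assms(2) expectation_\<xi>_cong[of "\<lambda>x. \<bar>x\<bar> powr p" k j] by (auto simp: m_def)
  have m0: "m \<ge> 0" by (simp add: m_def)
  obtain C where C: "C > 0"
    "\<And>x y. \<bar>x + y\<bar> powr p \<le> \<bar>x\<bar> powr p + p * (\<bar>x\<bar> powr p / x) * y + C * (\<bar>x\<bar> powr p / x\<^sup>2 * y\<^sup>2 + \<bar>y\<bar> powr p)"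
    using abs_powr_expand[OF p] by blast
  \<comment> \<open>Chosen so that the part of the quadratic term that contains \<open>K\<close>
    again comes with the factor \<open>r / 4\<close> only, which \<open>K / 2 * r\<close> can
    absorb.\<close>
  define \<eta> where "\<eta> = r / (4 * C)"
  have \<eta>: "\<eta> > 0" "C * \<eta> = r / 4" using r C by (auto simp: \<eta>_def)
  \<comment> \<open>The first summand bounds the part of the quadratic term free of
    \<open>K\<close>, the second the moment of \<open>Y\<close> by \<open>K / 2\<close>, and the
    third makes \<open>K\<close> positive.\<close>
  define K where "K = 4 * (C * (1 / \<eta>) powr (r - 1)) / r + 2 * C * m + 1"
  have Kp: "0 \<le> 4 * (C * (1 / \<eta>) powr (r - 1)) / r" "0 \<le> 2 * C * m" using r C m0 by auto
  have "2 * C * m \<le> K" "K > 0" using Kp m0 unfolding K_def by linarith+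
  then have K: "K > 0" "C * m \<le> K / 2" by simp_all
  have "4 * (C * (1 / \<eta>) powr (r - 1)) / r \<le> K" using Kp m0 unfolding K_def by linarith
  then have K2: "C * (1 / \<eta>) powr (r - 1) \<le> K * r / 4" using r by (simp add: field_simps)
  have main: "integrable M (\<lambda>\<omega>. \<bar>psum I c \<omega>\<bar> powr p) \<and>
    expectation (\<lambda>\<omega>. \<bar>psum I c \<omega>\<bar> powr p) \<le> K * (\<Sum>k\<in>I. (c k)\<^sup>2) powr r" if "finite I" for I c
    using that
  proof (induction I)
    case (insert k I)
    define P where "P = psum I c"
    define Y where "Y \<omega> = c k * \<xi> k \<omega>" for \<omega>
    define \<sigma> where "\<sigma> = (\<Sum>k\<in>I. (c k)\<^sup>2)"
    have \<sigma>: "\<sigma> \<ge> 0" by (simp add: \<sigma>_def sum_nonneg)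
    have [measurable]: "P \<in> borel_measurable M" "Y \<in> borel_measurable M"
      by (simp_all add: P_def Y_def[abs_def])
    have IH: "integrable M (\<lambda>\<omega>. \<bar>P \<omega>\<bar> powr p)" "expectation (\<lambda>\<omega>. \<bar>P \<omega>\<bar> powr p) \<le> K * \<sigma> powr r"
      using insert.IH by (auto simp: P_def \<sigma>_def)
    have ind: "indep_var borel Y borel P"
      unfolding P_def Y_def[abs_def] by (rule indep_psum[OF insert.hyps(1,2)])
    have Y: "integrable M Y" "expectation Y = 0" "integrable M (\<lambda>\<omega>. (Y \<omega>)\<^sup>2)" "expectation (\<lambda>\<omega>. (Y \<omega>)\<^sup>2) = (c k)\<^sup>2"
      using integrable_\<xi> mean_\<xi> integrable_\<xi>_square second_moment_\<xi> by (auto simp: Y_def[abs_def] power_mult_distrib)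
    have ck: "\<bar>c k\<bar> powr p = ((c k)\<^sup>2) powr r"
    proof (cases "c k = 0")
      case False
      have "((c k)\<^sup>2) powr r = (\<bar>c k\<bar> powr 2) powr r" using False by simp
      also have "\<dots> = \<bar>c k\<bar> powr p" by (simp only: powr_powr r_def) simp
      finally show ?thesis by simp
    qed simp
    have Yp: "integrable M (\<lambda>\<omega>. \<bar>Y \<omega>\<bar> powr p)" "expectation (\<lambda>\<omega>. \<bar>Y \<omega>\<bar> powr p) = ((c k)\<^sup>2) powr r * m"
      using mk[of k] ck by (auto simp: Y_def[abs_def] abs_mult powr_mult)
    have i1: "integrable M (\<lambda>\<omega>. \<bar>P \<omega>\<bar> powr p / P \<omega>)" and i2: "integrable M (\<lambda>\<omega>. \<bar>P \<omega>\<bar> powr p / (P \<omega>)\<^sup>2)"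
      using abs_powr_div_le[OF p]
      by (auto intro!: Bochner_Integration.integrable_bound[OF Bochner_Integration.integrable_add[OF integrable_const IH(1), of 1]])
    have ind1: "indep_var borel Y borel (\<lambda>\<omega>. \<bar>P \<omega>\<bar> powr p / P \<omega>)"
      using indep_var_compose[OF ind, of "\<lambda>x. x" borel "\<lambda>x. \<bar>x\<bar> powr p / x" borel] by (simp add: comp_def)
    have ind2: "indep_var borel (\<lambda>\<omega>. (Y \<omega>)\<^sup>2) borel (\<lambda>\<omega>. \<bar>P \<omega>\<bar> powr p / (P \<omega>)\<^sup>2)"
      using indep_var_compose[OF ind, of "\<lambda>x. x\<^sup>2" borel "\<lambda>x. \<bar>x\<bar> powr p / x\<^sup>2" borel] by (simp add: comp_def)
    have p1: "integrable M (\<lambda>\<omega>. Y \<omega> * (\<bar>P \<omega>\<bar> powr p / P \<omega>))" "expectation (\<lambda>\<omega>. Y \<omega> * (\<bar>P \<omega>\<bar> powr p / P \<omega>)) = 0"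
      using indep_var_integrable[OF ind1 Y(1) i1] indep_var_lebesgue_integral[OF ind1 Y(1) i1] Y(2) by auto
    have p2: "integrable M (\<lambda>\<omega>. (Y \<omega>)\<^sup>2 * (\<bar>P \<omega>\<bar> powr p / (P \<omega>)\<^sup>2))"
      "expectation (\<lambda>\<omega>. (Y \<omega>)\<^sup>2 * (\<bar>P \<omega>\<bar> powr p / (P \<omega>)\<^sup>2)) = (c k)\<^sup>2 * expectation (\<lambda>\<omega>. \<bar>P \<omega>\<bar> powr p / (P \<omega>)\<^sup>2)"
      using indep_var_integrable[OF ind2 Y(3) i2] indep_var_lebesgue_integral[OF ind2 Y(3) i2] Y(4) by auto
    define A where "A \<omega> = Y \<omega> * (\<bar>P \<omega>\<bar> powr p / P \<omega>)" for \<omega>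
    define B where "B \<omega> = (Y \<omega>)\<^sup>2 * (\<bar>P \<omega>\<bar> powr p / (P \<omega>)\<^sup>2)" for \<omega>
    note p1 = p1[folded A_def] and p2 = p2[folded B_def]
    define U where "U \<omega> = \<bar>P \<omega>\<bar> powr p + p * A \<omega> + C * (B \<omega> + \<bar>Y \<omega>\<bar> powr p)" for \<omega>
    have U: "integrable M U" "expectation U = expectation (\<lambda>\<omega>. \<bar>P \<omega>\<bar> powr p) +
        C * ((c k)\<^sup>2 * expectation (\<lambda>\<omega>. \<bar>P \<omega>\<bar> powr p / (P \<omega>)\<^sup>2) + ((c k)\<^sup>2) powr r * m)"
      unfolding U_def[abs_def] using IH p1 p2 Yp by auto
    have PU: "\<bar>P \<omega> + Y \<omega>\<bar> powr p \<le> U \<omega>" for \<omega>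
      using C(2)[of "P \<omega>" "Y \<omega>"] by (simp add: U_def A_def B_def mult_ac)
    have int: "integrable M (\<lambda>\<omega>. \<bar>P \<omega> + Y \<omega>\<bar> powr p)"
      by (rule Bochner_Integration.integrable_bound[OF U(1)]) (use order_trans[OF PU abs_ge_self] in auto)
    have "expectation (\<lambda>\<omega>. \<bar>P \<omega> + Y \<omega>\<bar> powr p) \<le> expectation U"
      by (intro integral_mono int U PU)
    also have "\<dots> \<le> K * (\<sigma> + (c k)\<^sup>2) powr r"
    \<comment> \<open>Splitting at a level proportional to \<sigma> needs
      \<open>\<sigma> > 0\<close>; otherwise \<open>P\<close> vanishes identically and only the
      moment of \<open>Y\<close> remains.\<close>
    proof (cases "\<sigma> = 0")
      case True
      then have "c i = 0" if "i \<in> I" for i using that insert.hyps by (simp add: \<sigma>_def sum_nonneg_eq_0_iff)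
      then have P0: "P \<omega> = 0" for \<omega> by (simp add: P_def psum_def)
      have "expectation U = C * m * ((c k)\<^sup>2) powr r" unfolding U(2) P0 using p by simp
      also have "\<dots> \<le> K * ((c k)\<^sup>2) powr r" using K by (intro mult_right_mono) auto
      finally show ?thesis using True by simp
    next
      case False
      then have s: "\<sigma> > 0" using \<sigma> by simp
      have "expectation (\<lambda>\<omega>. \<bar>P \<omega>\<bar> powr p / (P \<omega>)\<^sup>2) \<le> expectation (\<lambda>\<omega>. \<eta> * \<bar>P \<omega>\<bar> powr p / \<sigma> + (\<sigma> / \<eta>) powr (p / 2 - 1))"
        using IH by (intro integral_mono i2 powr_div_square_le p \<eta> s) auto
      also have "\<dots> = \<eta> / \<sigma> * expectation (\<lambda>\<omega>. \<bar>P \<omega>\<bar> powr p) + (\<sigma> / \<eta>) powr (r - 1)"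
        using IH by (simp add: r_def prob_space)
      also have "\<dots> \<le> \<eta> / \<sigma> * (K * \<sigma> powr r) + (\<sigma> / \<eta>) powr (r - 1)"
        using IH \<eta> s by (intro add_right_mono mult_left_mono) auto
      also have "\<dots> = (\<eta> * K + (1 / \<eta>) powr (r - 1)) * \<sigma> powr (r - 1)"
        using s \<eta> by (simp add: powr_diff powr_divide field_simps)
      finally have 1: "expectation (\<lambda>\<omega>. \<bar>P \<omega>\<bar> powr p / (P \<omega>)\<^sup>2) \<le> (\<eta> * K + (1 / \<eta>) powr (r - 1)) * \<sigma> powr (r - 1)" .
      have "C * (\<eta> * K + (1 / \<eta>) powr (r - 1)) = r / 4 * K + C * (1 / \<eta>) powr (r - 1)"
        using \<eta>(2) by (metis distrib_left mult.assoc)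
      also have "\<dots> \<le> K / 2 * r" using K2 by simp
      finally have 2: "C * (\<eta> * K + (1 / \<eta>) powr (r - 1)) \<le> K / 2 * r" .
      have "expectation U \<le> K * \<sigma> powr r + C * ((c k)\<^sup>2 * ((\<eta> * K + (1 / \<eta>) powr (r - 1)) * \<sigma> powr (r - 1)) + ((c k)\<^sup>2) powr r * m)"
        unfolding U(2) using IH C 1 by (intro add_mono mult_left_mono order_refl) auto
      also have "\<dots> = K * \<sigma> powr r + (C * (\<eta> * K + (1 / \<eta>) powr (r - 1))) * ((c k)\<^sup>2 * \<sigma> powr (r - 1)) + C * m * ((c k)\<^sup>2) powr r"
        by (simp add: algebra_simps)
      also have "\<dots> \<le> K * \<sigma> powr r + (K / 2 * r) * ((c k)\<^sup>2 * \<sigma> powr (r - 1)) + K / 2 * ((c k)\<^sup>2) powr r"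
        using 2 K by (intro add_mono mult_right_mono order_refl) auto
      \<comment> \<open>One half of \<open>K * \<sigma> powr r\<close> joins the quadratic term to
        form a tangent, the other half joins the moment of \<open>Y\<close> by
        superadditivity.\<close>
      also have "\<dots> = K / 2 * (\<sigma> powr r + r * \<sigma> powr (r - 1) * (c k)\<^sup>2) + K / 2 * (\<sigma> powr r + ((c k)\<^sup>2) powr r)"
        by (simp add: algebra_simps)
      also have "\<dots> \<le> K / 2 * (\<sigma> + (c k)\<^sup>2) powr r + K / 2 * (\<sigma> + (c k)\<^sup>2) powr r"
        using K r s by (intro add_mono mult_left_mono powr_add_ge_tangent powr_superadditive) auto
      finally show ?thesis by simp
    qed
    finally have "expectation (\<lambda>\<omega>. \<bar>P \<omega> + Y \<omega>\<bar> powr p) \<le> K * (\<sigma> + (c k)\<^sup>2) powr r" .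
    then show ?case
      using int insert.hyps by (simp add: psum_insert P_def Y_def \<sigma>_def add.commute)
  qed (simp add: psum_def)
  show thesis
    by (rule that[OF K(1)]) (use main in \<open>simp add: r_def\<close>)
qed

theorem series_moment_bound:
  assumes p: "p \<ge> 2" and m: "integrable M (\<lambda>\<omega>. \<bar>\<xi> j \<omega>\<bar> powr p)"
  obtains K where "K > 0" "\<And>c. l2 c \<Longrightarrow> integrable M (\<lambda>\<omega>. \<bar>series c \<omega>\<bar> powr p)"
    "\<And>c. l2 c \<Longrightarrow> expectation (\<lambda>\<omega>. \<bar>series c \<omega>\<bar> powr p) \<le> K * (l2sq c) powr (p / 2)"
proof -
  obtain K where K: "K > 0" "\<And>I c. finite I \<Longrightarrow> integrable M (\<lambda>\<omega>. \<bar>psum I c \<omega>\<bar> powr p) \<and>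
    expectation (\<lambda>\<omega>. \<bar>psum I c \<omega>\<bar> powr p) \<le> K * (\<Sum>k\<in>I. (c k)\<^sup>2) powr (p / 2)"
    using psum_moment_bound[OF p m] by blast
  have lim: "AE \<omega> in M. (\<lambda>n. \<bar>psum (window n) c \<omega>\<bar> powr p) \<longlonglongrightarrow> \<bar>series c \<omega>\<bar> powr p" if "l2 c" for c
    using AE_psum_tendsto[OF that]
    by eventually_elim (use p in \<open>auto intro!: tendsto_powr' tendsto_rabs\<close>)
  have le: "expectation (\<lambda>\<omega>. \<bar>psum (window n) c \<omega>\<bar> powr p) \<le> K * (l2sq c) powr (p / 2)" if "l2 c" for c n
  proof -
    have "expectation (\<lambda>\<omega>. \<bar>psum (window n) c \<omega>\<bar> powr p) \<le> K * (\<Sum>k\<in>window n. (c k)\<^sup>2) powr (p / 2)"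
      using K(2) by auto
    also have "\<dots> \<le> K * (l2sq c) powr (p / 2)"
      using K(1) p l2sq_ge_sum[OF that] by (intro mult_left_mono powr_mono2) (auto intro: sum_nonneg)
    finally show ?thesis .
  qed
  show thesis
  proof (rule that[OF K(1)])
    fix c assume c: "l2 c"
    show "integrable M (\<lambda>\<omega>. \<bar>series c \<omega>\<bar> powr p)"
      by (rule integrable_limit_bound(1)[OF _ _ _ lim[OF c] always_eventually]) (use K(2) le[OF c] in auto)
    show "expectation (\<lambda>\<omega>. \<bar>series c \<omega>\<bar> powr p) \<le> K * (l2sq c) powr (p / 2)"
      by (rule integrable_limit_bound(2)[OF _ _ _ lim[OF c] always_eventually]) (use K(2) le[OF c] in auto)
  qed
qed

text \<open>With two moments only, the Taylor remainder is \<open>s\<^sup>2\<close> times the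
  expectation of a minimum of a square and a cube; the latter tends to 0 by dominated
  convergence.\<close>

lemma char_\<xi>_approx:
  assumes e: "e > 0"
  obtains d where "d > 0" "\<And>s. \<bar>s\<bar> \<le> d \<Longrightarrow>
    norm (char (distr M borel (\<xi> k)) s - of_real (exp (- (s\<^sup>2 / 2)))) \<le> e * s\<^sup>2"
proof -
  define g where "g s = expectation (\<lambda>\<omega>. min (6 * (\<xi> k \<omega>)\<^sup>2) (\<bar>s\<bar> * \<bar>\<xi> k \<omega>\<bar> ^ 3))" for s
  have gi: "integrable M (\<lambda>\<omega>. min (6 * (\<xi> k \<omega>)\<^sup>2) (\<bar>s\<bar> * \<bar>\<xi> k \<omega>\<bar> ^ 3))" for s
    by (rule Bochner_Integration.integrable_bound[of _ "\<lambda>\<omega>. 6 * (\<xi> k \<omega>)\<^sup>2"]) (use integrable_\<xi>_square in auto)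
  have "(\<lambda>n. g (1 / real (Suc n))) \<longlonglongrightarrow> expectation (\<lambda>_. 0)"
    unfolding g_def
  proof (rule integral_dominated_convergence[where w = "\<lambda>\<omega>. 6 * (\<xi> k \<omega>)\<^sup>2"])
    show "AE \<omega> in M. (\<lambda>n. min (6 * (\<xi> k \<omega>)\<^sup>2) (\<bar>1 / real (Suc n)\<bar> * \<bar>\<xi> k \<omega>\<bar> ^ 3)) \<longlonglongrightarrow> 0"
    proof (intro AE_I2)
      fix \<omega>
      have "(\<lambda>n. \<bar>1 / real (Suc n)\<bar> * \<bar>\<xi> k \<omega>\<bar> ^ 3) \<longlonglongrightarrow> \<bar>0\<bar> * \<bar>\<xi> k \<omega>\<bar> ^ 3"
        by (intro tendsto_intros LIMSEQ_Suc[OF lim_1_over_n])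
      from tendsto_min[OF tendsto_const this, of "6 * (\<xi> k \<omega>)\<^sup>2"]
      show "(\<lambda>n. min (6 * (\<xi> k \<omega>)\<^sup>2) (\<bar>1 / real (Suc n)\<bar> * \<bar>\<xi> k \<omega>\<bar> ^ 3)) \<longlonglongrightarrow> 0" by simp
    qed
  qed (use integrable_\<xi>_square in auto)
  then have "\<forall>\<^sub>F n in sequentially. g (1 / real (Suc n)) < e"
    by (intro order_tendstoD) (use e in auto)
  then obtain n where n: "g (1 / real (Suc n)) < e" by (auto simp: eventually_sequentially)
  \<comment> \<open>The first bound makes \<open>g s\<close> at most \<open>e\<close>, as
    \<open>g\<close> increases with \<open>\<bar>s\<bar>\<close>; the other two turn the quartic
    difference between \<open>1 - s\<^sup>2 / 2\<close> and the Gaussian factor into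
    \<open>e * s\<^sup>2 / 4\<close>.\<close>
  define d where "d = min (1 / real (Suc n)) (min 1 e)"
  show thesis
  proof (rule that[of d])
    show "d > 0" using e by (simp add: d_def)
    fix s :: real assume s: "\<bar>s\<bar> \<le> d"
    then have s': "\<bar>s\<bar> \<le> 1 / real (Suc n)" "\<bar>s\<bar> \<le> 1" "\<bar>s\<bar> \<le> e" by (auto simp: d_def)
    have "g s \<le> g (1 / real (Suc n))"
      unfolding g_def using s' by (intro integral_mono gi min.mono mult_right_mono) auto
    then have gs: "g s \<le> e" using n by simp
    have 1: "norm (char (distr M borel (\<xi> k)) s - of_real (1 - s\<^sup>2 / 2)) \<le> s\<^sup>2 / 6 * g s"
      using char_approx3'[OF \<xi>_measurable integrable_\<xi> integrable_\<xi>_square mean_\<xi> var_\<xi> refl, of k s] by (simp add: g_def)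
    define x where "x = s\<^sup>2 / 2"
    have s1: "s\<^sup>2 \<le> 1" using s' by (simp add: abs_square_le_1)
    have x: "0 \<le> x" by (simp add: x_def)
    have "exp (- x) \<le> 1 / (1 + x)"
      using exp_ge_add_one_self[of x] x by (simp add: exp_minus field_simps)
    also have "\<dots> \<le> 1 - x + x\<^sup>2"
      using x by (simp add: field_simps power2_eq_square)
    finally have 2: "\<bar>(1 - x) - exp (- x)\<bar> \<le> x\<^sup>2"
      using exp_ge_add_one_self[of "- x"] by (simp add: abs_le_iff)
    have "x\<^sup>2 = s\<^sup>2 * (s\<^sup>2 / 4)" by (simp add: x_def power2_eq_square)
    also have "s\<^sup>2 = \<bar>s\<bar> * \<bar>s\<bar>" by (simp add: power2_eq_square)
    also have "\<bar>s\<bar> * \<bar>s\<bar> * (\<bar>s\<bar> * \<bar>s\<bar> / 4) \<le> \<bar>s\<bar> * \<bar>s\<bar> * (e * 1 / 4)"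
      using s' by (intro mult_left_mono divide_right_mono mult_mono) auto
    finally have 3: "x\<^sup>2 \<le> s\<^sup>2 * e / 4" by (simp add: power2_eq_square)
    have "norm (of_real (1 - x) - of_real (exp (- x)) :: complex) = \<bar>(1 - x) - exp (- x)\<bar>"
      unfolding of_real_diff[symmetric] norm_of_real ..
    then have "norm (char (distr M borel (\<xi> k)) s - of_real (exp (- x))) \<le> s\<^sup>2 / 6 * g s + x\<^sup>2"
      using 1 2 unfolding x_def[symmetric] by (intro norm_diff_triangle_le) auto
    also have "\<dots> \<le> s\<^sup>2 / 6 * e + s\<^sup>2 * e / 4"
      using gs 3 by (intro add_mono mult_left_mono) auto
    also have "\<dots> \<le> e * s\<^sup>2" using e by (simp add: algebra_simps)
    finally show "norm (char (distr M borel (\<xi> k)) s - of_real (exp (- (s\<^sup>2 / 2)))) \<le> e * s\<^sup>2"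
      by (simp add: x_def)
  qed
qed

text \<open>A quantitative central limit theorem for series. Factors of modulus at most 1 can be
  exchanged for Gaussian ones at the cost of the sum of the individual errors, and that sum is
  \<open>e\<close> times the sum of squared coefficients. Windows pass this to the limit.\<close>

theorem char_series_approx:
  assumes e: "e > 0"
  obtains d where "d > 0" "\<And>c. l2 c \<Longrightarrow> (\<And>k. \<bar>c k\<bar> \<le> d) \<Longrightarrow>
    norm (expectation (\<lambda>\<omega>. iexp (series c \<omega>)) - of_real (exp (- (l2sq c / 2)))) \<le> e * l2sq c"
proof -
  obtain d where d: "d > 0" "\<And>s. \<bar>s\<bar> \<le> d \<Longrightarrow>
    norm (char (distr M borel (\<xi> 0)) s - of_real (exp (- (s\<^sup>2 / 2)))) \<le> e * s\<^sup>2"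
    using char_\<xi>_approx[OF e, of 0] by blast
  show thesis
  proof (rule that[OF d(1)])
    fix c assume c: "l2 c" and cd: "\<And>k. \<bar>c k\<bar> \<le> d"
    interpret D: real_distribution "distr M borel (\<xi> 0)" by (rule real_distribution_distr) simp
    have fin: "norm (expectation (\<lambda>\<omega>. iexp (psum I c \<omega>)) - of_real (exp (- ((\<Sum>k\<in>I. (c k)\<^sup>2) / 2)))) \<le> e * (\<Sum>k\<in>I. (c k)\<^sup>2)"
      if "finite I" for I
    proof -
      have "expectation (\<lambda>\<omega>. iexp (psum I c \<omega>)) = char (distr M borel (psum I c)) 1"
        by (simp add: char_def integral_distr)
      also have "\<dots> = (\<Prod>k\<in>I. char (distr M borel (\<lambda>\<omega>. c k * \<xi> k \<omega>)) 1)"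
        unfolding psum_def[abs_def] by (rule char_distr_sum[OF indep_scaled])
      also have "\<dots> = (\<Prod>k\<in>I. char (distr M borel (\<xi> 0)) (c k))"
      proof (rule prod.cong[OF refl])
        fix k
        have "char (distr M borel (\<lambda>\<omega>. c k * \<xi> k \<omega>)) 1 = char (distr M borel (\<xi> k)) (c k)"
          by (simp add: char_def integral_distr)
        then show "char (distr M borel (\<lambda>\<omega>. c k * \<xi> k \<omega>)) 1 = char (distr M borel (\<xi> 0)) (c k)"
          using same_distr[of k 0] by simp
      qed
      finally have eq: "expectation (\<lambda>\<omega>. iexp (psum I c \<omega>)) = (\<Prod>k\<in>I. char (distr M borel (\<xi> 0)) (c k))" .
      have "exp (- ((\<Sum>k\<in>I. (c k)\<^sup>2) / 2)) = (\<Prod>k\<in>I. exp (- ((c k)\<^sup>2 / 2)))"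
        using that by (simp add: exp_sum[symmetric] sum_negf sum_divide_distrib)
      then have eq2: "complex_of_real (exp (- ((\<Sum>k\<in>I. (c k)\<^sup>2) / 2))) = (\<Prod>k\<in>I. of_real (exp (- ((c k)\<^sup>2 / 2))))"
        by simp
      have "norm ((\<Prod>k\<in>I. char (distr M borel (\<xi> 0)) (c k)) - (\<Prod>k\<in>I. of_real (exp (- ((c k)\<^sup>2 / 2)))))
          \<le> (\<Sum>k\<in>I. norm (char (distr M borel (\<xi> 0)) (c k) - of_real (exp (- ((c k)\<^sup>2 / 2)))))"
        by (rule norm_prod_diff) (auto simp: D.cmod_char_le_1)
      also have "\<dots> \<le> (\<Sum>k\<in>I. e * (c k)\<^sup>2)" by (intro sum_mono d cd)
      finally show ?thesis unfolding eq eq2 by (simp add: sum_distrib_left)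
    qed
    have 1: "(\<lambda>m. expectation (\<lambda>\<omega>. iexp (psum (window m) c \<omega>))) \<longlonglongrightarrow> expectation (\<lambda>\<omega>. iexp (series c \<omega>))"
    proof (rule integral_dominated_convergence[where w = "\<lambda>_. 1"])
      show "AE \<omega> in M. (\<lambda>m. iexp (psum (window m) c \<omega>)) \<longlonglongrightarrow> iexp (series c \<omega>)"
        using AE_psum_tendsto[OF c] by eventually_elim (intro tendsto_intros)
    qed auto
    show "norm (expectation (\<lambda>\<omega>. iexp (series c \<omega>)) - of_real (exp (- (l2sq c / 2)))) \<le> e * l2sq c"
    proof (rule LIMSEQ_le)
      show "(\<lambda>m. norm (expectation (\<lambda>\<omega>. iexp (psum (window m) c \<omega>)) - of_real (exp (- ((\<Sum>k\<in>window m. (c k)\<^sup>2) / 2)))))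
        \<longlonglongrightarrow> norm (expectation (\<lambda>\<omega>. iexp (series c \<omega>)) - of_real (exp (- (l2sq c / 2))))"
        by (intro tendsto_intros 1 l2sq_window c) auto
      show "(\<lambda>m. e * (\<Sum>k\<in>window m. (c k)\<^sup>2)) \<longlonglongrightarrow> e * l2sq c"
        by (intro tendsto_intros l2sq_window c)
    qed (use fin in auto)
  qed
qed

end

section \<open>Partial sums of the linear process\<close>

definition l2norm :: "(int \<Rightarrow> real) \<Rightarrow> real" where
  "l2norm c = sqrt (l2sq c)"

lemma l2norm_nonneg: "0 \<le> l2norm c"
  by (simp add: l2norm_def l2sq_nonneg)

lemma l2norm_power2: "(l2norm c)\<^sup>2 = l2sq c"
  by (simp add: l2norm_def l2sq_nonneg)

lemma l2norm_triangle:
  assumes "l2 c" "l2 d"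
  shows "l2norm (\<lambda>k. c k + d k) \<le> l2norm c + l2norm d"
  unfolding l2norm_def
proof (rule LIMSEQ_le)
  show "(\<lambda>m. sqrt (\<Sum>k\<in>window m. (c k + d k)\<^sup>2)) \<longlonglongrightarrow> sqrt (l2sq (\<lambda>k. c k + d k))"
    by (intro tendsto_intros l2sq_window l2_add assms)
  show "(\<lambda>m. sqrt (\<Sum>k\<in>window m. (c k)\<^sup>2) + sqrt (\<Sum>k\<in>window m. (d k)\<^sup>2)) \<longlonglongrightarrow> sqrt (l2sq c) + sqrt (l2sq d)"
    by (intro tendsto_intros l2sq_window assms)
  show "\<exists>N. \<forall>n\<ge>N. sqrt (\<Sum>k\<in>window n. (c k + d k)\<^sup>2) \<le> sqrt (\<Sum>k\<in>window n. (c k)\<^sup>2) + sqrt (\<Sum>k\<in>window n. (d k)\<^sup>2)"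
    using L2_set_triangle_ineq[of c d] by (auto simp: L2_set_def)
qed

lemma l2sq_translate: "l2sq (\<lambda>k. c (k + i)) = l2sq c"
  unfolding l2sq_def
  by (rule infsum_reindex_bij_betw[of "\<lambda>k. k + i" UNIV UNIV "\<lambda>k. (c k)\<^sup>2"])
    (rule bij_betw_byWitness[where f' = "\<lambda>k. k - i"], auto)

lemma l2_translate: "l2 c \<Longrightarrow> l2 (\<lambda>k. c (k + i))"
  unfolding l2_def[of "\<lambda>k. c (k + i)"] by (rule l2_reindex) (auto intro: injI)

lemma l2sq_scale: "l2sq (\<lambda>k. r * c k) = r\<^sup>2 * l2sq c"
  unfolding l2sq_def power_mult_distrib by (rule infsum_cmult_right')

lemma l2_diff: "l2 c \<Longrightarrow> l2 d \<Longrightarrow> l2 (\<lambda>k. c k - d k)"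
  using l2_add[of c "\<lambda>k. - 1 * d k"] l2_scale[of d "-1"] by simp

text \<open>Polarization, \<open>2 * x * y = x\<^sup>2 + y\<^sup>2 - (x - y)\<^sup>2\<close>: only
  norms of differences occur, and for partial sums these are values of \<open>s\<close>.\<close>

lemma l2sq_linear_combination:
  assumes A: "finite A" and c: "\<And>i. i \<in> A \<Longrightarrow> l2 (c i)"
  shows "l2sq (\<lambda>k. \<Sum>i\<in>A. \<theta> i * c i k) =
    (\<Sum>i\<in>A. \<Sum>j\<in>A. \<theta> i * \<theta> j * ((l2sq (c i) + l2sq (c j) - l2sq (\<lambda>k. c i k - c j k)) / 2))"
proof (rule LIMSEQ_unique)
  show "(\<lambda>m. \<Sum>k\<in>window m. (\<Sum>i\<in>A. \<theta> i * c i k)\<^sup>2) \<longlonglongrightarrow> l2sq (\<lambda>k. \<Sum>i\<in>A. \<theta> i * c i k)"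
    by (intro l2sq_window l2_sum l2_scale c)
  have "(\<Sum>k\<in>W. (\<Sum>i\<in>A. \<theta> i * c i k)\<^sup>2) = (\<Sum>i\<in>A. \<Sum>j\<in>A. \<theta> i * \<theta> j *
      (((\<Sum>k\<in>W. (c i k)\<^sup>2) + (\<Sum>k\<in>W. (c j k)\<^sup>2) - (\<Sum>k\<in>W. (c i k - c j k)\<^sup>2)) / 2))" for W
  proof -
    have "(\<Sum>k\<in>W. (\<Sum>i\<in>A. \<theta> i * c i k)\<^sup>2) = (\<Sum>k\<in>W. \<Sum>i\<in>A. \<Sum>j\<in>A. \<theta> i * \<theta> j * (c i k * c j k))"
      unfolding power2_eq_square sum_product by (simp add: mult_ac)
    also have "\<dots> = (\<Sum>i\<in>A. \<Sum>j\<in>A. \<Sum>k\<in>W. \<theta> i * \<theta> j * (c i k * c j k))"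
      by (subst sum.swap, rule sum.cong[OF refl], rule sum.swap)
    also have "\<dots> = (\<Sum>i\<in>A. \<Sum>j\<in>A. \<theta> i * \<theta> j * (\<Sum>k\<in>W. ((c i k)\<^sup>2 + (c j k)\<^sup>2 - (c i k - c j k)\<^sup>2) / 2))"
      by (simp add: sum_distrib_left power2_eq_square algebra_simps)
    finally show ?thesis by (simp add: sum_divide_distrib[symmetric] sum.distrib sum_subtractf)
  qed
  then show "(\<lambda>m. \<Sum>k\<in>window m. (\<Sum>i\<in>A. \<theta> i * c i k)\<^sup>2) \<longlonglongrightarrow>
    (\<Sum>i\<in>A. \<Sum>j\<in>A. \<theta> i * \<theta> j * ((l2sq (c i) + l2sq (c j) - l2sq (\<lambda>k. c i k - c j k)) / 2))"
    by (simp only:) (intro tendsto_sum tendsto_mult tendsto_const tendsto_divide tendsto_add tendsto_diff l2sq_window l2_diff c, auto)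
qed

text \<open>The coefficient of \<open>\<xi> k\<close> in the \<open>n\<close>-th partial
  sum.\<close>

definition sum_coeff :: "(int \<Rightarrow> real) \<Rightarrow> nat \<Rightarrow> int \<Rightarrow> real" where
  "sum_coeff a n k = (\<Sum>j=1..n. a (int j - k))"

lemma l2_sum_coeff: "l2 a \<Longrightarrow> l2 (sum_coeff a n)"
  unfolding sum_coeff_def[abs_def] by (intro l2_sum l2_shift)

text \<open>Stationarity at the level of coefficients: an increment is a translate of a partial sum,
  so its norm depends on its length alone.\<close>

lemma sum_coeff_diff: "sum_coeff a (m + n) k - sum_coeff a n k = sum_coeff a m (k - int n)"
  unfolding sum_coeff_def
proof (induction m)
  case (Suc m)
  have "{1..Suc m + n} = insert (Suc m + n) {1..m + n}" by auto
  then show ?case using Suc by (simp add: algebra_simps)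
qed simp

lemma sum_coeff_step: "sum_coeff a n k - sum_coeff a n (k + 1) = a (int n - k) - a (- k)"
  unfolding sum_coeff_def by (induction n) (auto simp: algebra_simps)

lemma sum_coeff_step_bound:
  "\<bar>sum_coeff a n k - sum_coeff a n (k + int l)\<bar> \<le> (\<Sum>i<l. \<bar>a (int n - k - int i)\<bar>) + (\<Sum>i<l. \<bar>a (- k - int i)\<bar>)"
proof (induction l)
  case (Suc l)
  have "sum_coeff a n (k + int l) - sum_coeff a n (k + int (Suc l)) = a (int n - k - int l) - a (- k - int l)"
    using sum_coeff_step[of a n "k + int l"] by (simp add: algebra_simps)
  then have "\<bar>sum_coeff a n (k + int l) - sum_coeff a n (k + int (Suc l))\<bar> \<le> \<bar>a (int n - k - int l)\<bar> + \<bar>a (- k - int l)\<bar>"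
    by linarith
  then show ?case using Suc by simp
qed simp

lemma sum_abs_le_l2norm:
  assumes a: "l2 a" and f: "inj f"
  shows "(\<Sum>i<l::nat. \<bar>a (f i)\<bar>) \<le> sqrt (real l) * l2norm a"
proof -
  have "(\<Sum>i<l. 1 * \<bar>a (f i)\<bar>)\<^sup>2 \<le> (\<Sum>i<l. 1\<^sup>2) * (\<Sum>i<l. \<bar>a (f i)\<bar>\<^sup>2)"
    by (rule Cauchy_Schwarz_ineq_sum)
  also have "(\<Sum>i<l. \<bar>a (f i)\<bar>\<^sup>2) = (\<Sum>k\<in>f ` {..<l}. (a k)\<^sup>2)"
    using f by (subst sum.reindex) (auto intro: inj_on_subset)
  also have "(\<Sum>i<l. 1\<^sup>2) * \<dots> \<le> (\<Sum>i<l. 1\<^sup>2) * l2sq a"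
    by (intro mult_left_mono l2sq_ge_sum a) auto
  also have "\<dots> = (sqrt (real l) * l2norm a)\<^sup>2" by (simp add: power_mult_distrib l2norm_power2)
  finally have "(\<Sum>i<l. \<bar>a (f i)\<bar>)\<^sup>2 \<le> (sqrt (real l) * l2norm a)\<^sup>2" by simp
  then show ?thesis by (rule power2_le_imp_le) (simp add: l2norm_nonneg)
qed

text \<open>A single large coefficient forces its neighbours to be large, since neighbouring
  coefficients differ by two terms of a square summable sequence.\<close>

lemma sum_coeff_bound:
  assumes a: "l2 a" and L: "L \<ge> 1"
  shows "\<bar>sum_coeff a n k\<bar> \<le> l2norm (sum_coeff a n) / sqrt (real L) + 2 * sqrt (real L) * l2norm a"
proof -
  \<comment> \<open>Pigeonhole: the \<open>L\<close> squares add up to at most the squared norm, so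
    one of them does not exceed the average.\<close>
  have "\<exists>l<L. (sum_coeff a n (k + int l))\<^sup>2 \<le> l2sq (sum_coeff a n) / real L"
  proof (rule ccontr)
    assume "\<not> ?thesis"
    then have "(\<Sum>l<L. l2sq (sum_coeff a n) / real L) < (\<Sum>l<L. (sum_coeff a n (k + int l))\<^sup>2)"
      using L by (intro sum_strict_mono) (auto simp: not_le lessThan_empty_iff)
    also have "\<dots> = (\<Sum>i\<in>(\<lambda>l. k + int l) ` {..<L}. (sum_coeff a n i)\<^sup>2)"
      by (subst sum.reindex) (auto simp: inj_on_def)
    also have "\<dots> \<le> l2sq (sum_coeff a n)" by (intro l2sq_ge_sum l2_sum_coeff a) auto
    finally show False using L by simp
  qed
  then obtain l where l: "l < L" "(sum_coeff a n (k + int l))\<^sup>2 \<le> l2sq (sum_coeff a n) / real L" by blast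
  have "(sum_coeff a n (k + int l))\<^sup>2 \<le> (l2norm (sum_coeff a n) / sqrt (real L))\<^sup>2"
    using l(2) by (simp add: power_divide l2norm_power2)
  then have 1: "\<bar>sum_coeff a n (k + int l)\<bar> \<le> l2norm (sum_coeff a n) / sqrt (real L)"
    by (intro power2_le_imp_le[of "\<bar>_\<bar>"]) (auto simp: l2norm_nonneg)
  have 2: "(\<Sum>i<l. \<bar>a (int n - k - int i)\<bar>) \<le> sqrt (real l) * l2norm a"
    by (rule sum_abs_le_l2norm[OF a]) (auto intro: injI)
  have 3: "(\<Sum>i<l. \<bar>a (- k - int i)\<bar>) \<le> sqrt (real l) * l2norm a"
    by (rule sum_abs_le_l2norm[OF a]) (auto intro: injI)
  have "sqrt (real l) * l2norm a \<le> sqrt (real L) * l2norm a"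
    using l by (intro mult_right_mono) (auto simp: l2norm_nonneg)
  then show ?thesis using 1 2 3 sum_coeff_step_bound[of a n k l] by linarith
qed

section \<open>Variances and finite dimensional limits of the partial sums\<close>

locale fractional_sum = std_iid M \<xi> for M :: "'a measure" and \<xi> +
  fixes a :: "int \<Rightarrow> real" and H :: real and h :: "real \<Rightarrow> real"
  assumes l2_a: "l2 a" and H0: "0 < H"
    and h_pos: "\<And>x. x > 0 \<Longrightarrow> h x > 0" and h_sv: "slowly_varying h"
    and var_sum: "\<And>n. n \<ge> 1 \<Longrightarrow> variance (linear_process_sum a \<xi> n) = (h (real n))\<^sup>2 * real n powr (2 * H)"
begin

abbreviation S :: "nat \<Rightarrow> 'a \<Rightarrow> real" where "S \<equiv> linear_process_sum a \<xi>"

definition s :: "nat \<Rightarrow> real" where "s n = l2norm (sum_coeff a n)"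

lemma S_measurable [measurable]: "S n \<in> borel_measurable M"
  unfolding linear_process_sum_def[abs_def] linear_process_def[abs_def] by measurable

lemma linear_process_series: "linear_process a \<xi> j \<omega> = series (\<lambda>k. a (j - k)) \<omega>"
  unfolding linear_process_def series_def ..

lemma AE_S: "AE \<omega> in M. S n \<omega> = series (sum_coeff a n) \<omega>"
proof -
  have "AE \<omega> in M. series (\<lambda>k. \<Sum>i=1..n. 1 * a (int i - k)) \<omega> = (\<Sum>i=1..n. 1 * series (\<lambda>k. a (int i - k)) \<omega>)"
    by (rule AE_series_sum) (auto intro: l2_shift l2_a)
  then show ?thesis
    by eventually_elim (simp add: linear_process_sum_def linear_process_series sum_coeff_def[abs_def])
qed

lemma variance_S: "variance (S n) = (s n)\<^sup>2"
proof -
  have c: "l2 (sum_coeff a n)" by (rule l2_sum_coeff[OF l2_a])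
  have "expectation (S n) = expectation (series (sum_coeff a n))"
    using AE_S[of n] by (intro integral_cong_AE) auto
  then have 0: "expectation (S n) = 0" using expectation_series[OF c] by simp
  have "expectation (\<lambda>\<omega>. (S n \<omega>)\<^sup>2) = expectation (\<lambda>\<omega>. (series (sum_coeff a n) \<omega>)\<^sup>2)"
    using AE_S[of n] by (intro integral_cong_AE) (auto elim: eventually_mono)
  then show ?thesis unfolding 0 using second_moment_series[OF c] by (simp add: s_def l2norm_power2)
qed

lemma s_eq: "n \<ge> 1 \<Longrightarrow> s n = h (real n) * real n powr H"
proof -
  assume n: "n \<ge> 1"
  have "(s n)\<^sup>2 = (h (real n) * real n powr H)\<^sup>2"
    using variance_S[of n] var_sum[OF n] unfolding mult_2 powr_add by (simp add: power_mult_distrib power2_eq_square)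
  moreover have "0 \<le> s n" "0 \<le> h (real n) * real n powr H"
    using n h_pos[of "real n"] by (auto simp: s_def l2norm_nonneg)
  ultimately show ?thesis using power2_eq_imp_eq by blast
qed

lemma l2sq_diff_coeff: "l2sq (\<lambda>k. sum_coeff a (m + n) k - sum_coeff a n k) = (s m)\<^sup>2"
  unfolding sum_coeff_diff using l2sq_translate[of "sum_coeff a m" "- int n"]
  by (simp add: s_def l2norm_power2)

text \<open>Translation invariance of the norm and its triangle inequality, applied in both
  directions, give \<open>s_diff\<close>; slow variation enters only through integer
  dilations.\<close>

sublocale regular_norm s H
proof
  show "s 0 = 0" by (simp add: s_def l2norm_def l2sq_def sum_coeff_def)
  show "s n > 0" if "n \<ge> 1" for n using s_eq[OF that] h_pos[of "real n"] that by simp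
  fix m n
  have c: "l2 (sum_coeff a i)" for i by (rule l2_sum_coeff[OF l2_a])
  define d where "d k = sum_coeff a (m + n) k - sum_coeff a n k" for k
  have d: "l2 d" "l2norm d = s m"
    using l2_diff[OF c c] l2sq_diff_coeff[of m n] l2norm_nonneg[of "sum_coeff a m"]
    by (auto simp: d_def[abs_def] l2norm_def s_def)
  have "s (m + n) \<le> s n + s m"
    using l2norm_triangle[OF c d(1), of n] d by (simp add: s_def d_def)
  moreover have "s n \<le> s (m + n) + s m"
    using l2norm_triangle[OF c l2_scale[OF d(1), of "-1"], of "m + n"] d l2sq_scale[of "-1" d]
    by (simp add: s_def d_def l2norm_def)
  ultimately show "\<bar>s (m + n) - s n\<bar> \<le> s m" by linarith
next
  fix q :: nat assume q: "q \<ge> 1"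
  have "((\<lambda>x. h (real q * x) / h x) \<longlongrightarrow> 1) at_top"
    using h_sv q by (auto simp: slowly_varying_def)
  then have "(\<lambda>n. h (real q * real n) / h (real n)) \<longlonglongrightarrow> 1"
    by (rule filterlim_compose[OF _ filterlim_real_sequentially])
  then have "(\<lambda>n. real q powr H * (h (real q * real n) / h (real n))) \<longlonglongrightarrow> real q powr H * 1"
    by (intro tendsto_intros)
  then have lim: "(\<lambda>n. real q powr H * (h (real q * real n) / h (real n))) \<longlonglongrightarrow> real q powr H" by simp
  show "(\<lambda>n. s (q * n) / s n) \<longlonglongrightarrow> real q powr H"
  proof (rule Lim_transform_eventually[OF lim])
    show "\<forall>\<^sub>F n in sequentially. real q powr H * (h (real q * real n) / h (real n)) = s (q * n) / s n"
      using eventually_ge_at_top[of 1]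
    proof eventually_elim
      case (elim n)
      then have "s (q * n) = h (real q * real n) * (real q powr H * real n powr H)"
        using q by (subst s_eq) (auto simp: powr_mult)
      then show ?case using elim s_eq[OF elim] by simp
    qed
  qed
qed (rule H0)

text \<open>Choosing \<open>L\<close> large makes the first term of \<open>sum_coeff_bound\<close> a
  small multiple of \<open>s n\<close>; the second is then a constant, which \<open>s n\<close>
  outgrows. Uniformity in \<open>i \<le> n\<close> comes from
  \<open>s_bounded_by_last\<close>.\<close>

lemma sum_coeff_negligible:
  assumes e: "e > 0"
  shows "\<forall>\<^sub>F n in sequentially. \<forall>k. \<forall>i\<le>n. \<bar>sum_coeff a i k\<bar> \<le> e * s n"
proof -
  obtain C where C: "\<And>m n. m \<le> n \<Longrightarrow> s m \<le> C * s n" using s_bounded_by_last by blast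
  have "(\<lambda>L. C / sqrt (real L)) \<longlonglongrightarrow> 0"
    by (intro real_tendsto_divide_at_top[OF tendsto_const] filterlim_compose[OF sqrt_at_top] filterlim_real_sequentially)
  then have "\<forall>\<^sub>F L in sequentially. C / sqrt (real L) < e / 2"
    by (rule order_tendstoD) (use e in auto)
  then have "\<forall>\<^sub>F L in sequentially. C / sqrt (real L) < e / 2 \<and> L \<ge> 1"
    using eventually_ge_at_top[of 1] by eventually_elim auto
  then obtain L where L: "C / sqrt (real L) < e / 2" "L \<ge> 1" by (auto simp: eventually_sequentially)
  define D where "D = 2 * sqrt (real L) * l2norm a"
  have "\<forall>\<^sub>F n in sequentially. s n \<ge> 2 * D / e"
    using s_at_top by (simp add: filterlim_at_top)
  then show ?thesis
  proof eventually_elim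
    case (elim n)
    then have D: "D \<le> e / 2 * s n" using e by (simp add: field_simps)
    show ?case
    proof (intro allI impI)
      fix k i assume "i \<le> n"
      have "\<bar>sum_coeff a i k\<bar> \<le> s i / sqrt (real L) + D"
        using sum_coeff_bound[OF l2_a L(2), of i k] by (simp add: s_def D_def)
      also have "s i / sqrt (real L) \<le> (C * s n) / sqrt (real L)"
        by (intro divide_right_mono C \<open>i \<le> n\<close>) auto
      also have "(C * s n) / sqrt (real L) = C / sqrt (real L) * s n" by simp
      also have "\<dots> \<le> e / 2 * s n" using L s_nonneg[of n] by (intro mult_right_mono) auto
      finally show "\<bar>sum_coeff a i k\<bar> \<le> e * s n" using D by (simp add: field_simps)
    qed
  qed
qed

lemma l2sq_diff_coeff': "l2sq (\<lambda>k. sum_coeff a p k - sum_coeff a q k) = (s (if p \<le> q then q - p else p - q))\<^sup>2"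
proof (cases "p \<le> q")
  case True
  have "l2sq (\<lambda>k. sum_coeff a p k - sum_coeff a q k) = l2sq (\<lambda>k. sum_coeff a q k - sum_coeff a p k)"
    unfolding l2sq_def by (simp add: power2_commute)
  then show ?thesis using True l2sq_diff_coeff[of "q - p" p] by simp
next
  case False
  then show ?thesis using l2sq_diff_coeff[of "p - q" q] by simp
qed

definition fbm_cov :: "real \<Rightarrow> real \<Rightarrow> real" where
  "fbm_cov t u = (t powr (2 * H) + u powr (2 * H) - \<bar>t - u\<bar> powr (2 * H)) / 2"

lemma power2_powr_H: "x \<ge> 0 \<Longrightarrow> (x powr H)\<^sup>2 = x powr (2 * H)"
  unfolding power2_eq_square mult_2 powr_add ..

lemma s_ratio_sq: 
  assumes "0 \<le> t" "t \<le> 1"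
  shows "(\<lambda>n. (s (nat \<lfloor>real n * t\<rfloor>) / s n)\<^sup>2) \<longlonglongrightarrow> t powr (2 * H)"
  using tendsto_power[OF s_ratio_real[OF assms], of 2] power2_powr_H[OF assms(1)] by simp

lemma s_ratio_diff_sq: 
  assumes t: "0 \<le> t" "t \<le> 1" and u: "0 \<le> u" "u \<le> 1"
  defines "d n \<equiv> (if nat \<lfloor>real n * t\<rfloor> \<le> nat \<lfloor>real n * u\<rfloor> then nat \<lfloor>real n * u\<rfloor> - nat \<lfloor>real n * t\<rfloor>
     else nat \<lfloor>real n * t\<rfloor> - nat \<lfloor>real n * u\<rfloor>)"
  shows "(\<lambda>n. (s (d n) / s n)\<^sup>2) \<longlonglongrightarrow> \<bar>t - u\<bar> powr (2 * H)"
proof -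
  \<comment> \<open>A difference of floors and the floor of the difference agree up to a bounded
    error, which \<open>s_ratio_close\<close> ignores.\<close>
  have close: "d n \<le> nat \<lfloor>real n * \<bar>t - u\<bar>\<rfloor> + 2 \<and> nat \<lfloor>real n * \<bar>t - u\<bar>\<rfloor> \<le> d n + 2" for n
  proof -
    have nn: "0 \<le> real n * t" "0 \<le> real n * u" using t u by auto
    have eq: "real n * \<bar>t - u\<bar> = \<bar>real n * t - real n * u\<bar>"
      by (simp add: right_diff_distrib[symmetric] abs_mult)
    show ?thesis unfolding eq d_def using nn by (auto simp: abs_if) linarith+
  qed
  have 1: "(\<lambda>n. s (d n) / s n - s (nat \<lfloor>real n * \<bar>t - u\<bar>\<rfloor>) / s n) \<longlonglongrightarrow> 0"
    by (rule s_ratio_close[where R = 2]) (use close in auto)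
  have 2: "(\<lambda>n. s (nat \<lfloor>real n * \<bar>t - u\<bar>\<rfloor>) / s n) \<longlonglongrightarrow> \<bar>t - u\<bar> powr H"
    by (rule s_ratio_real) (use t u in auto)
  from tendsto_add[OF 1 2] have "(\<lambda>n. s (d n) / s n) \<longlonglongrightarrow> \<bar>t - u\<bar> powr H" by simp
  from tendsto_power[OF this, of 2] show ?thesis using power2_powr_H[of "\<bar>t - u\<bar>"] by simp
qed

text \<open>A linear combination of partial sums is again one series, with coefficients
  \<open>c n\<close>. Polarization identifies the limit of its squared norm, its coefficients tend
  to 0 uniformly, and \<open>char_series_approx\<close> does the rest.\<close>

theorem char_fdd_tendsto:
  assumes A: "finite A" and t: "\<And>i. i \<in> A \<Longrightarrow> 0 \<le> t i \<and> t i \<le> 1"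
  shows "(\<lambda>n. expectation (\<lambda>\<omega>. iexp (\<Sum>i\<in>A. \<theta> i * (S (nat \<lfloor>real n * t i\<rfloor>) \<omega> / s n)))) \<longlonglongrightarrow>
    of_real (exp (- ((\<Sum>i\<in>A. \<Sum>j\<in>A. \<theta> i * \<theta> j * fbm_cov (t i) (t j)) / 2)))"
proof -
  define N where "N n i = nat \<lfloor>real n * t i\<rfloor>" for n i
  define c where "c n k = (\<Sum>i\<in>A. (\<theta> i / s n) * sum_coeff a (N n i) k)" for n k
  define \<sigma> where "\<sigma> = (\<Sum>i\<in>A. \<Sum>j\<in>A. \<theta> i * \<theta> j * fbm_cov (t i) (t j))"
  have lc: "l2 (sum_coeff a i)" for i by (rule l2_sum_coeff[OF l2_a])
  have c: "l2 (c n)" for n unfolding c_def[abs_def] by (intro l2_sum l2_scale lc)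
  have eq: "expectation (\<lambda>\<omega>. iexp (\<Sum>i\<in>A. \<theta> i * (S (N n i) \<omega> / s n))) = expectation (\<lambda>\<omega>. iexp (series (c n) \<omega>))" for n
  proof (rule integral_cong_AE)
    have "AE \<omega> in M. \<forall>i\<in>A. S (N n i) \<omega> = series (sum_coeff a (N n i)) \<omega>"
      using A AE_S by (intro AE_finite_allI) auto
    moreover have "AE \<omega> in M. series (c n) \<omega> = (\<Sum>i\<in>A. (\<theta> i / s n) * series (sum_coeff a (N n i)) \<omega>)"
      unfolding c_def[abs_def] by (rule AE_series_sum[OF A lc])
    ultimately show "AE \<omega> in M. iexp (\<Sum>i\<in>A. \<theta> i * (S (N n i) \<omega> / s n)) = iexp (series (c n) \<omega>)"
      by eventually_elim simp
  qed auto
  have "l2sq (c n) = (\<Sum>i\<in>A. \<Sum>j\<in>A. \<theta> i * \<theta> j * (((s (N n i) / s n)\<^sup>2 + (s (N n j) / s n)\<^sup>2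
      - (s (if N n i \<le> N n j then N n j - N n i else N n i - N n j) / s n)\<^sup>2) / 2))" for n
  proof -
    have "l2sq (c n) = (\<Sum>i\<in>A. \<Sum>j\<in>A. (\<theta> i / s n) * (\<theta> j / s n) * ((l2sq (sum_coeff a (N n i)) + l2sq (sum_coeff a (N n j))
        - l2sq (\<lambda>k. sum_coeff a (N n i) k - sum_coeff a (N n j) k)) / 2))"
      unfolding c_def[abs_def] by (rule l2sq_linear_combination[OF A lc])
    also have "\<dots> = (\<Sum>i\<in>A. \<Sum>j\<in>A. \<theta> i * \<theta> j * (((s (N n i) / s n)\<^sup>2 + (s (N n j) / s n)\<^sup>2
      - (s (if N n i \<le> N n j then N n j - N n i else N n i - N n j) / s n)\<^sup>2) / 2))"
      unfolding l2sq_diff_coeff' l2norm_power2[symmetric] s_def[symmetric]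
      by (intro sum.cong refl) (simp add: power_divide power2_eq_square add_divide_distrib[symmetric] diff_divide_distrib[symmetric] del: divide_divide_eq_left)
    finally show ?thesis .
  qed
  moreover have "(\<lambda>n. \<Sum>i\<in>A. \<Sum>j\<in>A. \<theta> i * \<theta> j * (((s (N n i) / s n)\<^sup>2 + (s (N n j) / s n)\<^sup>2
      - (s (if N n i \<le> N n j then N n j - N n i else N n i - N n j) / s n)\<^sup>2) / 2)) \<longlonglongrightarrow> \<sigma>"
    unfolding \<sigma>_def fbm_cov_def N_def
    by (intro tendsto_sum tendsto_mult tendsto_const tendsto_divide tendsto_add tendsto_diff s_ratio_sq s_ratio_diff_sq) (use t in auto)
  ultimately have lim: "(\<lambda>n. l2sq (c n)) \<longlonglongrightarrow> \<sigma>" by simp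
  define T where "T = (\<Sum>i\<in>A. \<bar>\<theta> i\<bar>)"
  have T: "T \<ge> 0" by (simp add: T_def sum_nonneg)
  have small: "\<forall>\<^sub>F n in sequentially. \<forall>k. \<bar>c n k\<bar> \<le> d" if d: "d > 0" for d
  proof -
    have "d / (T + 1) > 0" using d T by simp
    from sum_coeff_negligible[OF this] eventually_ge_at_top[of 1]
    show ?thesis
    proof eventually_elim
      case (elim n)
      have sn: "s n > 0" using s_pos elim by simp
      show ?case
      proof
        fix k
        have "\<bar>c n k\<bar> \<le> (\<Sum>i\<in>A. \<bar>(\<theta> i / s n) * sum_coeff a (N n i) k\<bar>)"
          unfolding c_def by (rule sum_abs)
        also have "\<dots> \<le> (\<Sum>i\<in>A. \<bar>\<theta> i\<bar> * (d / (T + 1)))"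
        proof (rule sum_mono)
          fix i assume i: "i \<in> A"
          have "N n i \<le> n" unfolding N_def using t[OF i] by (intro nat_floor_le) auto
          then have "\<bar>sum_coeff a (N n i) k\<bar> \<le> d / (T + 1) * s n" using elim by blast
          then have "\<bar>\<theta> i\<bar> * (\<bar>sum_coeff a (N n i) k\<bar> / s n) \<le> \<bar>\<theta> i\<bar> * (d / (T + 1))"
            using sn by (intro mult_left_mono) (simp_all add: pos_divide_le_eq)
          then show "\<bar>(\<theta> i / s n) * sum_coeff a (N n i) k\<bar> \<le> \<bar>\<theta> i\<bar> * (d / (T + 1))"
            using sn by (simp add: abs_mult abs_divide)
        qed
        also have "\<dots> = T * (d / (T + 1))" by (simp only: T_def sum_distrib_right)
        also have "\<dots> = d * (T / (T + 1))" by simp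
        also have "\<dots> \<le> d * 1" using d T by (intro mult_left_mono) auto
        finally show "\<bar>c n k\<bar> \<le> d" by simp
      qed
    qed
  qed
  have \<sigma>: "\<sigma> \<ge> 0" by (rule LIMSEQ_le_const[OF lim]) (auto simp: l2sq_nonneg)
  have "(\<lambda>n. expectation (\<lambda>\<omega>. iexp (series (c n) \<omega>)) - of_real (exp (- (l2sq (c n) / 2)))) \<longlonglongrightarrow> 0"
  proof (rule tendstoI)
    fix e :: real assume e: "e > 0"
    \<comment> \<open>The squared norms are eventually below \<open>\<sigma> + 1\<close>, which
      turns the relative error into an absolute one.\<close>
    define e' where "e' = e / (\<sigma> + 1)"
    have e': "e' > 0" using e \<sigma> by (simp add: e'_def)
    obtain d where d: "d > 0" "\<And>c. l2 c \<Longrightarrow> (\<And>k. \<bar>c k\<bar> \<le> d) \<Longrightarrow>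
      norm (expectation (\<lambda>\<omega>. iexp (series c \<omega>)) - of_real (exp (- (l2sq c / 2)))) \<le> e' * l2sq c"
      using char_series_approx[OF e'] by blast
    have "\<forall>\<^sub>F n in sequentially. l2sq (c n) < \<sigma> + 1" by (rule order_tendstoD[OF lim]) simp
    with small[OF d(1)]
    show "\<forall>\<^sub>F n in sequentially. dist (expectation (\<lambda>\<omega>. iexp (series (c n) \<omega>)) - of_real (exp (- (l2sq (c n) / 2)))) 0 < e"
    proof eventually_elim
      case (elim n)
      then have "norm (expectation (\<lambda>\<omega>. iexp (series (c n) \<omega>)) - of_real (exp (- (l2sq (c n) / 2)))) \<le> e' * l2sq (c n)"
        by (intro d c) auto
      also have "\<dots> < e' * (\<sigma> + 1)" using elim e' by simp
      also have "\<dots> = e" using \<sigma> by (simp add: e'_def)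
      finally show ?case by simp
    qed
  qed
  moreover have "(\<lambda>n. complex_of_real (exp (- (l2sq (c n) / 2)))) \<longlonglongrightarrow> of_real (exp (- (\<sigma> / 2)))"
    by (intro tendsto_intros lim) auto
  ultimately have "(\<lambda>n. (expectation (\<lambda>\<omega>. iexp (series (c n) \<omega>)) - of_real (exp (- (l2sq (c n) / 2)))) + complex_of_real (exp (- (l2sq (c n) / 2)))) \<longlonglongrightarrow> 0 + of_real (exp (- (\<sigma> / 2)))"
    by (rule tendsto_add)
  then show ?thesis unfolding N_def[symmetric] eq \<sigma>_def[symmetric] by simp
qed

lemma S_increment_AE: "AE \<omega> in M. S (i + j) \<omega> - S i \<omega> = series (\<lambda>k. sum_coeff a j (k + (- int i))) \<omega>"
proof -
  have lc: "l2 (sum_coeff a i)" for i by (rule l2_sum_coeff[OF l2_a])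
  \<comment> \<open>A difference as a linear combination over the two booleans with weights 1 and
    -1.\<close>
  have "AE \<omega> in M. series (\<lambda>k. \<Sum>b\<in>UNIV. (if b then 1 else -1) * (if b then sum_coeff a (i + j) else sum_coeff a i) k) \<omega> =
     (\<Sum>b\<in>UNIV. (if b then 1 else -1) * series (if b then sum_coeff a (i + j) else sum_coeff a i) \<omega>)"
    by (rule AE_series_sum) (use lc in auto)
  then have "AE \<omega> in M. series (\<lambda>k. sum_coeff a (i + j) k - sum_coeff a i k) \<omega> =
     series (sum_coeff a (i + j)) \<omega> - series (sum_coeff a i) \<omega>"
    by (simp add: UNIV_bool)
  moreover have "(\<lambda>k. sum_coeff a (i + j) k - sum_coeff a i k) = (\<lambda>k. sum_coeff a j (k + (- int i)))"
    using sum_coeff_diff[of a j i] by (simp add: add.commute)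
  ultimately have "AE \<omega> in M. series (\<lambda>k. sum_coeff a j (k + (- int i))) \<omega> =
     series (sum_coeff a (i + j)) \<omega> - series (sum_coeff a i) \<omega>" by simp
  with AE_S[of i] AE_S[of "i + j"] show ?thesis by eventually_elim simp
qed

theorem increment_moment_bound:
  assumes p: "p \<ge> 2" and m: "integrable M (\<lambda>\<omega>. \<bar>\<xi> l \<omega>\<bar> powr p)"
  obtains K where "K > 0" "\<And>i j. integrable M (\<lambda>\<omega>. \<bar>S (i + j) \<omega> - S i \<omega>\<bar> powr p)"
    "\<And>i j. expectation (\<lambda>\<omega>. \<bar>S (i + j) \<omega> - S i \<omega>\<bar> powr p) \<le> K * s j powr p"
proof -
  obtain K where K: "K > 0" "\<And>c. l2 c \<Longrightarrow> integrable M (\<lambda>\<omega>. \<bar>series c \<omega>\<bar> powr p)"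
    "\<And>c. l2 c \<Longrightarrow> expectation (\<lambda>\<omega>. \<bar>series c \<omega>\<bar> powr p) \<le> K * (l2sq c) powr (p / 2)"
    using series_moment_bound[OF p m] by blast
  show thesis
  proof (rule that[OF K(1)])
    fix i j
    define c where "c k = sum_coeff a j (k + (- int i))" for k
    have c: "l2 c" unfolding c_def[abs_def] by (intro l2_translate l2_sum_coeff l2_a)
    have "(s j)\<^sup>2 powr (p / 2) = s j powr p"
    proof (cases "s j = 0")
      case False
      then have "s j > 0" using s_nonneg[of j] by simp
      then have "(s j)\<^sup>2 = s j powr 2" by simp
      then show ?thesis by (simp only: powr_powr) simp
    qed (use p in auto)
    moreover have "l2sq c = (s j)\<^sup>2"
      unfolding c_def[abs_def] l2sq_translate by (simp add: s_def l2norm_power2)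
    ultimately have e: "expectation (\<lambda>\<omega>. \<bar>series c \<omega>\<bar> powr p) \<le> K * s j powr p" using K(3)[OF c] by simp
    have ae: "AE \<omega> in M. \<bar>series c \<omega>\<bar> powr p = \<bar>S (i + j) \<omega> - S i \<omega>\<bar> powr p"
      using S_increment_AE[of i j] by eventually_elim (simp add: c_def[abs_def])
    show "integrable M (\<lambda>\<omega>. \<bar>S (i + j) \<omega> - S i \<omega>\<bar> powr p)"
      using K(2)[OF c] by (rule integrable_cong_AE_imp) (use ae in \<open>auto elim: eventually_mono\<close>)
    have "expectation (\<lambda>\<omega>. \<bar>series c \<omega>\<bar> powr p) = expectation (\<lambda>\<omega>. \<bar>S (i + j) \<omega> - S i \<omega>\<bar> powr p)"
      by (rule integral_cong_AE) (use ae in auto)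
    then show "expectation (\<lambda>\<omega>. \<bar>S (i + j) \<omega> - S i \<omega>\<bar> powr p) \<le> K * s j powr p" using e by simp
  qed
qed

end

section \<open>Gaussian limits and a maximal inequality\<close>

text \<open>A degenerate law with mean zero sits at 0 and obeys the formula with variance 0, so both
  cases of \<open>gaussian_rv\<close> lead to one expression.\<close>

lemma (in prob_space) gaussian_char:
  assumes X: "gaussian_rv M X" and m: "expectation X = 0"
  shows "integrable M (\<lambda>\<omega>. (X \<omega>)\<^sup>2)"
    "expectation (\<lambda>\<omega>. iexp (X \<omega>)) = of_real (exp (- (expectation (\<lambda>\<omega>. (X \<omega>)\<^sup>2) / 2)))"
proof -
  have Xm [measurable]: "X \<in> borel_measurable M" using X by (simp add: gaussian_rv_def)
  consider (const) c where "AE \<omega> in M. X \<omega> = c"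
    | (normal) c \<sigma> where "\<sigma> > 0" "distributed M lborel X (\<lambda>x. ennreal (normal_density c \<sigma> x))"
    using X unfolding gaussian_rv_def by blast
  then have "integrable M (\<lambda>\<omega>. (X \<omega>)\<^sup>2) \<and>
    expectation (\<lambda>\<omega>. iexp (X \<omega>)) = of_real (exp (- (expectation (\<lambda>\<omega>. (X \<omega>)\<^sup>2) / 2)))"
  proof cases
    case const
    have "expectation X = expectation (\<lambda>_. c)" using const by (intro integral_cong_AE) auto
    then have "c = 0" using m by (simp add: prob_space)
    then have ae: "AE \<omega> in M. X \<omega> = 0" using const by simp
    have "expectation (\<lambda>\<omega>. (X \<omega>)\<^sup>2) = expectation (\<lambda>_. 0)"
      using ae by (intro integral_cong_AE) auto
    moreover have "expectation (\<lambda>\<omega>. iexp (X \<omega>)) = expectation (\<lambda>_. 1)"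
      using ae by (intro integral_cong_AE) auto
    moreover have "integrable M (\<lambda>\<omega>. (X \<omega>)\<^sup>2)"
      by (rule integrable_cong_AE_imp[of _ "\<lambda>_. 0"]) (use ae in \<open>auto elim: eventually_mono\<close>)
    ultimately show ?thesis by (simp add: prob_space)
  next
    case normal
    have c: "c = 0" using normal_distributed_expectation[OF normal] m by simp
    have v: "expectation (\<lambda>\<omega>. (X \<omega>)\<^sup>2) = \<sigma>\<^sup>2" using normal_distributed_variance[OF normal] m by simp
    then have i: "integrable M (\<lambda>\<omega>. (X \<omega>)\<^sup>2)"
      using not_integrable_integral_eq[of M "\<lambda>\<omega>. (X \<omega>)\<^sup>2"] normal(1) by auto
    define Y where "Y \<omega> = X \<omega> / \<sigma>" for \<omega>
    have [measurable]: "Y \<in> borel_measurable M" unfolding Y_def[abs_def] by simp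
    have "distributed M lborel Y std_normal_density"
      using normal normal_standard_normal_convert[OF normal(1), of X c] c by (simp add: Y_def[abs_def])
    then have "distr M lborel Y = std_normal_distribution" by (rule distributed_distr_eq_density)
    then have D: "distr M borel Y = std_normal_distribution"
      by (metis distr_cong sets_lborel)
    have "expectation (\<lambda>\<omega>. iexp (X \<omega>)) = expectation (\<lambda>\<omega>. iexp (\<sigma> * Y \<omega>))"
      using normal(1) by (simp add: Y_def)
    also have "\<dots> = char (distr M borel Y) \<sigma>" by (simp add: char_def integral_distr)
    also have "\<dots> = of_real (exp (- (\<sigma>\<^sup>2) / 2))" unfolding D by (simp add: char_std_normal_distribution)
    finally show ?thesis using i v by simp
  qed
  then show "integrable M (\<lambda>\<omega>. (X \<omega>)\<^sup>2)"
    "expectation (\<lambda>\<omega>. iexp (X \<omega>)) = of_real (exp (- (expectation (\<lambda>\<omega>. (X \<omega>)\<^sup>2) / 2)))" by auto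
qed

lemma fractional_BM_char:
  assumes B: "fractional_BM_on I H N B" and A: "finite A" and t: "inj_on t A" "t ` A \<subseteq> I"
  shows "(\<integral>\<omega>. iexp (\<Sum>i\<in>A. \<theta> i * B (t i) \<omega>) \<partial>N) = of_real (exp (- ((\<Sum>i\<in>A. \<Sum>j\<in>A. \<theta> i * \<theta> j *
    ((t i powr (2 * H) + t j powr (2 * H) - \<bar>t i - t j\<bar> powr (2 * H)) / 2)) / 2)))"
    "u \<in> I \<Longrightarrow> integrable N (\<lambda>\<omega>. (B u \<omega>)\<^sup>2)"
    "u \<in> I \<Longrightarrow> B u \<in> borel_measurable N"
proof -
  interpret N: prob_space N using B by (simp add: fractional_BM_on_def)
  have g: "gaussian_rv N (\<lambda>\<omega>. \<Sum>u\<in>T. c u * B u \<omega>)" if "finite T" "T \<subseteq> I" for T c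
    using B that by (auto simp: fractional_BM_on_def gaussian_process_on_def)
  have g1: "gaussian_rv N (B u)" if "u \<in> I" for u using g[of "{u}" "\<lambda>_. 1"] that by simp
  have m: "N.expectation (B u) = 0" if "u \<in> I" for u using B that by (auto simp: fractional_BM_on_def)
  have sq: "integrable N (\<lambda>\<omega>. (B u \<omega>)\<^sup>2)" if "u \<in> I" for u by (rule N.gaussian_char(1)[OF g1[OF that] m[OF that]])
  have [measurable]: "B u \<in> borel_measurable N" if "u \<in> I" for u using g1[OF that] by (simp add: gaussian_rv_def)
  show "u \<in> I \<Longrightarrow> integrable N (\<lambda>\<omega>. (B u \<omega>)\<^sup>2)" "u \<in> I \<Longrightarrow> B u \<in> borel_measurable N" by fact+
  have "\<forall>u\<in>I. \<forall>v\<in>I. N.expectation (\<lambda>\<omega>. B u \<omega> * B v \<omega>) =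
      (u powr (2 * H) + v powr (2 * H) - \<bar>u - v\<bar> powr (2 * H)) / 2"
    using B unfolding fractional_BM_on_def by (simp add: abs_minus_commute add.commute)
  note cov = this[rule_format]
  have bi: "integrable N (B u)" if "u \<in> I" for u
    by (rule N.square_integrable_imp_integrable[OF _ sq[OF that]]) (use that in measurable)
  have prod: "integrable N (\<lambda>\<omega>. B u \<omega> * B v \<omega>)" if "u \<in> I" "v \<in> I" for u v
  proof (rule Bochner_Integration.integrable_bound[of _ "\<lambda>\<omega>. (B u \<omega>)\<^sup>2 + (B v \<omega>)\<^sup>2"])
    show "AE \<omega> in N. norm (B u \<omega> * B v \<omega>) \<le> norm ((B u \<omega>)\<^sup>2 + (B v \<omega>)\<^sup>2)"
    proof (intro AE_I2)
      fix \<omega>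
      show "norm (B u \<omega> * B v \<omega>) \<le> norm ((B u \<omega>)\<^sup>2 + (B v \<omega>)\<^sup>2)"
        using sum_squares_bound[of "\<bar>B u \<omega>\<bar>" "\<bar>B v \<omega>\<bar>"]
          abs_ge_zero[of "B u \<omega> * B v \<omega>"] unfolding abs_mult real_norm_def power2_abs by linarith
    qed
  qed (use that sq in auto)
  define X where "X \<omega> = (\<Sum>i\<in>A. \<theta> i * B (t i) \<omega>)" for \<omega>
  have tI: "t i \<in> I" if "i \<in> A" for i using t(2) that by auto
  \<comment> \<open>Injectivity of \<open>t\<close> turns indices into times:
    \<open>gaussian_process_on\<close> speaks of sums over sets of times.\<close>
  have "X = (\<lambda>\<omega>. \<Sum>u\<in>t ` A. \<theta> (the_inv_into A t u) * B u \<omega>)"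
    unfolding X_def using t(1) by (simp add: sum.reindex the_inv_into_f_f)
  then have gX: "gaussian_rv N X" using g[of "t ` A" "\<lambda>u. \<theta> (the_inv_into A t u)"] A t(2) by simp
  have mX: "N.expectation X = 0"
    unfolding X_def using bi m tI by (subst Bochner_Integration.integral_sum) auto
  have "N.expectation (\<lambda>\<omega>. (X \<omega>)\<^sup>2) = N.expectation (\<lambda>\<omega>. \<Sum>i\<in>A. \<Sum>j\<in>A. \<theta> i * \<theta> j * (B (t i) \<omega> * B (t j) \<omega>))"
    unfolding X_def power2_eq_square sum_product by (simp add: mult_ac)
  also have "\<dots> = (\<Sum>i\<in>A. \<Sum>j\<in>A. \<theta> i * \<theta> j * N.expectation (\<lambda>\<omega>. B (t i) \<omega> * B (t j) \<omega>))"
    using prod tI by (simp add: Bochner_Integration.integral_sum)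
  also have "\<dots> = (\<Sum>i\<in>A. \<Sum>j\<in>A. \<theta> i * \<theta> j *
    ((t i powr (2 * H) + t j powr (2 * H) - \<bar>t i - t j\<bar> powr (2 * H)) / 2))"
    by (intro sum.cong refl) (simp only: cov tI)
  finally have "N.expectation (\<lambda>\<omega>. (X \<omega>)\<^sup>2) = (\<Sum>i\<in>A. \<Sum>j\<in>A. \<theta> i * \<theta> j *
    ((t i powr (2 * H) + t j powr (2 * H) - \<bar>t i - t j\<bar> powr (2 * H)) / 2))" .
  then show "(\<integral>\<omega>. iexp (\<Sum>i\<in>A. \<theta> i * B (t i) \<omega>) \<partial>N) = of_real (exp (- ((\<Sum>i\<in>A. \<Sum>j\<in>A. \<theta> i * \<theta> j *
    ((t i powr (2 * H) + t j powr (2 * H) - \<bar>t i - t j\<bar> powr (2 * H)) / 2)) / 2)))"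
    using N.gaussian_char(2)[OF gX mX] by (simp add: X_def)
qed

text \<open>Either \<open>b\<close> is at most a small multiple of \<open>a\<close> and is absorbed
  by the factor \<open>l\<close>, or \<open>a\<close> is at most a large multiple of
  \<open>b\<close>. The factor of \<open>a powr p\<close> may be as close to 1 as desired, which a
  recursion over scales needs.\<close>

lemma powr_add_le_split:
  fixes p l :: real
  assumes p: "p > 0" and l: "l > 1"
  obtains C where "C > 0" "\<And>a b. 0 \<le> a \<Longrightarrow> 0 \<le> b \<Longrightarrow> (a + b) powr p \<le> l * a powr p + C * b powr p"
proof -
  define d where "d = l powr (1 / p) - 1"
  have "1 powr (1 / p) < l powr (1 / p)" using l p by (intro powr_less_mono2) auto
  then have d: "d > 0" by (simp add: d_def)
  have ld: "(1 + d) powr p = l" using l p by (simp add: d_def powr_powr)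
  define C where "C = (1 / d + 1) powr p"
  have "1 / d + 1 > 0" using d by (simp add: add_pos_pos)
  then have C: "C > 0" unfolding C_def by simp
  show thesis
  proof (rule that[OF C])
    fix a b :: real assume ab: "0 \<le> a" "0 \<le> b"
    show "(a + b) powr p \<le> l * a powr p + C * b powr p"
    proof (cases "b \<le> d * a")
      case True
      have "(a + b) powr p \<le> ((1 + d) * a) powr p"
        using True ab p by (intro powr_mono2) (auto simp: algebra_simps)
      also have "\<dots> = l * a powr p" using ld by (simp add: powr_mult)
      moreover have "0 \<le> C * b powr p" using C by simp
      ultimately show ?thesis by linarith
    next
      case False
      then have "a \<le> b / d" using d by (simp add: field_simps)
      then have "(a + b) powr p \<le> ((1 / d + 1) * b) powr p"
        using ab p by (intro powr_mono2) (auto simp: algebra_simps)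
      also have "\<dots> = C * b powr p" by (simp add: C_def powr_mult)
      moreover have "0 \<le> l * a powr p" using l by simp
      ultimately show ?thesis by linarith
    qed
  qed
qed

section \<open>A maximal inequality over dyadic blocks\<close>

context prob_space
begin

text \<open>The endpoint \<open>2 ^ r\<close> is included, so that adjacent blocks share a point and
  join to a block of twice the length.\<close>

definition dyadic_max :: "(nat \<Rightarrow> 'a \<Rightarrow> real) \<Rightarrow> nat \<Rightarrow> nat \<Rightarrow> 'a \<Rightarrow> real" where
  "dyadic_max x r i \<omega> = Max ((\<lambda>j. \<bar>x (i + j) \<omega> - x i \<omega>\<bar>) ` {..2 ^ r})"

lemma dyadic_max_ge: "j \<le> 2 ^ r \<Longrightarrow> \<bar>x (i + j) \<omega> - x i \<omega>\<bar> \<le> dyadic_max x r i \<omega>"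
  unfolding dyadic_max_def by (intro Max_ge) auto

lemma dyadic_max_nonneg: "0 \<le> dyadic_max x r i \<omega>"
  using dyadic_max_ge[of 0 r x i \<omega>] by simp

lemma dyadic_max_least:
  "(\<And>j. j \<le> 2 ^ r \<Longrightarrow> \<bar>x (i + j) \<omega> - x i \<omega>\<bar> \<le> c) \<Longrightarrow> dyadic_max x r i \<omega> \<le> c"
  unfolding dyadic_max_def by (intro Max.boundedI) auto

lemma dyadic_max_measurable [measurable]:
  assumes [measurable]: "\<And>j. x j \<in> borel_measurable M"
  shows "dyadic_max x r i \<in> borel_measurable M"
  unfolding dyadic_max_def[abs_def] by (rule borel_measurable_Max) auto

lemma dyadic_max_Suc:
  "dyadic_max x (Suc r) i \<omega> \<le> max (dyadic_max x r i \<omega>) (dyadic_max x r (i + 2 ^ r) \<omega>) + \<bar>x (i + 2 ^ r) \<omega> - x i \<omega>\<bar>"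
proof (rule dyadic_max_least)
  fix j :: nat assume j: "j \<le> 2 ^ Suc r"
  show "\<bar>x (i + j) \<omega> - x i \<omega>\<bar> \<le> max (dyadic_max x r i \<omega>) (dyadic_max x r (i + 2 ^ r) \<omega>) + \<bar>x (i + 2 ^ r) \<omega> - x i \<omega>\<bar>"
  proof (cases "j \<le> 2 ^ r")
    case True
    then show ?thesis using dyadic_max_ge[of j r x i \<omega>] by linarith
  next
    case False
    then have "i + 2 ^ r + (j - 2 ^ r) = i + j" "j - 2 ^ r \<le> 2 ^ r" using j by auto
    then have "\<bar>x (i + j) \<omega> - x (i + 2 ^ r) \<omega>\<bar> \<le> dyadic_max x r (i + 2 ^ r) \<omega>"
      using dyadic_max_ge[of "j - 2 ^ r" r x "i + 2 ^ r" \<omega>] by simp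
    then show ?thesis by linarith
  qed
qed

text \<open>Doubling a block costs two half blocks and one increment. The halves contribute the
  factor \<open>2 * l\<close>, which can be kept below \<open>2 powr \<gamma>\<close> because
  \<open>\<gamma> > 1\<close>. The constant is chosen before \<open>x\<close>, \<open>D\<close> and
  \<open>J\<close>, since in the application all three vary with \<open>n\<close>.\<close>

theorem dyadic_max_moment_bound:
  assumes p: "p > 0" and \<gamma>: "\<gamma> > 1"
  obtains K where "K > 0" "\<And>x D J r i. (\<And>j. x j \<in> borel_measurable M) \<Longrightarrow>
    (\<And>i j. integrable M (\<lambda>\<omega>. \<bar>x (i + j) \<omega> - x i \<omega>\<bar> powr p)) \<Longrightarrow> D \<ge> 0 \<Longrightarrow>
    (\<And>i j. 1 \<le> j \<Longrightarrow> j \<le> J \<Longrightarrow> expectation (\<lambda>\<omega>. \<bar>x (i + j) \<omega> - x i \<omega>\<bar> powr p) \<le> D * real j powr \<gamma>) \<Longrightarrow>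
    2 ^ r \<le> J \<Longrightarrow> integrable M (\<lambda>\<omega>. dyadic_max x r i \<omega> powr p) \<and>
    expectation (\<lambda>\<omega>. dyadic_max x r i \<omega> powr p) \<le> K * D * real (2 ^ r) powr \<gamma>"
proof -
  have g2: "(2::real) powr \<gamma> > 2 powr 1" using \<gamma> by (intro powr_less_mono) auto
  \<comment> \<open>\<open>2 * l\<close> is the midpoint between 2 and
    \<open>2 powr \<gamma>\<close>.\<close>
  define l where "l = (2 + 2 powr \<gamma>) / 4"
  have l: "l > 1" "2 * l < 2 powr \<gamma>" using g2 by (auto simp: l_def)
  obtain C where C: "C > 0" "\<And>a b. 0 \<le> a \<Longrightarrow> 0 \<le> b \<Longrightarrow> (a + b) powr p \<le> l * a powr p + C * b powr p"
    using powr_add_le_split[OF p l(1)] by blast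
  \<comment> \<open>Solves \<open>2 * l * K + C \<le> 2 powr \<gamma> * K\<close>, the condition for
    the induction to reproduce its constant; being at least 1 settles single steps.\<close>
  define K where "K = max 1 (C / (2 powr \<gamma> - 2 * l))"
  have K: "K \<ge> 1" by (simp add: K_def)
  have "C / (2 powr \<gamma> - 2 * l) \<le> K" by (simp add: K_def)
  then have KC: "2 * l * K + C \<le> 2 powr \<gamma> * K" using l by (simp add: field_simps)
  show thesis
  proof (rule that)
    show "K > 0" using K by simp
    fix x D J r i
    assume xm: "\<And>j. x j \<in> borel_measurable M"
      and xi: "\<And>i j. integrable M (\<lambda>\<omega>. \<bar>x (i + j) \<omega> - x i \<omega>\<bar> powr p)" and D: "D \<ge> 0"
      and xe: "\<And>i j. 1 \<le> j \<Longrightarrow> j \<le> J \<Longrightarrow> expectation (\<lambda>\<omega>. \<bar>x (i + j) \<omega> - x i \<omega>\<bar> powr p) \<le> D * real j powr \<gamma>"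
      and J: "2 ^ r \<le> J"
    note xm [measurable]
    show "integrable M (\<lambda>\<omega>. dyadic_max x r i \<omega> powr p) \<and>
      expectation (\<lambda>\<omega>. dyadic_max x r i \<omega> powr p) \<le> K * D * real (2 ^ r) powr \<gamma>"
      using J
    proof (induction r arbitrary: i)
      case 0
      have "dyadic_max x 0 i \<omega> = \<bar>x (i + 1) \<omega> - x i \<omega>\<bar>" for \<omega>
      proof (rule antisym)
        show "dyadic_max x 0 i \<omega> \<le> \<bar>x (i + 1) \<omega> - x i \<omega>\<bar>"
        proof (rule dyadic_max_least)
          fix j :: nat assume "j \<le> 2 ^ 0"
          then have "j = 0 \<or> j = 1" by auto
          then show "\<bar>x (i + j) \<omega> - x i \<omega>\<bar> \<le> \<bar>x (i + 1) \<omega> - x i \<omega>\<bar>" by auto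
        qed
        show "\<bar>x (i + 1) \<omega> - x i \<omega>\<bar> \<le> dyadic_max x 0 i \<omega>" by (rule dyadic_max_ge) simp
      qed
      moreover have "D * 1 \<le> K * D" using mult_right_mono[OF K D] by simp
      moreover have "expectation (\<lambda>\<omega>. \<bar>x (i + 1) \<omega> - x i \<omega>\<bar> powr p) \<le> D" using xe[of 1 i] 0 by simp
      ultimately show ?case using xi[of i 1] by simp
    next
      case (Suc r)
      have J': "2 ^ r \<le> J" using Suc.prems by simp
      note IH = Suc.IH[OF J']
      define U where "U \<omega> = l * (dyadic_max x r i \<omega> powr p + dyadic_max x r (i + 2 ^ r) \<omega> powr p) + C * \<bar>x (i + 2 ^ r) \<omega> - x i \<omega>\<bar> powr p" for \<omega>
      have U: "integrable M U" unfolding U_def[abs_def] using IH xi by auto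
      have le: "dyadic_max x (Suc r) i \<omega> powr p \<le> U \<omega>" for \<omega>
      proof -
        let ?a = "dyadic_max x r i \<omega>" and ?b = "dyadic_max x r (i + 2 ^ r) \<omega>"
        have "dyadic_max x (Suc r) i \<omega> powr p \<le> (max ?a ?b + \<bar>x (i + 2 ^ r) \<omega> - x i \<omega>\<bar>) powr p"
          using p dyadic_max_nonneg dyadic_max_Suc by (intro powr_mono2) auto
        also have "\<dots> \<le> l * max ?a ?b powr p + C * \<bar>x (i + 2 ^ r) \<omega> - x i \<omega>\<bar> powr p"
          using dyadic_max_nonneg[of x r i \<omega>] by (intro C) auto
        also have "max ?a ?b powr p \<le> ?a powr p + ?b powr p" by (auto simp: max_def)
        finally show ?thesis using l by (simp add: U_def)
      qed
      have int: "integrable M (\<lambda>\<omega>. dyadic_max x (Suc r) i \<omega> powr p)"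
        by (rule Bochner_Integration.integrable_bound[OF U]) (use order_trans[OF le abs_ge_self] in auto)
      have "expectation (\<lambda>\<omega>. dyadic_max x (Suc r) i \<omega> powr p) \<le> expectation U"
        by (intro integral_mono int U le)
      also have "\<dots> = l * (expectation (\<lambda>\<omega>. dyadic_max x r i \<omega> powr p) + expectation (\<lambda>\<omega>. dyadic_max x r (i + 2 ^ r) \<omega> powr p))
          + C * expectation (\<lambda>\<omega>. \<bar>x (i + 2 ^ r) \<omega> - x i \<omega>\<bar> powr p)"
        unfolding U_def[abs_def] using IH xi by simp
      also have "\<dots> \<le> l * (K * D * real (2 ^ r) powr \<gamma> + K * D * real (2 ^ r) powr \<gamma>) + C * (D * real (2 ^ r) powr \<gamma>)"
        using IH l C xe[of "2 ^ r" i] J' by (intro add_mono mult_left_mono) auto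
      also have "\<dots> = (2 * l * K + C) * (D * real (2 ^ r) powr \<gamma>)" by (simp add: algebra_simps)
      also have "\<dots> \<le> (2 powr \<gamma> * K) * (D * real (2 ^ r) powr \<gamma>)"
        using KC D by (intro mult_right_mono) auto
      also have "\<dots> = K * D * (2 * real (2 ^ r)) powr \<gamma>" by (simp add: powr_mult)
      finally show ?case using int by simp
    qed
  qed
qed

end

section \<open>The normalized partial sum process\<close>

context fractional_sum
begin

text \<open>For \<open>n = 0\<close> the norm vanishes, and division by it yields the zero
  path.\<close>

definition normalized_path :: "nat \<Rightarrow> 'a \<Rightarrow> real \<Rightarrow> real" where
  "normalized_path n \<omega> = step_path n (\<lambda>i. S i \<omega> / s n)"

lemma normalized_path_eq: "t \<in> {0..1} \<Longrightarrow> normalized_path n \<omega> t = S (nat \<lfloor>real n * t\<rfloor>) \<omega> / s n"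
  by (simp add: normalized_path_def step_path_def)

lemma S_second_moment: "integrable M (\<lambda>\<omega>. (S n \<omega>)\<^sup>2)" "expectation (\<lambda>\<omega>. (S n \<omega>)\<^sup>2) = (s n)\<^sup>2"
proof -
  have c: "l2 (sum_coeff a n)" by (rule l2_sum_coeff[OF l2_a])
  have ae: "AE \<omega> in M. (series (sum_coeff a n) \<omega>)\<^sup>2 = (S n \<omega>)\<^sup>2"
    using AE_S[of n] by eventually_elim simp
  show "integrable M (\<lambda>\<omega>. (S n \<omega>)\<^sup>2)"
    by (rule integrable_cong_AE_imp[OF integrable_series_square[OF c] _ ae]) simp
  have "expectation (\<lambda>\<omega>. (series (sum_coeff a n) \<omega>)\<^sup>2) = expectation (\<lambda>\<omega>. (S n \<omega>)\<^sup>2)"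
    by (rule integral_cong_AE[OF _ _ ae]) auto
  then show "expectation (\<lambda>\<omega>. (S n \<omega>)\<^sup>2) = (s n)\<^sup>2"
    using second_moment_series[OF c] by (simp add: s_def l2norm_power2)
qed

theorem skeleton_expectation_tendsto:
  fixes \<Phi> :: "(nat \<Rightarrow> real) \<Rightarrow> real"
  assumes B: "fractional_BM_on {0..1} H N B" and m: "m \<ge> 1"
    and \<Phi>: "continuous_on UNIV \<Phi>" "\<And>x. \<bar>\<Phi> x\<bar> \<le> b"
  shows "(\<lambda>n. \<integral>\<omega>. \<Phi> (skeleton m (normalized_path n \<omega>)) \<partial>M) \<longlonglongrightarrow>
    (\<integral>\<omega>. \<Phi> (skeleton m (\<lambda>t\<in>{0..1}. B t \<omega>)) \<partial>N)"
proof -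
  obtain C where C: "\<And>m n. m \<le> n \<Longrightarrow> s m \<le> C * s n" using s_bounded_by_last by blast
  define t where "t i = real i / real m" for i
  have t: "t i \<in> {0..1}" if "i \<le> m" for i using that m by (simp add: t_def)
  have tinj: "inj_on t {..m}" using m by (auto simp: inj_on_def t_def)
  have tI: "t ` {..m} \<subseteq> {0..1}" using t by auto
  have N: "prob_space N" using B by (simp add: fractional_BM_on_def)
  have Bm: "B u \<in> borel_measurable N" "integrable N (\<lambda>\<omega>. (B u \<omega>)\<^sup>2)" if "u \<in> {0..1}" for u
    using fractional_BM_char(2,3)[OF B finite_atMost tinj tI that] by auto
  have X: "skeleton m (normalized_path n \<omega>) i = (if i \<le> m then S (nat \<lfloor>real n * t i\<rfloor>) \<omega> / s n else 0)" for n \<omega> i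
    using t[of i] by (simp add: skeleton_def t_def[symmetric] normalized_path_eq)
  have Z: "skeleton m (\<lambda>t\<in>{0..1}. B t \<omega>) i = (if i \<le> m then B (t i) \<omega> else 0)" for \<omega> i
    using t[of i] by (simp add: skeleton_def t_def[symmetric])
  \<comment> \<open>One bound for all second moments: normalized partial sums are controlled by
    \<open>s_bounded_by_last\<close>, the limit by the sum over the grid.\<close>
  define V where "V = max (C\<^sup>2) (\<Sum>i\<le>m. \<integral>\<omega>. (B (t i) \<omega>)\<^sup>2 \<partial>N)"
  have V0: "V \<ge> 0" unfolding V_def by (simp add: max.coboundedI1)
  show ?thesis
  proof (rule char_tendsto_imp_expectation_tendsto[where d = m and V = V and \<Phi> = \<Phi> and B = b
      and X = "\<lambda>n \<omega>. skeleton m (normalized_path n \<omega>)" and Z = "\<lambda>\<omega>. skeleton m (\<lambda>t\<in>{0..1}. B t \<omega>)"])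
    show "prob_space M" by (rule prob_space_axioms)
    show "(\<lambda>\<omega>. skeleton m (normalized_path n \<omega>)) \<in> borel_measurable M" for n
      by (rule measurable_coordinatewise_then_product) (simp add: X)
    show "(\<lambda>\<omega>. skeleton m (\<lambda>t\<in>{0..1}. B t \<omega>)) \<in> borel_measurable N"
    proof (rule measurable_coordinatewise_then_product)
      fix i
      show "(\<lambda>\<omega>. skeleton m (\<lambda>t\<in>{0..1}. B t \<omega>) i) \<in> borel_measurable N"
        unfolding Z using Bm(1)[OF t[of i]] by (cases "i \<le> m") auto
    qed
    show "integrable M (\<lambda>\<omega>. (skeleton m (normalized_path n \<omega>) i)\<^sup>2)" for n i
      unfolding X using S_second_moment(1) by (cases "i \<le> m") (simp_all add: power_divide)
    show "(\<integral>\<omega>. (skeleton m (normalized_path n \<omega>) i)\<^sup>2 \<partial>M) \<le> V" for n i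
    proof (cases "i \<le> m")
      case True
      have "s (nat \<lfloor>real n * t i\<rfloor>) \<le> C * s n"
        by (intro C nat_floor_le t True)
      then have "s (nat \<lfloor>real n * t i\<rfloor>) / s n \<le> \<bar>C\<bar>"
        using s_nonneg[of n] by (cases "s n = 0") (auto simp: pos_divide_le_eq intro: order_trans mult_right_mono)
      then have "(s (nat \<lfloor>real n * t i\<rfloor>) / s n)\<^sup>2 \<le> \<bar>C\<bar>\<^sup>2"
        using s_nonneg by (intro power_mono) auto
      then show ?thesis unfolding X using True S_second_moment(2) by (simp add: power_divide V_def)
    qed (simp add: X V0)
    show "integrable N (\<lambda>\<omega>. (skeleton m (\<lambda>t\<in>{0..1}. B t \<omega>) i)\<^sup>2)" for i
      unfolding Z using Bm(2)[OF t[of i]] by (cases "i \<le> m") auto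
    show "(\<integral>\<omega>. (skeleton m (\<lambda>t\<in>{0..1}. B t \<omega>) i)\<^sup>2 \<partial>N) \<le> V" for i
    proof (cases "i \<le> m")
      case True
      have "(\<integral>\<omega>. (B (t i) \<omega>)\<^sup>2 \<partial>N) \<le> (\<Sum>i\<le>m. \<integral>\<omega>. (B (t i) \<omega>)\<^sup>2 \<partial>N)"
        by (rule member_le_sum) (use True in auto)
      then show ?thesis unfolding Z using True by (simp add: V_def)
    qed (simp add: Z V0)
    show "(\<lambda>n. \<integral>\<omega>. iexp (\<Sum>i\<le>m. \<theta> i * skeleton m (normalized_path n \<omega>) i) \<partial>M) \<longlonglongrightarrow>
       (\<integral>\<omega>. iexp (\<Sum>i\<le>m. \<theta> i * skeleton m (\<lambda>t\<in>{0..1}. B t \<omega>) i) \<partial>N)" for \<theta>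
    proof -
      have 1: "(\<Sum>i\<le>m. \<theta> i * skeleton m (normalized_path n \<omega>) i) = (\<Sum>i\<in>{..m}. \<theta> i * (S (nat \<lfloor>real n * t i\<rfloor>) \<omega> / s n))" for n \<omega>
        unfolding X by (intro sum.cong) auto
      have 2: "(\<Sum>i\<le>m. \<theta> i * skeleton m (\<lambda>t\<in>{0..1}. B t \<omega>) i) = (\<Sum>i\<in>{..m}. \<theta> i * B (t i) \<omega>)" for \<omega>
        unfolding Z by (intro sum.cong) auto
      show ?thesis
        unfolding 1 2 fractional_BM_char(1)[OF B finite_atMost tinj tI] fbm_cov_def[symmetric]
        by (rule char_fdd_tendsto) (use t in auto)
    qed
  qed (use N \<Phi> in \<open>auto simp: X Z\<close>)
qed

text \<open>A grid cell spans about \<open>n / m\<close> steps and fits into a dyadic block of at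
  most \<open>4 * (n / m)\<close> steps. The moment of its oscillation is at most a constant times
  \<open>(4 / m) powr \<gamma>\<close>, uniformly in \<open>n \<ge> m\<close>, and summing over
  \<open>m + 1\<close> cells leaves the order \<open>m powr (1 - \<gamma>)\<close>.\<close>

theorem skeleton_modulus:
  assumes p: "p \<ge> 2" "p * H > 1" and m: "integrable M (\<lambda>\<omega>. \<bar>\<xi> l \<omega>\<bar> powr p)" and e: "e > 0"
  shows "\<forall>\<^sub>F m in sequentially. \<forall>\<^sub>F n in sequentially.
      \<exists>U. integrable M U \<and>
        (\<forall>\<omega>\<in>space M. unif_dist (normalized_path n \<omega>) (step_path m (skeleton m (normalized_path n \<omega>))) \<le> U \<omega>) \<and>
        (\<integral>\<omega>. U \<omega> \<partial>M) \<le> e"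
proof -
  obtain K1 where K1: "K1 > 0" "\<And>i j. integrable M (\<lambda>\<omega>. \<bar>S (i + j) \<omega> - S i \<omega>\<bar> powr p)"
    "\<And>i j. expectation (\<lambda>\<omega>. \<bar>S (i + j) \<omega> - S i \<omega>\<bar> powr p) \<le> K1 * s j powr p"
    using increment_moment_bound[OF p(1) m] by blast
  have "1 / p < H" using p by (simp add: field_simps)
  then obtain \<beta> where \<beta>: "1 / p < \<beta>" "\<beta> < H" using dense by blast
  have "0 < 1 / p" using p by simp
  then have \<beta>: "0 < \<beta>" "\<beta> < H" "1 / p < \<beta>" using \<beta> by (blast intro: less_trans)+
  define \<gamma> where "\<gamma> = \<beta> * p"
  have \<gamma>: "\<gamma> > 1" using \<beta>(3) p by (simp add: \<gamma>_def field_simps)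
  obtain C where C: "C > 0"
    "\<And>m n. 1 \<le> m \<Longrightarrow> m \<le> n \<Longrightarrow> s m \<le> C * (real m / real n) powr \<beta> * s n"
    using potter_bound[OF \<beta>(1,2)] by blast
  have p0: "p > 0" using p by simp
  obtain K2 where K2: "K2 > 0" "\<And>x D J r i. (\<And>j. x j \<in> borel_measurable M) \<Longrightarrow>
    (\<And>i j. integrable M (\<lambda>\<omega>. \<bar>x (i + j) \<omega> - x i \<omega>\<bar> powr p)) \<Longrightarrow> D \<ge> 0 \<Longrightarrow>
    (\<And>i j. 1 \<le> j \<Longrightarrow> j \<le> J \<Longrightarrow> expectation (\<lambda>\<omega>. \<bar>x (i + j) \<omega> - x i \<omega>\<bar> powr p) \<le> D * real j powr \<gamma>) \<Longrightarrow>
    2 ^ r \<le> J \<Longrightarrow> integrable M (\<lambda>\<omega>. dyadic_max x r i \<omega> powr p) \<and>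
    expectation (\<lambda>\<omega>. dyadic_max x r i \<omega> powr p) \<le> K2 * D * real (2 ^ r) powr \<gamma>"
    using dyadic_max_moment_bound[OF p0 \<gamma>] by blast
  define K where "K = K2 * (K1 * C powr p)"
  have K: "K > 0" using K1 K2 C by (simp add: K_def)
  define x where "x n i \<omega> = S i \<omega> / s n" for n i \<omega>
  have x_meas: "x n i \<in> borel_measurable M" for n i unfolding x_def[abs_def] by simp
  have x_diff: "\<bar>x n (i + j) \<omega> - x n i \<omega>\<bar> powr p = \<bar>S (i + j) \<omega> - S i \<omega>\<bar> powr p / s n powr p" for n i j \<omega>
    using s_nonneg[of n] by (simp add: x_def diff_divide_distrib[symmetric] abs_divide powr_divide)
  have x_int: "integrable M (\<lambda>\<omega>. \<bar>x n (i + j) \<omega> - x n i \<omega>\<bar> powr p)" for n i j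
    unfolding x_diff using K1(2) by simp
  have x_exp: "expectation (\<lambda>\<omega>. \<bar>x n (i + j) \<omega> - x n i \<omega>\<bar> powr p) \<le> (K1 * C powr p / real n powr \<gamma>) * real j powr \<gamma>"
    if j: "1 \<le> j" "j \<le> n" for n i j
  proof -
    have sn: "s n > 0" using j by (intro s_pos) auto
    have "expectation (\<lambda>\<omega>. \<bar>x n (i + j) \<omega> - x n i \<omega>\<bar> powr p) \<le> K1 * s j powr p / s n powr p"
      unfolding x_diff using K1(3)[of i j] by (simp add: divide_right_mono)
    also have "\<dots> \<le> K1 * (C * (real j / real n) powr \<beta> * s n) powr p / s n powr p"
      using K1 s_nonneg[of j] p C(2)[OF j] by (intro divide_right_mono mult_left_mono powr_mono2) auto
    also have "(C * (real j / real n) powr \<beta> * s n) powr p = C powr p * (real j / real n) powr \<gamma> * s n powr p"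
      unfolding powr_mult by (simp add: \<gamma>_def powr_powr)
    finally show ?thesis using sn by (simp add: powr_divide)
  qed
  have dm: "integrable M (\<lambda>\<omega>. dyadic_max (x n) r i \<omega> powr p) \<and>
      expectation (\<lambda>\<omega>. dyadic_max (x n) r i \<omega> powr p) \<le> K * (real (2 ^ r) / real n) powr \<gamma>" if "2 ^ r \<le> n" for n r i
  proof -
    have "integrable M (\<lambda>\<omega>. dyadic_max (x n) r i \<omega> powr p) \<and>
      expectation (\<lambda>\<omega>. dyadic_max (x n) r i \<omega> powr p) \<le> K2 * (K1 * C powr p / real n powr \<gamma>) * real (2 ^ r) powr \<gamma>"
      by (rule K2(2)[OF x_meas x_int _ x_exp that]) (use K1 in auto)
    then show ?thesis by (simp add: K_def powr_divide)
  qed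
  \<comment> \<open>Half of \<open>e\<close> is granted to small oscillations; the other half bounds
    the moments of order \<open>p\<close>, weighted by
    \<open>\<epsilon> powr (1 - p)\<close>.\<close>
  define \<epsilon> where "\<epsilon> = e / 2"
  have \<epsilon>: "\<epsilon> > 0" using e by (simp add: \<epsilon>_def)
  have lim: "(\<lambda>m. \<epsilon> powr (1 - p) * K * 4 powr \<gamma> * 2 * real m powr (1 - \<gamma>)) \<longlonglongrightarrow> \<epsilon> powr (1 - p) * K * 4 powr \<gamma> * 2 * 0"
    by (intro tendsto_mult tendsto_const tendsto_neg_powr filterlim_real_sequentially) (use \<gamma> in auto)
  then have "\<forall>\<^sub>F m in sequentially. \<epsilon> powr (1 - p) * K * 4 powr \<gamma> * 2 * real m powr (1 - \<gamma>) < e / 2"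
    by (rule order_tendstoD) (use e in auto)
  then show ?thesis
    \<comment> \<open>From \<open>m \<ge> 4\<close> on, the dyadic block length stays at most
      \<open>n\<close>, the range in which the moment bound holds.\<close>
    using eventually_ge_at_top[of 4]
  proof eventually_elim
    case (elim m)
    have m0: "m \<ge> 1" "m > 0" using elim by auto
    show ?case
      using eventually_ge_at_top[of m]
    proof eventually_elim
      case n: (elim n)
      \<comment> \<open>The added 1 allows for the floors at both ends of a grid cell. Rounding up
        to a power of two then loses a factor 2, and so does the added 1 itself.\<close>
      define q where "q = n div m + 1"
      have "n div m \<ge> 1" using n m0 by (simp add: div_greater_zero_iff Suc_le_eq)
      then have "q \<ge> 2" by (simp add: q_def)
      then obtain r' where "2 ^ r' < q" "q \<le> 2 ^ (r' + 1)" using ex_power_ivl2[of 2 q] by auto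
      then obtain r where r: "q \<le> 2 ^ r" "2 ^ r < 2 * q" by (intro that[of "r' + 1"]) auto
      have "\<lfloor>real n / real m\<rfloor> = int (n div m)" by (rule floor_divide_of_nat_eq)
      then have nm: "real (n div m) \<le> real n / real m" "real n / real m < real (n div m) + 1"
        by (simp_all add: floor_eq_iff)
      then have "real q \<le> real n / real m + 1" by (simp add: q_def)
      also have "\<dots> \<le> 2 * (real n / real m)" using n m0 by (simp add: field_simps)
      finally have "real q \<le> 2 * (real n / real m)" .
      moreover have "real (2 ^ r) \<le> 2 * real q" using r(2) by (metis less_imp_le of_nat_le_iff of_nat_mult of_nat_numeral)
      ultimately have "real (2 ^ r) \<le> 4 * (real n / real m)" by linarith
      then have rr: "real (2 ^ r) / real n \<le> 4 / real m" using n m0 by (simp add: field_simps)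
      also have "4 / real m \<le> 1" using elim(2) by simp
      finally have "real (2 ^ r) / real n \<le> 1" .
      then have "real (2 ^ r) \<le> real n" using n m0 by (simp add: field_simps)
      then have rn: "2 ^ r \<le> n" by (simp only: of_nat_le_iff)
      define b where "b k = nat \<lfloor>real n * (real k / real m)\<rfloor>" for k
      \<comment> \<open>The sum over all blocks replaces their maximum, so one integrable variable
        serves all \<open>t\<close>.\<close>
      define U where "U \<omega> = \<epsilon> + \<epsilon> powr (1 - p) * (\<Sum>k\<le>m. dyadic_max (x n) r (b k) \<omega> powr p)" for \<omega>
      have "integrable M U"
        unfolding U_def[abs_def] using dm[OF rn] by auto
      moreover have "unif_dist (normalized_path n \<omega>) (step_path m (skeleton m (normalized_path n \<omega>))) \<le> U \<omega>" for \<omega>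
      proof (rule unif_dist_le)
        fix t :: real assume t: "t \<in> {0..1}"
        define k where "k = nat \<lfloor>real m * t\<rfloor>"
        define j where "j = nat \<lfloor>real n * t\<rfloor> - b k"
        have km: "k \<le> m" unfolding k_def by (rule nat_floor_le[OF t])
        have k_in: "real k / real m \<in> {0..1}" using km m0 by simp
        have kt: "real k \<le> real m * t" "real m * t < real k + 1" using t by (auto simp: k_def)
        have kt': "real k / real m \<le> t" "t \<le> real k / real m + 1 / real m"
          using kt m0 by (simp_all add: field_simps)
        have bt: "b k \<le> nat \<lfloor>real n * t\<rfloor>"
          unfolding b_def using kt' by (intro nat_mono floor_mono mult_left_mono) auto
        have "real n * t \<le> real n * (real k / real m) + real n / real m"
          using mult_left_mono[OF kt'(2), of "real n"] by (simp add: distrib_left)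
        moreover have "real (nat \<lfloor>real n * t\<rfloor>) \<le> real n * t" using t by simp
        moreover have "real n * (real k / real m) < real (b k) + 1"
          unfolding b_def by linarith
        ultimately have "real (nat \<lfloor>real n * t\<rfloor>) < real (b k) + 1 + real n / real m" by linarith
        then have "real j < real n / real m + 1" using bt by (simp add: j_def of_nat_diff)
        also have "real n / real m < real (n div m) + 1"
          by (rule nm)
        finally have "j \<le> q" by (simp add: q_def)
        then have jr: "j \<le> 2 ^ r" using r(1) by simp
        have bj: "b k + j = nat \<lfloor>real n * t\<rfloor>" using bt by (simp add: j_def)
        define z where "z = dyadic_max (x n) r (b k) \<omega>"
        have z0: "z \<ge> 0" unfolding z_def by (rule dyadic_max_nonneg)
        have "\<bar>normalized_path n \<omega> t - step_path m (skeleton m (normalized_path n \<omega>)) t\<bar> = \<bar>x n (b k + j) \<omega> - x n (b k) \<omega>\<bar>"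
          unfolding step_path_skeleton[OF t] k_def[symmetric] normalized_path_eq[OF t] normalized_path_eq[OF k_in] bj x_def unfolding b_def ..
        also have "\<dots> \<le> z" unfolding z_def by (rule dyadic_max_ge[OF jr])
        \<comment> \<open>Where \<open>z\<close> exceeds \<epsilon>, the factor
          \<open>(z / \<epsilon>) powr (p - 1)\<close> is at least 1.\<close>
        also have "z \<le> \<epsilon> + \<epsilon> powr (1 - p) * z powr p"
        proof (cases "z \<le> \<epsilon>")
          case False
          then have "\<epsilon> powr (p - 1) \<le> z powr (p - 1)" using \<epsilon> p by (intro powr_mono2) auto
          then have "z * \<epsilon> powr (p - 1) \<le> z * z powr (p - 1)" using z0 by (intro mult_left_mono)
          also have "z * z powr (p - 1) = z powr p" using False \<epsilon> by (simp add: powr_mult_base)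
          finally have "z * \<epsilon> powr (p - 1) * \<epsilon> powr (1 - p) \<le> z powr p * \<epsilon> powr (1 - p)"
            by (intro mult_right_mono) auto
          also have "z * \<epsilon> powr (p - 1) * \<epsilon> powr (1 - p) = z"
            using \<epsilon> by (simp add: mult.assoc powr_add[symmetric])
          finally show ?thesis using \<epsilon> by (simp add: mult.commute)
        next
          case True
          have "0 \<le> \<epsilon> powr (1 - p) * z powr p" by simp
          then show ?thesis using True by linarith
        qed
        also have "\<dots> \<le> U \<omega>"
          unfolding U_def z_def using km
          by (intro add_left_mono mult_left_mono member_le_sum[of k "{..m}" "\<lambda>k. dyadic_max (x n) r (b k) \<omega> powr p"]) auto
        finally show "\<bar>normalized_path n \<omega> t - step_path m (skeleton m (normalized_path n \<omega>)) t\<bar> \<le> U \<omega>" .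
      qed
      moreover have "expectation U \<le> e"
      proof -
        have "expectation U = \<epsilon> + \<epsilon> powr (1 - p) * (\<Sum>k\<le>m. expectation (\<lambda>\<omega>. dyadic_max (x n) r (b k) \<omega> powr p))"
          unfolding U_def[abs_def] using dm[OF rn] by (simp add: prob_space Bochner_Integration.integral_sum)
        also have "\<dots> \<le> \<epsilon> + \<epsilon> powr (1 - p) * (\<Sum>k\<le>m. K * (4 / real m) powr \<gamma>)"
        proof (intro add_left_mono mult_left_mono sum_mono)
          fix k
          have "expectation (\<lambda>\<omega>. dyadic_max (x n) r (b k) \<omega> powr p) \<le> K * (real (2 ^ r) / real n) powr \<gamma>"
            using dm[OF rn] by blast
          also have "\<dots> \<le> K * (4 / real m) powr \<gamma>"
            using K \<gamma> rr by (intro mult_left_mono powr_mono2) auto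
          finally show "expectation (\<lambda>\<omega>. dyadic_max (x n) r (b k) \<omega> powr p) \<le> K * (4 / real m) powr \<gamma>" .
        qed auto
        also have "(\<Sum>k\<le>m. K * (4 / real m) powr \<gamma>) = (real m + 1) * (K * (4 / real m) powr \<gamma>)" by simp
        also have "\<dots> \<le> (2 * real m) * (K * (4 / real m) powr \<gamma>)"
          using m0 K by (intro mult_right_mono) auto
        also have "\<dots> = K * 4 powr \<gamma> * 2 * real m powr (1 - \<gamma>)"
          using m0 by (simp add: powr_divide powr_diff)
        finally have "expectation U \<le> \<epsilon> + \<epsilon> powr (1 - p) * (K * 4 powr \<gamma> * 2 * real m powr (1 - \<gamma>))"
          by (simp add: mult_left_mono)
        also have "\<epsilon> powr (1 - p) * (K * 4 powr \<gamma> * 2 * real m powr (1 - \<gamma>)) \<le> e / 2"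
          using elim(1) by (simp add: mult_ac)
        finally show ?thesis by (simp add: \<epsilon>_def)
      qed
      ultimately show ?case by blast
    qed
  qed
qed

theorem normalized_path_C_converges:
  assumes B: "fractional_BM_on {0..1} H N B"
    and p: "p \<ge> 2" "p * H > 1" and m: "integrable M (\<lambda>\<omega>. \<bar>\<xi> l \<omega>\<bar> powr p)"
  shows "C_converges M normalized_path N (\<lambda>\<omega>. \<lambda>t\<in>{0..1}. B t \<omega>)"
proof -
  interpret N: prob_space N using B by (simp add: fractional_BM_on_def)
  have "skeleton_approx M N normalized_path (\<lambda>\<omega>. \<lambda>t\<in>{0..1}. B t \<omega>)"
  proof
    show "normalized_path n \<in> measurable M skorokhod_borel" for n
      unfolding normalized_path_def[abs_def] by (rule measurable_step_path) simp
    show "(\<lambda>\<omega>. normalized_path n \<omega> t) \<in> borel_measurable M" if "t \<in> {0..1}" for n t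
      unfolding normalized_path_eq[OF that] by simp
    show "(\<lambda>t\<in>{0..1}. B t \<omega>) \<in> C01" if "\<omega> \<in> space N" for \<omega>
    proof -
      have "continuous_on {0..1} (\<lambda>t. B t \<omega>)" using B that by (auto simp: fractional_BM_on_def)
      then have "continuous_on {0..1} (\<lambda>t\<in>{0..1}. B t \<omega>)"
        by (rule continuous_on_eq) simp
      then show ?thesis by (simp add: C01_def)
    qed
    show "(\<lambda>\<omega>. (\<lambda>t\<in>{0..1}. B t \<omega>) t) \<in> borel_measurable N" if "t \<in> {0..1}" for t
      \<comment> \<open>The empty index set meets the conditions on the grid; only measurability of
        \<open>B t\<close> is wanted.\<close>
      using fractional_BM_char(3)[OF B, of "{}" "\<lambda>_. 0" t] that by simp
  qed (use skeleton_expectation_tendsto[OF B] skeleton_modulus[OF p m] in blast)+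
  then show ?thesis by (rule skeleton_approx.C_convergesI)
qed

end

theorem proposition1:
  fixes M :: "'a measure" and \<xi> :: "int \<Rightarrow> 'a \<Rightarrow> real" and a :: "int \<Rightarrow> real"
    and H \<alpha> :: real and h :: "real \<Rightarrow> real"
    and N :: "'b measure" and B :: "real \<Rightarrow> 'b \<Rightarrow> real"
  assumes "prob_space M"
    and "iid M \<xi>"
    and "\<And>k. integrable M (\<xi> k)"
    and "\<And>k. prob_space.expectation M (\<xi> k) = 0"
    and "\<And>k. prob_space.variance M (\<xi> k) = 1"
    and "(\<lambda>k. (a k)\<^sup>2) summable_on UNIV"
    and "0 < H" and "H < 1"
    and "\<And>x. x > 0 \<Longrightarrow> h x > 0"
    and "slowly_varying h"
    and "\<And>n::nat. n \<ge> 1 \<Longrightarrow>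
           prob_space.variance M (linear_process_sum a \<xi> n) = (h (real n))\<^sup>2 * real n powr (2 * H)"
    and "\<alpha> \<ge> 2" and "\<alpha> * H > 1"
    and "integrable M (\<lambda>\<omega>. \<bar>\<xi> 1 \<omega>\<bar> powr \<alpha>)"
    and "fractional_BM_on {0..1} H N B"
  shows "C_converges M
           (\<lambda>n \<omega>. \<lambda>t\<in>{0..1}. linear_process_sum a \<xi> (nat \<lfloor>real n * t\<rfloor>) \<omega> /
                               sqrt (prob_space.variance M (linear_process_sum a \<xi> n)))
           N (\<lambda>\<omega>. \<lambda>t\<in>{0..1}. B t \<omega>)"
proof -
  interpret M: prob_space M by fact
  interpret fractional_sum M \<xi> a H h
  proof
    show "M.indep_vars (\<lambda>_. borel) \<xi> UNIV" "\<And>j k. distr M borel (\<xi> j) = distr M borel (\<xi> k)"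
      using assms(2) by (auto simp: iid_def)
    show "l2 a" using assms(6) by (simp add: l2_def)
  qed (fact assms)+
  \<comment> \<open>The variance is the square of \<open>s n\<close>, and nonnegativity of
    \<open>s\<close> lets the square root undo it.\<close>
  have "(\<lambda>n \<omega>. \<lambda>t\<in>{0..1}. linear_process_sum a \<xi> (nat \<lfloor>real n * t\<rfloor>) \<omega> /
      sqrt (prob_space.variance M (linear_process_sum a \<xi> n))) = normalized_path"
    using s_nonneg unfolding variance_S by (simp add: normalized_path_def step_path_def fun_eq_iff)
  then show ?thesis
    using normalized_path_C_converges[OF assms(15,12,13,14)] by simp
qed

end
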